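(* For the Robinson shift $X_{\rm Rob}$, $\mathrm{Sym}(X_{\rm Rob},\mathbb{Z}^2)\cong\mathbb{Z}^2\rtimes D_4$, where $D_4$ is the dihedral group of order $8$.
   Context: For a finite alphabet $\mathcal{A}$, $\mathcal{A}^{\mathbb{Z}^2}$ carries the product topology of the discrete topology and the shift action $(\sigma_{\vec{g}}(x))_{\vec{h}}=x_{\vec{h}-\vec{g}}$. An extended symmetry of a subshift $X\subseteq\mathcal{A}^{\mathbb{Z}^2}$ is a bijective continuous map $f:X\to X$ for which there is $A\in\mathrm{GL}_2(\mathbb{Z})$ with $f\circ\sigma_{\vec{p}}=\sigma_{A\vec{p}}\circ f$ for all $\vec{p}\in\mathbb{Z}^2$; these form the group $\mathrm{Sym}(X,\mathbb{Z}^2)$ under composition. Robinson tiles. Each tile is a unit square $[0,1]^2$ whose edges carry arrow heads and arrow tails, of two colors (black, red), at marked points. The five basic tiles are (markings listed by edge point): Tile 1: black tail at top $(\frac12,1)$, black head at bottom $(\frac12,0)$, black tails at left $(0,\frac12)$ and right $(1,\frac12)$. Tile 2: the markings of Tile 1, together with a red tail at $(\frac14,1)$, a red head at $(\frac14,0)$, and red tails at $(0,\frac14)$ and $(1,\frac14)$. Tile 3 (the cross): black heads at $(\frac12,1),(\frac12,0),(0,\frac12),(1,\frac12)$, and red heads at $(\frac14,1)$ and $(1,\frac14)$. Tile 4: the markings of Tile 1, together with red tails at $(0,\frac14)$ and $(1,\frac14)$. Tile 5: the markings of Tile 1, together with a red tail at $(\frac14,1)$ and a red head at $(\frac14,0)$.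 The alphabet consists of all rotations (by multiples of $\pi/2$) and reflections of these five tiles; this gives 28 symbols. Rotations of Tile 3 are called crosses. The Robinson shift $X_{\rm Rob}\subset\mathcal{A}^{\mathbb{Z}^2}$ is the set of configurations (the tile $x_{(i,j)}$ is placed on the square $[i,i+1]\times[j,j+1]$) such that: (1) on each edge shared by two adjacent tiles, every arrow head of one tile is in contact (same point, same color) with an arrow tail of the other tile, and every arrow tail is in contact with an arrow head; (2) there is $\vec{k}\in\mathbb{Z}^2$ such that all tiles at positions in $2\mathbb{Z}\times2\mathbb{Z}+\vec{k}$ are crosses; (3) any other cross is at a position in $2\mathbb{Z}\times2\mathbb{Z}+\vec{k}+(1,1)$. *)

theory Defs
  imports "HOL-Analysis.Analysis" "HOL-Algebra.Bij" "HOL-Algebra.Elementary_Groups"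
begin

type_synonym 'a config = "int^2 \<Rightarrow> 'a"

definition shift :: "int^2 \<Rightarrow> 'a config \<Rightarrow> 'a config" where
  "shift g x = (\<lambda>h. x (h - g))"

definition full_shift_topology :: "'a set \<Rightarrow> 'a config topology" where
  "full_shift_topology \<A> = product_topology (\<lambda>_. discrete_topology \<A>) UNIV"

definition GL2Z :: "(int^2^2) monoid" where
  "GL2Z = \<lparr>carrier = {A. invertible A}, mult = (**), one = mat 1\<rparr>"

definition extended_symmetry ::
    "'a set \<Rightarrow> 'a config set \<Rightarrow> ('a config \<Rightarrow> 'a config) \<Rightarrow> bool" where
  "extended_symmetry \<A> X f \<longleftrightarrow>
     bij_betw f X X \<and>
     continuous_map (subtopology (full_shift_topology \<A>) X)
       (subtopology (full_shift_topology \<A>) X) f \<and>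
     (\<exists>A \<in> carrier GL2Z. \<forall>p. \<forall>x\<in>X. f (shift p x) = shift (A *v p) (f x))"

text \<open>As in \<^const>\<open>BijGroup\<close>, a map from \<open>X\<close> to \<open>X\<close> is represented by the function that is
  extensional on \<open>X\<close>, and the operation is composition.\<close>

definition Sym :: "'a set \<Rightarrow> 'a config set \<Rightarrow> ('a config \<Rightarrow> 'a config) monoid" where
  "Sym \<A> X = BijGroup X \<lparr>carrier := {f \<in> Bij X. extended_symmetry \<A> X f}\<rparr>"

definition semidirect_product ::
    "('n, 'x) monoid_scheme \<Rightarrow> ('h, 'y) monoid_scheme \<Rightarrow> ('h \<Rightarrow> 'n \<Rightarrow> 'n) \<Rightarrow> ('n \<times> 'h) monoid"
  where
  "semidirect_product N H \<phi> =
     \<lparr>carrier = carrier N \<times> carrier H,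
      mult = (\<lambda>(n, h) (n', h'). (n \<otimes>\<^bsub>N\<^esub> \<phi> h n', h \<otimes>\<^bsub>H\<^esub> h')),
      one = (\<one>\<^bsub>N\<^esub>, \<one>\<^bsub>H\<^esub>)\<rparr>"

definition Z2 :: "(int^2) monoid" where
  "Z2 = \<lparr>carrier = UNIV, mult = (+), one = 0\<rparr>"

text \<open>The dihedral group of order 8 in its standard action on the square: it is generated by the
  rotation by \<open>\<pi>/2\<close> and the reflection in the vertical axis.\<close>

definition D4 :: "(int^2^2) monoid" where
  "D4 = subgroup_generated GL2Z
     {vector [vector [0, -1], vector [1, 0]], vector [vector [-1, 0], vector [0, 1]]}"

datatype colour = Black | Red
datatype arrow_end = Head | Tail

text \<open>A tile is the set of its markings; a marking consists of a point on the boundary of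
  \<open>[0,1]\<^sup>2\<close>, a colour and the kind of arrow end found there.\<close>

type_synonym marking = "(real \<times> real) \<times> colour \<times> arrow_end"
type_synonym tile = "marking set"

definition tile1 :: tile where
  "tile1 = {((1/2, 1), Black, Tail), ((1/2, 0), Black, Head),
            ((0, 1/2), Black, Tail), ((1, 1/2), Black, Tail)}"

definition tile2 :: tile where
  "tile2 = tile1 \<union> {((1/4, 1), Red, Tail), ((1/4, 0), Red, Head),
                    ((0, 1/4), Red, Tail), ((1, 1/4), Red, Tail)}"

definition tile3 :: tile where
  "tile3 = {((1/2, 1), Black, Head), ((1/2, 0), Black, Head),
            ((0, 1/2), Black, Head), ((1, 1/2), Black, Head),
            ((1/4, 1), Red, Head), ((1, 1/4), Red, Head)}"

definition tile4 :: tile where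
  "tile4 = tile1 \<union> {((0, 1/4), Red, Tail), ((1, 1/4), Red, Tail)}"

definition tile5 :: tile where
  "tile5 = tile1 \<union> {((1/4, 1), Red, Tail), ((1/4, 0), Red, Head)}"

text \<open>Quarter turn about the centre \<open>(1/2, 1/2)\<close> of the square, and reflection in its vertical
  midline; together they generate all rotations and reflections of the square.\<close>

definition rotate_tile :: "tile \<Rightarrow> tile" where
  "rotate_tile = image (\<lambda>((a, b), m). ((1 - b, a), m))"

definition reflect_tile :: "tile \<Rightarrow> tile" where
  "reflect_tile = image (\<lambda>((a, b), m). ((1 - a, b), m))"

inductive_set robinson_alphabet :: "tile set" where
  basic: "t \<in> {tile1, tile2, tile3, tile4, tile5} \<Longrightarrow> t \<in> robinson_alphabet"
| rotate: "t \<in> robinson_alphabet \<Longrightarrow> rotate_tile t \<in> robinson_alphabet"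
| reflect: "t \<in> robinson_alphabet \<Longrightarrow> reflect_tile t \<in> robinson_alphabet"

definition crosses :: "tile set" where
  "crosses = {(rotate_tile ^^ n) tile3 | n. True}"

definition unit_square :: "int^2 \<Rightarrow> (real \<times> real) set" where
  "unit_square p = {of_int (p$1)..of_int (p$1) + 1} \<times> {of_int (p$2)..of_int (p$2) + 1}"

definition placed_markings :: "tile config \<Rightarrow> int^2 \<Rightarrow> marking set" where
  "placed_markings x p = (\<lambda>((a, b), m). ((a + of_int (p$1), b + of_int (p$2)), m)) ` x p"

definition adjacent :: "int^2 \<Rightarrow> int^2 \<Rightarrow> bool" where
  "adjacent p q \<longleftrightarrow> \<bar>p$1 - q$1\<bar> + \<bar>p$2 - q$2\<bar> = 1"

text \<open>For adjacent \<open>p\<close> and \<open>q\<close>, the intersection of the two unit squares is the shared edge.\<close>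

definition edges_match :: "tile config \<Rightarrow> bool" where
  "edges_match x \<longleftrightarrow>
     (\<forall>p q. adjacent p q \<longrightarrow> (\<forall>z \<in> unit_square p \<inter> unit_square q. \<forall>c.
        ((z, c, Head) \<in> placed_markings x p \<longrightarrow> (z, c, Tail) \<in> placed_markings x q) \<and>
        ((z, c, Tail) \<in> placed_markings x p \<longrightarrow> (z, c, Head) \<in> placed_markings x q)))"

definition even_coset :: "int^2 \<Rightarrow> (int^2) set" where
  "even_coset k = {2 *s v + k | v. True}"

definition X_Rob :: "tile config set" where
  "X_Rob = {x. (\<forall>p. x p \<in> robinson_alphabet) \<and> edges_match x \<and>
     (\<exists>k. (\<forall>p \<in> even_coset k. x p \<in> crosses) \<and>
          (\<forall>p. x p \<in> crosses \<and> p \<notin> even_coset k \<longrightarrow> p \<in> even_coset (k + vector [1, 1])))}"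

end

theory Submission
  imports Defs
begin

text \<open>Write \<open>\<omega>\<^sub>t\<close> (below \<open>seeded t\<close>) for the configuration that carries the tile \<open>t\<close> at the origin and is fixed by the
  inflation \<open>inflate\<close>, which puts a Robinson configuration on the even sublattice and fills the gaps with
  first-level crosses and arms. The \<open>\<omega>\<^sub>t\<close> agree off the two axes.

  An extended symmetry \<open>f\<close> with matrix \<open>A\<close> is a block map with a block inverse. Two points \<open>\<omega>\<^sub>s\<close>, \<open>\<omega>\<^sub>t\<close> that
  differ exactly on one axis are sent to points that differ only near its image. Undoing an inflation
  halves the spread of a linear functional on the set of differences, so this set lies on a line,
  and unless the line is parallel to an axis it is a single point, which the inverse block map
  excludes. Hence \<open>A\<close> is a signed permutation matrix, and composing with a symmetry of the square
  gives \<open>A = 1\<close>. The position of the differences modulo all powers of two shows that, after a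
  shift, \<open>f\<close> permutes the \<open>\<omega>\<^sub>t\<close>; it fixes each of them because every tile occurs off the axes.

  So \<open>f\<close> fixes every point that can be deflated infinitely often. The others contain a
  crossless row or column, a fault along which two half planes may be shifted against each other.
  Each half plane is locally an \<open>\<omega>\<^sub>t\<close>, so \<open>f\<close> fixes the point up to the tiles on the fault line; these are
  compared with the configurations where a single arm crosses the fault from one half plane.\<close>

text \<open>An extended symmetry is a block map and knows nothing of deflation. The property
  \<open>toeplitz\<close> closes this gap. It speaks only of boxes that repeat along the multiples
  of \<open>2 ^ n\<close>, so it survives every block map whose matrix is invertible over the
  integers, and it excludes faults; hence the images of the \<open>seeded t\<close> can again be
  deflated infinitely often. The phases of such a point form a pair of 2-adic integers, known at
  level \<open>n\<close> modulo \<open>2 ^ Suc n\<close>. The images of all \<open>seeded t\<close>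
  agree on arbitrarily large boxes and so have a common phase, but nothing forces a 2-adic phase to
  be an integer. The column on which two images differ does so: it has an integer coordinate that is
  congruent to the phase at every level. The phase does not see the tile at the origin. Here
  recurrence decides: large neighbourhoods of the origin in \<open>seeded t\<close> reappear off the
  axes, where all the \<open>seeded\<close> configurations coincide.\<close>

datatype red = NoRed | Lo | Hi
text \<open>An abstract tile is a cross, given by the two directions (right, up) of its red heads, or a
  vertical or horizontal arm, given by its direction, its red line along the arrow and the
  presence of a red line across it. An edge carries the direction in which its arrow crosses it
  (\<open>True\<close> for right and up) and the position of the red arrow: \<open>Lo\<close> is \<open>1/4\<close> and \<open>Hi\<close> is \<open>3/4\<close>.\<close>

datatype atile = Cross bool bool | Vert bool red bool | Horiz bool red bool

section \<open>Abstract tiles and valid tilings\<close>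

definition red_side :: "bool \<Rightarrow> red" where
  "red_side b = (if b then Lo else Hi)"

lemma red_side_eq [simp]: "red_side a = red_side b \<longleftrightarrow> a = b" "red_side b \<noteq> NoRed" "NoRed \<noteq> red_side b"
  by (auto simp: red_side_def)

text \<open>A red head of a cross is displaced away from the other red head of the cross, and the
  red line across an arm is displaced towards the head of the arm. This is the origin of
  \<open>red_side b\<close> and \<open>red_side (\<not> s)\<close> in the four edge
  functions.\<close>

fun rgt :: "atile \<Rightarrow> bool \<times> red" where
  "rgt (Cross a b) = (True, if a then red_side b else NoRed)"
| "rgt (Vert s r q) = (False, if q then red_side (\<not> s) else NoRed)"
| "rgt (Horiz s r q) = (s, r)"

fun lft :: "atile \<Rightarrow> bool \<times> red" where
  "lft (Cross a b) = (False, if a then NoRed else red_side b)"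
| "lft (Vert s r q) = (True, if q then red_side (\<not> s) else NoRed)"
| "lft (Horiz s r q) = (s, r)"

fun upp :: "atile \<Rightarrow> bool \<times> red" where
  "upp (Cross a b) = (True, if b then red_side a else NoRed)"
| "upp (Vert s r q) = (s, r)"
| "upp (Horiz s r q) = (False, if q then red_side (\<not> s) else NoRed)"

fun dwn :: "atile \<Rightarrow> bool \<times> red" where
  "dwn (Cross a b) = (False, if b then NoRed else red_side a)"
| "dwn (Vert s r q) = (s, r)"
| "dwn (Horiz s r q) = (True, if q then red_side (\<not> s) else NoRed)"

fun is_cross :: "atile \<Rightarrow> bool" where
  "is_cross (Cross a b) = True"
| "is_cross _ = False"

lemma is_cross_iff: "is_cross t \<longleftrightarrow> (\<exists>a b. t = Cross a b)"
  by (cases t) auto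

type_synonym atiling = "int \<Rightarrow> int \<Rightarrow> atile"

text \<open>Only rows in \<open>J\<close> are constrained, but the vertical edges between these rows and their
  neighbours outside \<open>J\<close> are. Crosses are normalised to sit at the positions with odd coordinates.\<close>

definition valid_on :: "int set \<Rightarrow> atiling \<Rightarrow> bool" where
  "valid_on J y \<longleftrightarrow>
     (\<forall>i. \<forall>j\<in>J. rgt (y i j) = lft (y (i + 1) j)) \<and>
     (\<forall>i j. j \<in> J \<or> j + 1 \<in> J \<longrightarrow> upp (y i j) = dwn (y i (j + 1))) \<and>
     (\<forall>i j. j \<in> J \<longrightarrow> odd i \<longrightarrow> odd j \<longrightarrow> is_cross (y i j)) \<and>
     (\<forall>i j. j \<in> J \<longrightarrow> is_cross (y i j) \<longrightarrow> (odd i \<longleftrightarrow> odd j))"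

lemma valid_onI:
  assumes "\<And>i j. j \<in> J \<Longrightarrow> rgt (y i j) = lft (y (i + 1) j)"
    and "\<And>i j. j \<in> J \<or> j + 1 \<in> J \<Longrightarrow> upp (y i j) = dwn (y i (j + 1))"
    and "\<And>i j. j \<in> J \<Longrightarrow> odd i \<Longrightarrow> odd j \<Longrightarrow> is_cross (y i j)"
    and "\<And>i j. j \<in> J \<Longrightarrow> is_cross (y i j) \<Longrightarrow> (odd i \<longleftrightarrow> odd j)"
  shows "valid_on J y"
  using assms unfolding valid_on_def by blast

lemma
  assumes "valid_on J y"
  shows valid_on_h: "j \<in> J \<Longrightarrow> rgt (y i j) = lft (y (i + 1) j)"
    and valid_on_v: "j \<in> J \<or> j + 1 \<in> J \<Longrightarrow> upp (y i j) = dwn (y i (j + 1))"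
    and valid_on_cross: "j \<in> J \<Longrightarrow> odd i \<Longrightarrow> odd j \<Longrightarrow> is_cross (y i j)"
    and valid_on_parity: "j \<in> J \<Longrightarrow> is_cross (y i j) \<Longrightarrow> (odd i \<longleftrightarrow> odd j)"
  using assms unfolding valid_on_def by blast+

lemma valid_on_mono: "valid_on J y \<Longrightarrow> K \<subseteq> J \<Longrightarrow> valid_on K y"
  unfolding valid_on_def by blast

definition sh :: "int \<Rightarrow> int \<Rightarrow> atiling \<Rightarrow> atiling" where
  "sh u v y = (\<lambda>i j. y (i - u) (j - v))"

lemma sh_apply: "sh u v y i j = y (i - u) (j - v)"
  by (simp add: sh_def)

lemma sh_sh [simp]: "sh u v (sh u' v' y) = sh (u + u') (v + v') y"
  by (auto simp: sh_def fun_eq_iff algebra_simps)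

lemma sh_0 [simp]: "sh 0 0 y = y"
  by (simp add: sh_def)

lemma valid_on_sh:
  assumes "valid_on J y" "even u" "even v"
  shows "valid_on {j. j - v \<in> J} (sh u v y)"
proof (rule valid_onI)
  fix i j :: int assume "j \<in> {j. j - v \<in> J}"
  then show "rgt (sh u v y i j) = lft (sh u v y (i + 1) j)"
    using valid_on_h[OF assms(1), of "j - v" "i - u"] by (simp add: sh_def algebra_simps)
next
  fix i j :: int assume "j \<in> {j. j - v \<in> J} \<or> j + 1 \<in> {j. j - v \<in> J}"
  then show "upp (sh u v y i j) = dwn (sh u v y i (j + 1))"
    using valid_on_v[OF assms(1), of "j - v" "i - u"] by (simp add: sh_def algebra_simps)
next
  fix i j :: int assume "j \<in> {j. j - v \<in> J}" "odd i" "odd j"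
  then show "is_cross (sh u v y i j)"
    using valid_on_cross[OF assms(1), of "j - v" "i - u"] assms by (simp add: sh_def)
next
  fix i j :: int assume "j \<in> {j. j - v \<in> J}" "is_cross (sh u v y i j)"
  then show "odd i = odd j"
    using valid_on_parity[OF assms(1), of "j - v" "i - u"] assms by (simp add: sh_def)
qed

lemma valid_sh: "valid_on UNIV y \<Longrightarrow> even u \<Longrightarrow> even v \<Longrightarrow> valid_on UNIV (sh u v y)"
  using valid_on_sh[of UNIV y u v] by simp

section \<open>Symmetries\<close>

fun flip_red :: "red \<Rightarrow> red" where
  "flip_red NoRed = NoRed" | "flip_red Lo = Hi" | "flip_red Hi = Lo"

lemma flip_red_red_side [simp]: "flip_red (red_side b) = red_side (\<not> b)" "flip_red (flip_red r) = r"
  "flip_red r = flip_red r' \<longleftrightarrow> r = r'" "flip_red r = NoRed \<longleftrightarrow> r = NoRed"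
  by (simp add: red_side_def, (cases r; simp), (cases r; cases r'; simp), (cases r; simp))

fun transpose_atile :: "atile \<Rightarrow> atile" where
  "transpose_atile (Cross a b) = Cross b a"
| "transpose_atile (Vert s r q) = Horiz s r q"
| "transpose_atile (Horiz s r q) = Vert s r q"

fun flip_atile :: "atile \<Rightarrow> atile" where
  "flip_atile (Cross a b) = Cross a (\<not> b)"
| "flip_atile (Vert s r q) = Vert (\<not> s) r q"
| "flip_atile (Horiz s r q) = Horiz s (flip_red r) q"

lemma transpose_atile_edges [simp]:
  "rgt (transpose_atile t) = upp t" "upp (transpose_atile t) = rgt t" "lft (transpose_atile t) = dwn t" "dwn (transpose_atile t) = lft t"
  "is_cross (transpose_atile t) = is_cross t" "transpose_atile (transpose_atile t) = t"
  by (cases t; simp)+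

lemma flip_atile_edges [simp]:
  "upp (flip_atile t) = (\<not> fst (dwn t), snd (dwn t))"
  "dwn (flip_atile t) = (\<not> fst (upp t), snd (upp t))"
  "rgt (flip_atile t) = (fst (rgt t), flip_red (snd (rgt t)))"
  "lft (flip_atile t) = (fst (lft t), flip_red (snd (lft t)))"
  "is_cross (flip_atile t) = is_cross t" "flip_atile (flip_atile t) = t"
  by (cases t; simp)+

definition transposed :: "atiling \<Rightarrow> atiling" where
  "transposed y = (\<lambda>i j. transpose_atile (y j i))"

definition reflected :: "atiling \<Rightarrow> atiling" where
  "reflected y = (\<lambda>i j. flip_atile (y i (- j)))"

lemma transposed_transposed [simp]: "transposed (transposed y) = y" and reflected_reflected [simp]: "reflected (reflected y) = y"
  by (simp_all add: transposed_def reflected_def fun_eq_iff)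

lemma transposed_sh [simp]: "transposed (sh u v y) = sh v u (transposed y)"
  by (simp add: transposed_def sh_def fun_eq_iff)

lemma reflected_sh [simp]: "reflected (sh u v y) = sh u (- v) (reflected y)"
  by (simp add: reflected_def sh_def fun_eq_iff)

lemma valid_transposed: "valid_on UNIV y \<Longrightarrow> valid_on UNIV (transposed y)"
  unfolding valid_on_def transposed_def by (auto)

lemma uminus_mem: "j \<in> uminus ` J \<longleftrightarrow> - j \<in> J" for j :: int
  by force

lemma valid_on_reflected:
  assumes "valid_on J y"
  shows "valid_on (uminus ` J) (reflected y)"
proof (rule valid_onI)
  fix i j :: int assume "j \<in> uminus ` J"
  then show "rgt (reflected y i j) = lft (reflected y (i + 1) j)"
    using valid_on_h[OF assms, of "- j" i] by (auto simp: reflected_def split: prod.splits)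
next
  fix i j :: int assume "j \<in> uminus ` J \<or> j + 1 \<in> uminus ` J"
  then have "- j - 1 \<in> J \<or> - j - 1 + 1 \<in> J" by (auto simp: uminus_mem)
  then show "upp (reflected y i j) = dwn (reflected y i (j + 1))"
    using valid_on_v[OF assms, of "- j - 1" i] by (auto simp: reflected_def split: prod.splits)
next
  fix i j :: int assume "j \<in> uminus ` J" "odd i" "odd j"
  then show "is_cross (reflected y i j)"
    using valid_on_cross[OF assms, of "-j" i] by (auto simp: reflected_def)
next
  fix i j :: int assume "j \<in> uminus ` J" "is_cross (reflected y i j)"
  then show "odd i = odd j"
    using valid_on_parity[OF assms, of "-j" i] by (auto simp: reflected_def)
qed

lemma valid_reflected: "valid_on UNIV y \<Longrightarrow> valid_on UNIV (reflected y)"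
  using valid_on_reflected[of UNIV y] by (simp add: surj_uminus)

section \<open>Substitution\<close>

definition horiz :: "bool \<times> red \<Rightarrow> bool \<Rightarrow> atile" where "horiz e q = Horiz (fst e) (snd e) q"
definition vert :: "bool \<times> red \<Rightarrow> bool \<Rightarrow> atile" where "vert e q = Vert (fst e) (snd e) q"

lemma horiz_simps [simp]: "rgt (horiz e q) = e" "lft (horiz e q) = e" "\<not> is_cross (horiz e q)"
  "upp (horiz e q) = (False, if q then red_side (\<not> fst e) else NoRed)"
  "dwn (horiz e q) = (True, if q then red_side (\<not> fst e) else NoRed)"
  "transpose_atile (horiz e q) = vert e q" "horiz e q \<noteq> Cross a b" "horiz e q = Horiz s r q' \<longleftrightarrow> e = (s, r) \<and> q = q'"
  "horiz e q = horiz e' q' \<longleftrightarrow> e = e' \<and> q = q'" "horiz e q \<noteq> Vert s r q'"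
  by (auto simp: horiz_def vert_def prod_eq_iff)

lemma vert_simps [simp]: "upp (vert e q) = e" "dwn (vert e q) = e" "\<not> is_cross (vert e q)"
  "lft (vert e q) = (True, if q then red_side (\<not> fst e) else NoRed)"
  "rgt (vert e q) = (False, if q then red_side (\<not> fst e) else NoRed)"
  "transpose_atile (vert e q) = horiz e q" "vert e q \<noteq> Cross a b" "vert e q = Vert s r q' \<longleftrightarrow> e = (s, r) \<and> q = q'"
  "vert e q = vert e' q' \<longleftrightarrow> e = e' \<and> q = q'" "vert e q \<noteq> Horiz s r q'"
  by (auto simp: horiz_def vert_def prod_eq_iff)

text \<open>The new crosses face each other in red squares around the positions
  \<open>(2 * i, 2 * j)\<close> with \<open>i\<close> and \<open>j\<close> odd, which is where a
  valid \<open>z\<close> has its forced crosses. The last argument of the new arms records whether a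
  side of such a square crosses them.\<close>

definition inflate :: "atiling \<Rightarrow> atiling" where
  "inflate z = (\<lambda>i j. if even i then if even j then z (i div 2) (j div 2)
                      else vert (upp (z (i div 2) (j div 2))) (odd (i div 2))
                else if even j then horiz (rgt (z (i div 2) (j div 2))) (odd (j div 2))
                      else Cross (even (i div 2)) (even (j div 2)))"

lemma inflate_simps [simp]:
  "inflate z (2 * i) (2 * j) = z i j"
  "inflate z (2 * i) (2 * j + 1) = vert (upp (z i j)) (odd i)"
  "inflate z (2 * i + 1) (2 * j) = horiz (rgt (z i j)) (odd j)"
  "inflate z (2 * i + 1) (2 * j + 1) = Cross (even i) (even j)"
  by (simp_all add: inflate_def)

lemma inflate_sh: "even u \<Longrightarrow> even v \<Longrightarrow> inflate (sh u v z) = sh (2 * u) (2 * v) (inflate z)"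
proof -
  assume "even u" "even v"
  moreover have "(i - 2 * u) div 2 = i div 2 - u" for i u :: int by linarith
  ultimately show ?thesis by (auto simp: inflate_def sh_def fun_eq_iff)
qed

lemma int_parity_cases:
  fixes i :: int obtains k where "i = 2 * k" | k where "i = 2 * k + 1"
  by (metis evenE oddE)

lemma parity4_cases:
  fixes i j :: int
  obtains k l where "i = 2 * k" "j = 2 * l" | k l where "i = 2 * k + 1" "j = 2 * l"
  | k l where "i = 2 * k" "j = 2 * l + 1" | k l where "i = 2 * k + 1" "j = 2 * l + 1"
  by (metis evenE oddE)

lemma inj_inflate: "inflate z = inflate z' \<Longrightarrow> z = z'"
  by (metis inflate_simps(1) ext)

text \<open>A row \<open>2 * j + 1\<close> of the inflation copies the vertical edges between the
  rows \<open>j\<close> and \<open>j + 1\<close> and relies on the forced crosses of the odd one of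
  these two; the conditions relating \<open>J\<close> and \<open>K\<close> say just this.\<close>

lemma valid_on_inflate:
  assumes z: "valid_on J z" and J: "\<And>j. 2 * j \<in> K \<Longrightarrow> j \<in> J"
    "\<And>j. 2 * j + 1 \<in> K \<Longrightarrow> (odd j \<longrightarrow> j \<in> J) \<and> (even j \<longrightarrow> j + 1 \<in> J)"
  shows "valid_on K (inflate z)"
proof -
  have cr: "\<exists>a b. z i j = Cross a b" if "odd i" "odd j" "j \<in> J" for i j
    using valid_on_cross[OF z, of j i] that by (auto simp: is_cross_iff)
  \<comment> \<open>In an odd row every edge points away from the cross at its odd end. This puts
    the red line across the new arm where the first-level crosses above and below have their red
    heads.\<close>
  have rdir: "fst (rgt (z i j)) = odd i" if "odd j" "j \<in> J" for i j
  proof (cases "odd i")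
    case True then show ?thesis using cr[of i j] that by auto
  next
    case False then show ?thesis using cr[of "i + 1" j] that valid_on_h[OF z, of j i] by auto
  qed
  have udir: "fst (upp (z i j)) = odd j" if "odd i" "2 * j + 1 \<in> K" for i j
  proof (cases "odd j")
    case True then show ?thesis using cr[of i j] that J(2) by auto
  next
    case False then show ?thesis using cr[of i "j + 1"] that valid_on_v[OF z, of j i] J(2) by auto
  qed
  show ?thesis
  proof (rule valid_onI)
    fix i j :: int assume jK: "j \<in> K"
    show "rgt (inflate z i j) = lft (inflate z (i + 1) j)"
    proof (cases rule: parity4_cases[of i j])
      case (1 k l) then show ?thesis by simp
    next
      case (2 k l)
      have "2 * k + 1 + 1 = 2 * (k + 1)" by simp
      then show ?thesis unfolding 2 using valid_on_h[OF z, of l k] jK J(1) 2 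
        by (simp del: mult_Suc_right distrib_left_numeral)
    next
      case (3 k l) then show ?thesis using udir[of k l] jK by auto
    next
      case (4 k l)
      have e: "2 * k + 1 + 1 = 2 * (k + 1)" by simp
      show ?thesis unfolding 4 e inflate_simps using udir[of "k+1" l] jK 4 by auto
    qed
  next
    fix i j :: int assume jK: "j \<in> K \<or> j + 1 \<in> K"
    show "upp (inflate z i j) = dwn (inflate z i (j + 1))"
    proof (cases rule: parity4_cases[of i j])
      case (1 k l) then show ?thesis by simp
    next
      case (2 k l) then show ?thesis using rdir[of l k] J jK by auto
    next
      case (3 k l)
      have e: "2 * l + 1 + 1 = 2 * (l + 1)" by simp
      have "l \<in> J \<or> l + 1 \<in> J" using J(1)[of "l + 1"] J(2)[of l] jK 3 by (auto simp: algebra_simps)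
      then show ?thesis unfolding 3 e inflate_simps using valid_on_v[OF z, of l k] by simp
    next
      case (4 k l)
      have e: "2 * l + 1 + 1 = 2 * (l + 1)" by simp
      have "even l \<longrightarrow> l + 1 \<in> J" using J(1)[of "l + 1"] J(2)[of l] jK 4 by (auto simp: algebra_simps)
      then show ?thesis unfolding 4 e inflate_simps using rdir[of "l+1" k] by auto
    qed
  next
    fix i j :: int assume "odd i" "odd j"
    then show "is_cross (inflate z i j)" by (auto simp: inflate_def)
  next
    fix i j :: int assume "j \<in> K" "is_cross (inflate z i j)"
    then show "odd i = odd j" by (auto simp: inflate_def split: if_splits)
  qed
qed

lemma valid_on_atLeast_inflate: "valid_on {1..} z \<Longrightarrow> valid_on {1..} (inflate z)"
  by (rule valid_on_inflate) (auto elim!: oddE evenE)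

lemma valid_inflate: "valid_on UNIV z \<Longrightarrow> valid_on UNIV (inflate z)"
  by (rule valid_on_inflate) auto

lemma transposed_inflate: "transposed (inflate z) = inflate (transposed z)"
  by (auto simp: inflate_def transposed_def fun_eq_iff)

section \<open>Desubstitution\<close>

fun cross_right :: "atile \<Rightarrow> bool" where "cross_right (Cross a b) = a" | "cross_right _ = False"
fun cross_up :: "atile \<Rightarrow> bool" where "cross_up (Cross a b) = b" | "cross_up _ = False"

lemma is_cross_eq: "is_cross t \<Longrightarrow> t = Cross (cross_right t) (cross_up t)"
  by (cases t) auto

text \<open>By parity the tile between two crosses of an odd row is an arm, and it is vertical
  because both crosses point at it. Its two sides carry the same red mark, so either both crosses
  turn a red head to it or neither does.\<close>

lemma valid_on_row:
  assumes z: "valid_on J z" and j: "j \<in> J" "odd i" "odd j"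
  shows "cross_right (z (i + 2) j) = (\<not> cross_right (z i j))"
    and "cross_right (z i j) \<Longrightarrow> cross_up (z (i + 2) j) = cross_up (z i j)"
    and "\<exists>s r. z (i + 1) j = Vert s r (cross_right (z i j)) \<and> (cross_right (z i j) \<longrightarrow> s = (\<not> cross_up (z i j)))"
proof -
  obtain a b where 1: "z i j = Cross a b" using valid_on_cross[OF z j] is_cross_iff by blast
  obtain a' b' where 2: "z (i + 2) j = Cross a' b'"
    using valid_on_cross[OF z, of j "i + 2"] j is_cross_iff by auto
  have 3: "\<not> is_cross (z (i + 1) j)" using valid_on_parity[OF z, of j "i + 1"] j by auto
  have 4: "rgt (z i j) = lft (z (i + 1) j)" "rgt (z (i + 1) j) = lft (z (i + 2) j)"
    using valid_on_h[OF z j(1), of i] valid_on_h[OF z j(1), of "i + 1"] by (simp_all add: add.assoc)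
  show "cross_right (z (i + 2) j) = (\<not> cross_right (z i j))"
    "cross_right (z i j) \<Longrightarrow> cross_up (z (i + 2) j) = cross_up (z i j)"
    "\<exists>s r. z (i + 1) j = Vert s r (cross_right (z i j)) \<and> (cross_right (z i j) \<longrightarrow> s = (\<not> cross_up (z i j)))"
    using 1 2 3 4 by (cases "z (i + 1) j"; auto split: if_splits)+
qed

lemma valid_on_col:
  assumes z: "valid_on J z" and j: "j \<in> J" "j + 1 \<in> J" "j + 2 \<in> J" "odd i" "odd j"
  shows "cross_up (z i (j + 2)) = (\<not> cross_up (z i j))"
    and "cross_up (z i j) \<Longrightarrow> cross_right (z i (j + 2)) = cross_right (z i j)"
    and "\<exists>s r. z i (j + 1) = Horiz s r (cross_up (z i j)) \<and> (cross_up (z i j) \<longrightarrow> s = (\<not> cross_right (z i j)))"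
proof -
  obtain a b where 1: "z i j = Cross a b" using valid_on_cross[OF z j(1,4,5)] is_cross_iff by blast
  obtain a' b' where 2: "z i (j + 2) = Cross a' b'"
    using valid_on_cross[OF z, of "j + 2" i] j is_cross_iff by auto
  have 3: "\<not> is_cross (z i (j + 1))" using valid_on_parity[OF z, of "j + 1" i] j by auto
  have 4: "upp (z i j) = dwn (z i (j + 1))" "upp (z i (j + 1)) = dwn (z i (j + 2))"
    using valid_on_v[OF z, of j i] valid_on_v[OF z, of "j + 1" i] j by (simp_all add: add.assoc)
  show "cross_up (z i (j + 2)) = (\<not> cross_up (z i j))"
    "cross_up (z i j) \<Longrightarrow> cross_right (z i (j + 2)) = cross_right (z i j)"
    "\<exists>s r. z i (j + 1) = Horiz s r (cross_up (z i j)) \<and> (cross_up (z i j) \<longrightarrow> s = (\<not> cross_right (z i j)))"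
    using 1 2 3 4 by (cases "z i (j + 1)"; auto split: if_splits)+
qed

lemma alternating:
  fixes g :: "int \<Rightarrow> bool"
  assumes "\<And>i. g (i + 1) = (\<not> g i)"
  shows "g i = (g 0 = even i)"
proof (induction i rule: int_induct[where k = 0])
  case base then show ?case by simp
next
  case (step1 i) then show ?case using assms[of i] by auto
next
  case (step2 i) then show ?case using assms[of "i - 1"] by auto
qed

section \<open>Phases of rows, crossless rows and faults\<close>

definition row_phase :: "atiling \<Rightarrow> int \<Rightarrow> bool" where "row_phase z l = cross_right (z 1 (2 * l + 1))"

lemma cross_right_row:
  assumes z: "valid_on J z" and "2 * l + 1 \<in> J"
  shows "cross_right (z (2 * i + 1) (2 * l + 1)) = (row_phase z l = even i)"
  using alternating[of "\<lambda>i. cross_right (z (2 * i + 1) (2 * l + 1))" i] valid_on_row(1)[OF z assms(2), of "2 * _ + 1"]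
  by (simp add: row_phase_def algebra_simps)

text \<open>The second condition holds for rows without crosses whose horizontal edges match, and
  it survives passing to every other tile of the row.\<close>

definition inert :: "atiling \<Rightarrow> int \<Rightarrow> bool" where
  "inert z r \<longleftrightarrow> (\<forall>i. \<not> is_cross (z i r)) \<and>
     (\<forall>i i'. i < i' \<longrightarrow> (\<not> fst (rgt (z i r)) \<longrightarrow> \<not> fst (rgt (z i' r)) \<and> \<not> fst (lft (z i' r))) \<and>
                      (fst (lft (z i' r)) \<longrightarrow> fst (lft (z i r)) \<and> fst (rgt (z i r))))"

definition crossless :: "atiling \<Rightarrow> int \<Rightarrow> bool" where
  "crossless z r \<longleftrightarrow> (\<forall>i. \<not> is_cross (z i r))"

text \<open>Without crosses the direction of the horizontal arrows changes only at a vertical arm,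
  and there from right to left; so it changes at most once along the row.\<close>

lemma crossless_inert:
  assumes z: "valid_on J z" and "r \<in> J" "crossless z r"
  shows "inert z r"
proof -
  have nc: "\<not> is_cross (z i r)" for i using assms by (simp add: crossless_def)
  have e: "rgt (z i r) = lft (z (i + 1) r)" for i using valid_on_h[OF z assms(2)] .
  have t: "(fst (rgt (z i r)) \<longrightarrow> fst (lft (z i r)))" for i
    using nc[of i] by (cases "z i r") auto
  have "\<not> fst (lft (z i' r)) \<and> \<not> fst (rgt (z i' r))" if "i < i'" "\<not> fst (rgt (z i r))" for i i'
    using that(1)
  proof (induction i' rule: int_gr_induct)
    case base then show ?case using e[of i] t[of "i+1"] that by auto
  next
    case (step k) then show ?case using e[of k] t[of "k+1"] by auto
  qed
  moreover have "fst (lft (z i r)) \<and> fst (rgt (z i r))" if "i < i'" "fst (lft (z i' r))" for i i'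
    using that(1)
  proof (induction i rule: int_less_induct)
    case base then show ?case using e[of "i' - 1"] t[of "i' - 1"] that by auto
  next
    case (step k) then show ?case using e[of "k - 1"] t[of "k-1"] by auto
  qed
  ultimately show ?thesis unfolding inert_def using nc by blast
qed

text \<open>If a cross above the row faced right and down, the arm to its right would point up and
  continue as a vertical arm into the row. Left of that arm all arrows of the row point right, so
  the tile below the cross is an arm to the right, whose crossing red line is at \<open>Hi\<close>,
  whereas the cross needs \<open>Lo\<close>. A cross facing left has the same vertical direction as
  the cross two places to its left, which faces right.\<close>

lemma face_up:
  assumes z: "valid_on J z" and r: "r + 1 \<in> J" "inert z r" "even r" "odd i"
  shows "cross_up (z i (r + 1))"
proof -
  have *: False if i: "odd i" "cross_right (z i (r + 1))" "\<not> cross_up (z i (r + 1))" for i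
  proof -
    obtain s q where v: "z (i + 1) (r + 1) = Vert s q True" "s"
      using valid_on_row(3)[OF z r(1) i(1)] i r(3) by auto
    then have "fst (upp (z (i + 1) r))" using valid_on_v[OF z, of r "i + 1"] r(1) by simp
    moreover have "\<not> is_cross (z (i + 1) r)" using r(2) by (auto simp: inert_def)
    ultimately have "fst (lft (z (i + 1) r))" by (cases "z (i + 1) r") auto
    then have 1: "fst (lft (z i r))" "fst (rgt (z i r))" using r(2) unfolding inert_def by (meson zless_add1_eq)+
    have "upp (z i r) = dwn (z i (r + 1))" using valid_on_v[OF z, of r i] r(1) by simp
    moreover have "z i (r + 1) = Cross True False"
      using is_cross_eq[OF valid_on_cross[OF z r(1) i(1)]] i r(3) by simp
    ultimately show False using 1 by (cases "z i r") (auto split: if_splits)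
  qed
  show ?thesis
  proof (rule ccontr)
    assume n: "\<not> cross_up (z i (r + 1))"
    show False
    proof (cases "cross_right (z i (r + 1))")
      case True then show False using * n r by blast
    next
      case False
      have o: "odd (i - 2)" "odd (r + 1)" using r by auto
      have "cross_right (z (i - 2) (r + 1))" using valid_on_row(1)[OF z r(1) o] False by auto
      moreover from this have "\<not> cross_up (z (i - 2) (r + 1))" using valid_on_row(2)[OF z r(1) o] n by auto
      ultimately show False using * o by blast
    qed
  qed
qed

lemma inert_reflected: "inert (reflected z) r \<longleftrightarrow> inert z (- r)"
  by (simp add: inert_def reflected_def)

lemma face_down:
  assumes z: "valid_on J z" and r: "r - 1 \<in> J" "inert z r" "even r" "odd i"
  shows "\<not> cross_up (z i (r - 1))"
proof -
  have "- r + 1 \<in> uminus ` J" using r by force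
  then have "cross_up (reflected z i (- r + 1))"
    using face_up[OF valid_on_reflected[OF z], of "- r" i] r by (auto simp: inert_reflected)
  moreover have "is_cross (z i (r - 1))" using valid_on_cross[OF z r(1)] r by auto
  ultimately show ?thesis by (auto simp: reflected_def is_cross_iff)
qed

text \<open>Two consecutive rows of first-level crosses that are not aligned form a fault.\<close>

lemma fault_row:
  assumes z: "valid_on J z" and J: "2 * l + 1 \<in> J" "2 * l + 2 \<in> J" "2 * l + 3 \<in> J" and c: "row_phase z l \<noteq> row_phase z (l + 1)"
  shows "crossless z (2 * l + 2)"
    and "\<not> cross_up (z (2 * i + 1) (2 * l + 1))"
proof -
  have J': "2 * (l + 1) + 1 \<in> J" "2 * l + 1 + 1 \<in> J" "2 * l + 1 + 2 \<in> J" using J by (simp_all add: algebra_simps)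
  have ne: "cross_right (z (2 * i + 1) (2 * l + 1)) \<noteq> cross_right (z (2 * i + 1) (2 * l + 3))" for i
    using cross_right_row[OF z J(1), of i] cross_right_row[OF z J'(1), of i] c by (auto simp: algebra_simps)
  have o: "odd (2 * l + 1)" "odd (2 * l + 3)" "odd (2 * i + 1)" for i :: int by auto
  \<comment> \<open>A red line between the two crosses of a column would make them face the same
    horizontal side.\<close>
  have nb: "\<not> cross_up (z (2 * i + 1) (2 * l + 1))" for i
    using valid_on_col(2)[OF z J(1) J'(2,3) o(3)[of i] o(1)] ne[of i] by (auto simp: algebra_simps)
  then show "\<not> cross_up (z (2 * i + 1) (2 * l + 1))" .
  have b: "cross_up (z (2 * i + 1) (2 * l + 3))" for i
    using valid_on_col(1)[OF z J(1) J'(2,3) o(3)[of i] o(1)] nb[of i] by (auto simp: algebra_simps)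
  show "crossless z (2 * l + 2)" unfolding crossless_def
  proof
    fix i :: int
    show "\<not> is_cross (z i (2 * l + 2))"
    proof (cases "odd i")
      case True then show ?thesis using valid_on_parity[OF z J(2), of i] by auto
    next
      case False
      then obtain k where i: "i = 2 * k + 1 + 1" by (metis add.assoc dvdE one_add_one add.commute diff_add_cancel even_plus_one_iff oddE)
      show ?thesis
      \<comment> \<open>In each even column a side of a red square crosses the arm just below or
        just above the row. Both rows of squares open away from the row, so that arm points into the
        row, where a cross would have to point out.\<close>
      proof (cases "cross_right (z (2 * k + 1) (2 * l + 1))")
        case True
        then obtain r q where "z i (2 * l + 1) = Vert True r q"
          using valid_on_row(3)[OF z J(1) o(3)[of k] o(1)] nb[of k] i by auto
        then have "dwn (z i (2 * l + 2)) = (True, r)"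
          using valid_on_v[OF z, of "2 * l + 1" i] J by (simp add: add.commute)
        then show ?thesis by (auto simp: is_cross_iff)
      next
        case False
        then have "cross_right (z (2 * k + 1) (2 * l + 3))" using ne[of k] by auto
        then obtain r q where "z i (2 * l + 3) = Vert False r q"
          using valid_on_row(3)[OF z J(3) o(3)[of k] o(2)] b[of k] i by auto
        then have "upp (z i (2 * l + 2)) = (False, r)"
          using valid_on_v[OF z, of "2 * l + 2" i] J by (simp add: add.commute)
        then show ?thesis by (auto simp: is_cross_iff)
      qed
    qed
  qed
qed

section \<open>Deflation of rows with aligned crosses\<close>

definition half :: "atiling \<Rightarrow> atiling" where "half z = (\<lambda>i j. z (2 * i) (2 * j))"

lemma half_inflate [simp]: "half (inflate z) = z"
  by (simp add: half_def)

text \<open>The arms next to the first-level crosses copy an edge of a neighbour on the even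
  sublattice, and the red squares prescribe their direction. Around a position with both halved
  coordinates odd these arms lead outwards above and below, which only a cross allows.\<close>

lemma desub:
  assumes z: "valid_on J z" and J: "\<And>j. 2 * j \<in> J \<longleftrightarrow> 2 * j - 1 \<in> J \<and> 2 * j + 1 \<in> J"
    and c: "\<And>i j. 2 * j + 1 \<in> J \<Longrightarrow> z (2 * i + 1) (2 * j + 1) = Cross (even i) (even j)"
  shows "valid_on {j. 2 * j \<in> J} (half z)"
    and "j \<in> J \<Longrightarrow> z i j = inflate (half z) i j"
proof -
  have hz: "z (2 * i + 1) (2 * j) = horiz (rgt (z (2 * i) (2 * j))) (odd j) \<and> (odd j \<longrightarrow> fst (rgt (z (2 * i) (2 * j))) = odd i)"
    if j: "2 * j \<in> J" for i j
  proof -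
    have j': "2 * j - 1 \<in> J" "2 * j + 1 \<in> J" using J j by auto
    have e: "2 * (j - 1) + 1 = 2 * j - 1" "2 * j - 1 + 1 = 2 * j" "2 * j - 1 + 2 = 2 * j + 1" "2 * (i::int) + 1 + 1 = 2 * i + 2" by auto
    have "z (2 * i + 1) (2 * j - 1) = Cross (even i) (odd j)"
      using c[of "j - 1" i] j' by (simp add: algebra_simps)
    then obtain s r where *: "z (2 * i + 1) (2 * j) = Horiz s r (odd j)" "odd j \<Longrightarrow> s = odd i"
      using valid_on_col(3)[OF z, of "2 * j - 1" "2 * i + 1"] j j' e by auto
    moreover have "rgt (z (2 * i) (2 * j)) = lft (z (2 * i + 1) (2 * j))" using valid_on_h[OF z j] .
    ultimately show ?thesis by (auto simp: horiz_def)
  qed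
  have ray_seed: "\<exists>s r. z (2 * i) (2 * j + 1) = Vert s r (odd i) \<and> (odd i \<longrightarrow> s = odd j) \<and> upp (z (2 * i) (2 * j)) = (s, r)
     \<and> dwn (z (2 * i) (2 * (j + 1))) = (s, r)"
    if j: "2 * j + 1 \<in> J" for i j
  proof -
    have e: "2 * (i - 1) + 1 = 2 * i - 1" "2 * i - 1 + 1 = 2 * i" by auto
    have "z (2 * i - 1) (2 * j + 1) = Cross (odd i) (even j)"
      using c[of j "i - 1"] j by (simp add: algebra_simps)
    then obtain s r where *: "z (2 * i) (2 * j + 1) = Vert s r (odd i)" "odd i \<longrightarrow> s = odd j"
      using valid_on_row(3)[OF z j, of "2 * i - 1"] e by auto
    moreover have "upp (z (2 * i) (2 * j)) = dwn (z (2 * i) (2 * j + 1))"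
       "upp (z (2 * i) (2 * j + 1)) = dwn (z (2 * i) (2 * j + 1 + 1))" using valid_on_v[OF z] j by blast+
    moreover have "2 * j + 1 + 1 = 2 * (j + 1)" by simp
    ultimately show ?thesis by (metis upp.simps(2) dwn.simps(2))
  qed
  show "valid_on {j. 2 * j \<in> J} (half z)"
  proof (rule valid_onI)
    fix i j :: int assume j: "j \<in> {j. 2 * j \<in> J}"
    have "rgt (z (2 * i + 1) (2 * j)) = lft (z (2 * i + 1 + 1) (2 * j))" using valid_on_h[OF z] j by blast
    then show "rgt (half z i j) = lft (half z (i + 1) j)"
      using hz[of j i] j by (simp add: half_def algebra_simps)
  next
    fix i j :: int assume "j \<in> {j. 2 * j \<in> J} \<or> j + 1 \<in> {j. 2 * j \<in> J}"
    moreover have "2 * (j + 1) - 1 = 2 * j + 1" by simp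
    ultimately have "2 * j + 1 \<in> J" using J[of j] J[of "j + 1"] by (metis mem_Collect_eq)
    then show "upp (half z i j) = dwn (half z i (j + 1))"
      using ray_seed[of j i] unfolding half_def by metis
  next
    fix i j :: int assume j: "j \<in> {j. 2 * j \<in> J}" "odd i" "odd j"
    then have J': "2 * j + 1 \<in> J" "2 * (j - 1) + 1 \<in> J" using J[of j] by auto
    then have "fst (upp (z (2 * i) (2 * j)))" "\<not> fst (dwn (z (2 * i) (2 * j)))"
      using ray_seed[OF J'(1), of i] ray_seed[OF J'(2), of i] j by auto
    then show "is_cross (half z i j)"
      unfolding half_def by (cases "z (2 * i) (2 * j)") auto
  next
    fix i j :: int assume j: "j \<in> {j. 2 * j \<in> J}" "is_cross (half z i j)"
    then have J': "2 * j + 1 \<in> J" "2 * j \<in> J" using J[of j] by auto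
    obtain a b where ab: "z (2 * i) (2 * j) = Cross a b" using j by (auto simp: half_def is_cross_iff)
    then show "odd i = odd j"
      using ray_seed[OF J'(1), of i] hz[OF J'(2), of i] by auto
  qed
  show "z i j = inflate (half z) i j" if "j \<in> J"
  proof (cases rule: parity4_cases[of i j])
    case (1 k l) then show ?thesis by (simp add: half_def)
  next
    case (2 k l) then show ?thesis using hz[of l k] that by (simp add: half_def)
  next
    case (3 k l) then show ?thesis using ray_seed[of l k] that by (metis inflate_simps(2) vert_simps(8) half_def)
  next
    case (4 k l) then show ?thesis using c[of l k] that by simp
  qed
qed

lemma Cross_eqI: "is_cross t \<Longrightarrow> cross_right t = a \<Longrightarrow> cross_up t = b \<Longrightarrow> t = Cross a b"
  by (cases t) auto

lemma int_const:
  fixes g :: "int \<Rightarrow> 'a"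
  assumes "\<And>l. g (l + 1) = g l"
  shows "g l = g 0"
proof (induction l rule: int_induct[where k = 0])
  case (step1 i) then show ?case using assms[of i] by simp
next
  case (step2 i) then show ?case using assms[of "i - 1"] by simp
qed simp

lemma desub_shift:
  assumes z: "valid_on J z" and J: "\<And>j. 2 * j \<in> J \<longleftrightarrow> 2 * j - 1 \<in> J \<and> 2 * j + 1 \<in> J"
    and ev: "even u"
    and c: "\<And>i j. 2 * j + 1 \<in> J \<Longrightarrow> z (2 * i + 1 + u) (2 * j + 1) = Cross (even i) (even j)"
  defines "y \<equiv> half (sh (- u) 0 z)"
  shows "valid_on {j. 2 * j \<in> J} y" "\<And>i j. j \<in> J \<Longrightarrow> z i j = inflate y (i - u) j"
    "\<And>i j. y i j = z (2 * i + u) (2 * j)"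
proof -
  have v: "valid_on J (sh (- u) 0 z)" using valid_on_sh[OF z, of "- u" 0] ev by simp
  have c': "sh (- u) 0 z (2 * i + 1) (2 * j + 1) = Cross (even i) (even j)" if "2 * j + 1 \<in> J" for i j
    using c[OF that] by (simp add: sh_def)
  show "valid_on {j. 2 * j \<in> J} y" unfolding y_def by (rule desub(1)[OF v J c'])
  show "z i j = inflate y (i - u) j" if "j \<in> J" for i j
    using desub(2)[OF v J c' that, of "i - u"] by (simp add: y_def sh_def)
  show "y i j = z (2 * i + u) (2 * j)" for i j by (simp add: y_def half_def sh_def)
qed

lemma inert_subsample:
  assumes "inert z r" "\<And>i. y i r' = z (2 * i + u) r"
  shows "inert y r'"
proof -
  have "i < i' \<Longrightarrow> 2 * i + u < 2 * i' + u" for i i' by simp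
  then show ?thesis using assms unfolding inert_def by (metis (no_types, lifting))
qed

lemma cross_up_above:
  assumes z: "valid_on J z" "inert z 0" and J: "\<And>k. 1 \<le> k \<Longrightarrow> k \<le> 2 * int l + 1 \<Longrightarrow> k \<in> J"
  shows "cross_up (z (2 * i + 1) (2 * int l + 1)) = even l"
  using J
proof (induction l)
  case 0
  then show ?case using face_up[OF z(1), of 0 "2 * i + 1"] z(2) by auto
next
  case (Suc l)
  have e: "2 * int l + 1 + 2 = 2 * int (Suc l) + 1" by simp
  have "cross_up (z (2 * i + 1) (2 * int l + 1 + 2)) = (\<not> cross_up (z (2 * i + 1) (2 * int l + 1)))"
    by (rule valid_on_col(1)[OF z(1)]) (use Suc.prems in auto)
  moreover have "cross_up (z (2 * i + 1) (2 * int l + 1)) = even l" using Suc by auto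
  ultimately show ?case unfolding e by simp
qed

text \<open>Two crossless rows cannot occur: the first-level crosses would have to face away from both,
  which forces the height to be divisible by four, and desubstitution halves the height.\<close>

lemma no_strip:
  assumes "valid_on {1..2 * int h - 1} z" "inert z 0" "inert z (2 * int h)" "h > 0"
  shows False
  using assms
proof (induction h arbitrary: z rule: less_induct)
  case (less h)
  note z = less.prems(1)
  define J where "J = {1..2 * int h - 1}"
  note z = less.prems(1)[folded J_def]
  have b: "cross_up (z (2 * i + 1) (2 * int l + 1)) = even l" if "l < h" for i l
    by (rule cross_up_above[OF z less.prems(2)]) (use that in \<open>auto simp: J_def\<close>)
  have "\<not> cross_up (z 1 (2 * int h - 1))"
    by (rule face_down[OF z _ less.prems(3)]) (use less.prems(4) in \<open>auto simp: J_def\<close>)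
  moreover have "2 * int (h - 1) + 1 = 2 * int h - 1" using less.prems(4) by linarith
  ultimately have "odd (h - 1)" using b[of "h - 1" 0] less.prems(4) by auto
  then have "even h" using less.prems(4) by (cases h) auto
  then obtain k where k: "h = 2 * k" by blast
  show False
  proof (cases "\<exists>l. Suc l < h \<and> row_phase z (int l) \<noteq> row_phase z (int l + 1)")
    \<comment> \<open>Two misaligned rows inside the strip give a third crossless row, and with it a
      strip of smaller height.\<close>
    case True
    then obtain l where l: "Suc l < h" "row_phase z (int l) \<noteq> row_phase z (int l + 1)" by blast
    have J: "2 * int l + 1 \<in> J" "2 * int l + 2 \<in> J" "2 * int l + 3 \<in> J" using l by (auto simp: J_def)
    have i: "inert z (2 * int (Suc l))" using crossless_inert[OF z J(2) fault_row(1)[OF z J l(2)]] by (simp add: algebra_simps)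
    show False
      by (rule less.IH[OF l(1) _ less.prems(2) i]) (use l in \<open>auto intro!: valid_on_mono[OF z] simp: J_def\<close>)
  next
    case False
    have c: "row_phase z (int l) = row_phase z 0" if "l < h" for l
      using that False by (induction l) (auto simp: add.commute)
    define u :: int where "u = (if row_phase z 0 then 0 else 2)"
    have J: "2 * j \<in> J \<longleftrightarrow> 2 * j - 1 \<in> J \<and> 2 * j + 1 \<in> J" for j
      using k by (simp add: J_def) presburger
    have cr: "z (2 * i + 1 + u) (2 * j + 1) = Cross (even i) (even j)" if "2 * j + 1 \<in> J" for i j
    proof -
      have "0 \<le> j" "j < int h" using that by (auto simp: J_def)
      then obtain l where l: "j = int l" "l < h" by (metis of_nat_less_iff zero_le_imp_eq_int)
      have "is_cross (z (2 * (i + u div 2) + 1) (2 * j + 1))" by (rule valid_on_cross[OF z that]) auto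
      moreover have "2 * (i + u div 2) + 1 = 2 * i + 1 + u" by (auto simp: u_def)
      ultimately show ?thesis
        using cross_right_row[OF z that, of "i + u div 2"] b[OF l(2), of "i + u div 2"] c[OF l(2)] l
        by (intro Cross_eqI) (auto simp: u_def)
    qed
    define y where "y = half (sh (- u) 0 z)"
    have "even u" by (auto simp: u_def)
    note ds = desub_shift[OF z J this cr, folded y_def]
    have "{j. 2 * j \<in> J} = {1..2 * int k - 1}" using k by (auto simp: J_def)
    with ds(1) have "valid_on {1..2 * int k - 1} y" by simp
    moreover have "inert y 0" by (rule inert_subsample[OF less.prems(2)]) (simp add: ds(3))
    moreover have "inert y (2 * int k)" by (rule inert_subsample[OF less.prems(3)]) (simp add: ds(3) k)
    ultimately show False using less.IH[of k y] k less.prems(4) by auto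
  qed
qed

section \<open>Half planes above an inert row\<close>

definition half_plane :: "atiling \<Rightarrow> bool" where "half_plane z \<longleftrightarrow> valid_on {1..} z \<and> inert z 0"

text \<open>A change of phase between two rows would produce a second crossless row, contrary to
  \<open>no_strip\<close>. The vertical directions are dictated by the boundary row, so only one
  horizontal phase is free.\<close>

lemma half_plane_cross:
  assumes "half_plane z" "0 \<le> j"
  shows "z (2 * i + 1) (2 * j + 1) = Cross (row_phase z 0 = even i) (even j)"
proof -
  have z: "valid_on {1..} z" "inert z 0" using assms by (auto simp: half_plane_def)
  have j1: "2 * j + 1 \<in> {1..}" using assms by simp
  have b: "cross_up (z (2 * i + 1) (2 * j + 1)) = even j"
    using cross_up_above[OF z, of "nat j" i] assms(2) by (simp add: even_nat_iff)
  have c: "row_phase z (int l + 1) = row_phase z (int l)" for l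
  proof (rule ccontr)
    assume "row_phase z (int l + 1) \<noteq> row_phase z (int l)"
    then have ne: "row_phase z (int l) \<noteq> row_phase z (int l + 1)" by blast
    have J: "2 * int l + 1 \<in> {1..}" "2 * int l + 2 \<in> {1..}" "2 * int l + 3 \<in> {1..}" by auto
    have i: "inert z (2 * int (Suc l))"
      using crossless_inert[OF z(1) J(2) fault_row(1)[OF z(1) J ne]] by (simp add: algebra_simps)
    show False by (rule no_strip[OF _ z(2) i]) (auto intro: valid_on_mono[OF z(1)])
  qed
  have "row_phase z (int l) = row_phase z 0" for l
    by (induction l) (use c in \<open>auto simp: add.commute\<close>)
  from this[of "nat j"] have "row_phase z j = row_phase z 0" using assms(2) by simp
  then have "cross_right (z (2 * i + 1) (2 * j + 1)) = (row_phase z 0 = even i)"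
    using cross_right_row[OF z(1) j1, of i] by simp
  with b show ?thesis by (intro Cross_eqI valid_on_cross[OF z(1) j1]) auto
qed

definition phase_offset :: "atiling \<Rightarrow> int" where "phase_offset z = (if row_phase z 0 then 0 else 2)"

lemma even_phase_offset: "even (phase_offset z)" by (simp add: phase_offset_def)

lemma half_plane_desub:
  assumes z: "half_plane z"
  defines "y \<equiv> half (sh (- phase_offset z) 0 z)"
  shows "half_plane y" "\<And>i j. 1 \<le> j \<Longrightarrow> z i j = inflate y (i - phase_offset z) j" "\<And>i j. y i j = z (2 * i + phase_offset z) (2 * j)"
proof -
  have z': "valid_on {1..} z" "inert z 0" using assms by (auto simp: half_plane_def)
  have J: "2 * j \<in> {1..} \<longleftrightarrow> 2 * j - 1 \<in> {1..} \<and> 2 * j + 1 \<in> {1..}" for j :: int by simp presburger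
  have cr: "z (2 * i + 1 + phase_offset z) (2 * j + 1) = Cross (even i) (even j)" if "2 * j + 1 \<in> {1..}" for i j
  proof -
    have "2 * (i + phase_offset z div 2) + 1 = 2 * i + 1 + phase_offset z" by (auto simp: phase_offset_def)
    then show ?thesis using half_plane_cross[OF z, of j "i + phase_offset z div 2"] that by (auto simp: phase_offset_def)
  qed
  note ds = desub_shift[OF z'(1) J even_phase_offset cr, folded y_def]
  have "{j. 2 * j \<in> {1..}} = {1::int..}" by auto
  moreover have "inert y 0" by (rule inert_subsample[OF z'(2)]) (simp add: ds(3)[of _ 0, simplified])
  ultimately show "half_plane y" using ds(1) by (simp add: half_plane_def)
  show "\<And>i j. 1 \<le> j \<Longrightarrow> z i j = inflate y (i - phase_offset z) j" using ds(2) by simp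
  show "\<And>i j. y i j = z (2 * i + phase_offset z) (2 * j)" using ds(3) by simp
qed

text \<open>The tiles in row 0 may differ, but their upper edges are the lower edges of row
  1.\<close>

lemma inflate_cong_above:
  assumes y: "valid_on {1..} y" and w: "valid_on {1..} w" and eq: "\<And>i j. 1 \<le> j \<Longrightarrow> y i j = w i j" and "1 \<le> j"
  shows "inflate y i j = inflate w i j"
proof -
  have u: "upp (y i j) = upp (w i j)" if "0 \<le> j" for i j
    using valid_on_v[OF y, of j i] valid_on_v[OF w, of j i] eq[of "j + 1" i] that by simp
  show ?thesis
  proof (cases rule: parity4_cases[of i j])
    case (1 k l) then show ?thesis using eq[of l k] assms(4) by simp
  next
    case (2 k l) then show ?thesis using eq[of l k] assms(4) by simp
  next
    case (3 k l) then show ?thesis using u[of l k] assms(4) by simp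
  next
    case (4 k l) then show ?thesis by simp
  qed
qed

lemma valid_on_atLeast_inflate_pow: "valid_on {1..} z \<Longrightarrow> valid_on {1..} ((inflate ^^ n) z)"
  by (induction n) (auto intro: valid_on_atLeast_inflate)

lemma valid_inflate_pow: "valid_on UNIV z \<Longrightarrow> valid_on UNIV ((inflate ^^ n) z)"
  by (induction n) (auto intro: valid_inflate)

text \<open>The boundary row stays in row 0 under deflation, so only a horizontal shift
  accumulates.\<close>

lemma half_plane_levels:
  assumes "half_plane z"
  shows "\<exists>q y. even q \<and> half_plane y \<and> (\<forall>i j. 1 \<le> j \<longrightarrow> z i j = (inflate ^^ n) y (i - q) j)"
  using assms
proof (induction n arbitrary: z)
  case 0
  have "even 0 \<and> half_plane z \<and> (\<forall>i j. 1 \<le> j \<longrightarrow> z i j = (inflate ^^ 0) z (i - 0) j)" using 0 by simp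
  then show ?case by blast
next
  case (Suc n)
  define y where "y = half (sh (- phase_offset z) 0 z)"
  note ds = half_plane_desub[OF Suc.prems, folded y_def]
  obtain q w where q: "even q" "half_plane w" "\<And>i j. 1 \<le> j \<Longrightarrow> y i j = (inflate ^^ n) w (i - q) j"
    using Suc.IH[OF ds(1)] by blast
  have v: "valid_on {1..} ((inflate ^^ n) w)" using q(2) by (auto simp: half_plane_def intro: valid_on_atLeast_inflate_pow)
  have v': "valid_on {1..} (sh q 0 ((inflate ^^ n) w))" using valid_on_sh[OF v q(1), of 0] by (simp add: atLeast_def)
  have "inflate y i j = inflate (sh q 0 ((inflate ^^ n) w)) i j" if "1 \<le> j" for i j
    by (rule inflate_cong_above[OF _ v' _ that]) (use ds(1) q(3) in \<open>auto simp: half_plane_def sh_def\<close>)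
  then have "z i j = (inflate ^^ Suc n) w (i - (phase_offset z + 2 * q)) j" if "1 \<le> j" for i j
    using ds(2)[OF that] that inflate_sh[OF q(1), of 0] by (simp add: sh_def algebra_simps)
  moreover have "even (phase_offset z + 2 * q)" by (simp add: even_phase_offset)
  ultimately show ?case using q(2) by blast
qed

text \<open>In both half planes the crosses of an odd row turn up or down according to the height
  modulo 4. Comparing them at height \<open>2 * R + 1\<close> shows that half the offset is again
  even. Deflation then halves offset and bound, until the bound is 0.\<close>

lemma half_plane_det:
  assumes "half_plane z" "half_plane z'" "even \<rho>" "0 \<le> \<rho>" "\<rho> \<le> R" "\<And>i j. R < j \<Longrightarrow> z i j = z' i (j - \<rho>)"
  shows "\<rho> = 0 \<and> (\<forall>i j. 1 \<le> j \<longrightarrow> z i j = z' i j)"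
  using assms
proof (induction "nat R" arbitrary: R \<rho> z z' rule: less_induct)
  case less
  note z = less.prems(1) and z' = less.prems(2)
  show ?case
  proof (cases "R = 0")
    case True then show ?thesis using less.prems by auto
  next
    case False
    then have R: "0 < R" using less.prems by linarith
    obtain \<sigma> where s: "\<rho> = 2 * \<sigma>" using less.prems(3) by blast
    have eq: "Cross (row_phase z 0 = even i) (even R) = Cross (row_phase z' 0 = even i) (even (R - \<sigma>))" for i :: int
    proof -
      have e: "2 * R + 1 - \<rho> = 2 * (R - \<sigma>) + 1" using s by simp
      have "z (2 * i + 1) (2 * R + 1) = z' (2 * i + 1) (2 * (R - \<sigma>) + 1)"
        using less.prems(6)[of "2 * R + 1" "2 * i + 1"] R unfolding e by simp
      then show ?thesis using half_plane_cross[OF z, of R i] half_plane_cross[OF z', of "R - \<sigma>" i] R less.prems s by simp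
    qed
    then have row_phase: "row_phase z 0 = row_phase z' 0" and es: "even \<sigma>" using eq[of 0] by auto
    have o: "phase_offset z' = phase_offset z" using row_phase by (simp add: phase_offset_def)
    define y where "y = half (sh (- phase_offset z) 0 z)"
    define y' where "y' = half (sh (- phase_offset z') 0 z')"
    note ds = half_plane_desub[OF z, folded y_def] and ds' = half_plane_desub[OF z', folded y'_def]
    have "nat (R div 2) < nat R" using R by linarith
    then have IH: "\<sigma> = 0 \<and> (\<forall>i j. 1 \<le> j \<longrightarrow> y i j = y' i j)"
    proof (rule less.hyps[of _ y y'])
      show "half_plane y" "half_plane y'" by fact+
      show "even \<sigma>" by fact
      show "0 \<le> \<sigma>" "\<sigma> \<le> R div 2" using less.prems s by auto
      fix i j assume "R div 2 < j"
      then have "R < 2 * j" by linarith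
      then show "y i j = y' i (j - \<sigma>)" using less.prems(6)[of "2 * j" "2 * i + phase_offset z"] s
        by (simp add: ds(3) ds'(3) o right_diff_distrib)
    qed
    have "z i j = z' i j" if "1 \<le> j" for i j
      using inflate_cong_above[of y y' j "i - phase_offset z"] ds(1) ds'(1) IH that ds(2)[OF that] ds'(2)[OF that]
      by (auto simp: half_plane_def o)
    then show ?thesis using IH s by simp
  qed
qed

section \<open>Full configurations\<close>

lemma row_phase_transposed: "valid_on UNIV z \<Longrightarrow> cross_up (z (2 * i + 1) (2 * l + 1)) = (row_phase (transposed z) i = even l)"
proof -
  assume z: "valid_on UNIV z"
  have "cross_right (transposed z (2 * l + 1) (2 * i + 1)) = (row_phase (transposed z) i = even l)"
    by (rule cross_right_row[OF valid_transposed[OF z]]) simp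
  moreover have "is_cross (z (2 * i + 1) (2 * l + 1))" by (rule valid_on_cross[OF z]) auto
  ultimately show ?thesis by (auto simp: transposed_def is_cross_iff)
qed

text \<open>If the phase is the same in all rows and in all columns, a shift by 0 or 2 in each
  direction brings the first-level crosses to the places they have in an inflation.\<close>

lemma valid_desub:
  assumes z: "valid_on UNIV z" and r: "\<And>l. row_phase z (l + 1) = row_phase z l" and s: "\<And>l. row_phase (transposed z) (l + 1) = row_phase (transposed z) l"
  shows "\<exists>y. valid_on UNIV y \<and> z = sh (phase_offset z) (phase_offset (transposed z)) (inflate y)"
proof -
  define w where "w = sh (- phase_offset z) (- phase_offset (transposed z)) z"
  have w: "valid_on UNIV w" unfolding w_def by (rule valid_sh) (use z even_phase_offset in auto)
  have "w (2 * i + 1) (2 * j + 1) = Cross (even i) (even j)" for i j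
  proof -
    have e: "2 * i + 1 + phase_offset z = 2 * (i + phase_offset z div 2) + 1" 
      "2 * j + 1 + phase_offset (transposed z) = 2 * (j + phase_offset (transposed z) div 2) + 1" by (auto simp: phase_offset_def)
    have "is_cross (z (2 * (i + phase_offset z div 2) + 1) (2 * (j + phase_offset (transposed z) div 2) + 1))"
      by (rule valid_on_cross[OF z]) auto
    moreover have "cross_right (z (2 * (i + phase_offset z div 2) + 1) (2 * (j + phase_offset (transposed z) div 2) + 1)) = even i"
      using cross_right_row[OF z, of "j + phase_offset (transposed z) div 2" "i + phase_offset z div 2"] int_const[of "row_phase z", OF r]
      by (auto simp: phase_offset_def)
    moreover have "cross_up (z (2 * (i + phase_offset z div 2) + 1) (2 * (j + phase_offset (transposed z) div 2) + 1)) = even j"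
      using row_phase_transposed[OF z, of "i + phase_offset z div 2" "j + phase_offset (transposed z) div 2"] int_const[of "row_phase (transposed z)", OF s]
      by (auto simp: phase_offset_def)
    ultimately show ?thesis unfolding w_def sh_def diff_minus_eq_add e by (rule Cross_eqI)
  qed
  then have "valid_on UNIV (half w)" "w = inflate (half w)"
    using desub[OF w, simplified] by auto
  moreover have "z = sh (phase_offset z) (phase_offset (transposed z)) w" by (simp add: w_def)
  ultimately show ?thesis by metis
qed

lemma crossless_half_plane:
  assumes "valid_on UNIV z" "crossless z 0"
  shows "half_plane z" "half_plane (reflected z)"
proof -
  have i: "inert z 0" using crossless_inert[OF assms(1) _ assms(2)] by simp
  then show "half_plane z" using assms valid_on_mono[OF assms(1)] by (simp add: half_plane_def)
  show "half_plane (reflected z)" using i valid_on_mono[OF valid_reflected[OF assms(1)]] by (simp add: half_plane_def inert_reflected)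
qed

lemma valid_crossless_even:
  assumes "valid_on UNIV z" "crossless z r" shows "even r"
  using valid_on_cross[OF assms(1), of r 1] assms(2) by (auto simp: crossless_def)

text \<open>The crosses next to the row face away from it on both sides, which fixes the vertical
  directions everywhere; the horizontal phases of the two half planes remain independent.\<close>

lemma crossless_cross:
  assumes z: "valid_on UNIV z" "crossless z 0"
  shows "z (2 * i + 1) (2 * j + 1) = Cross (if 0 \<le> j then row_phase z 0 = even i else row_phase z (- 1) = even i) (even j)"
proof (cases "0 \<le> j")
  case True then show ?thesis using half_plane_cross[OF crossless_half_plane(1)[OF z], of j i] by simp
next
  case False
  note h = crossless_half_plane(2)[OF z]
  have "- j - 1 \<ge> 0" using False by simp
  note * = half_plane_cross[OF h this, of i] half_plane_cross[OF h, of 0 0]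
  have e: "- (2 * (- j - 1) + 1) = 2 * j + 1" by simp
  have "flip_atile (z (2 * i + 1) (2 * j + 1)) = Cross (row_phase (reflected z) 0 = even i) (odd j)" 
    using *(1) unfolding reflected_def e by simp
  moreover have "flip_atile (z 1 (- 1)) = Cross (row_phase (reflected z) 0) True"
    using *(2) unfolding reflected_def by simp
  moreover have "t = Cross a (\<not> b)" if "flip_atile t = Cross a b" for t a b
    using that by (metis flip_atile.simps(1) flip_atile_edges(6))
  ultimately have "z (2 * i + 1) (2 * j + 1) = Cross (row_phase (reflected z) 0 = even i) (\<not> odd j)"
    "z 1 (- 1) = Cross (row_phase (reflected z) 0) (\<not> True)" by blast+
  then show ?thesis using False by (simp add: row_phase_def)
qed

text \<open>Deflation halves the width \<open>R\<close> of the unknown strip; if the two half planes do not fit together, then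
  the position of the fault has to be compared in both configurations (lemma \<open>half_plane_det\<close>).\<close>

lemma inflate_cong_off:
  assumes y: "valid_on UNIV y" and w: "valid_on UNIV w" and eq: "\<And>i j. j \<noteq> 0 \<Longrightarrow> y i j = w i j" and "j \<noteq> 0"
  shows "inflate y i j = inflate w i j"
proof -
  have u: "upp (y i j) = upp (w i j)" for i j
    using valid_on_v[OF y, of j i] valid_on_v[OF w, of j i] eq[of "j + 1" i] eq[of j i] by (cases "j = 0") auto
  show ?thesis
  proof (cases rule: parity4_cases[of i j])
    case (1 k l) then show ?thesis using eq[of l k] assms(4) by simp
  next
    case (2 k l) then show ?thesis using eq[of l k] assms(4) by simp
  next
    case (3 k l) then show ?thesis using u[of k l] by simp
  next
    case (4 k l) then show ?thesis by simp
  qed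
qed

lemma fill_strip:
  assumes "valid_on UNIV z" "valid_on UNIV w" "crossless z 0" "\<And>i j. R < \<bar>j\<bar> \<Longrightarrow> z i j = w i j" "0 \<le> R"
  shows "j \<noteq> 0 \<Longrightarrow> z i j = w i j"
  using assms
proof (induction "nat R" arbitrary: R z w i j rule: less_induct)
  case less
  note z = less.prems(2) and w = less.prems(3) and c0 = less.prems(4) and eq = less.prems(5)
  show ?case
  proof (cases "R = 0")
    case True then show ?thesis using eq less.prems(1) by simp
  next
    case False
    then have R: "0 < R" using less.prems(6) by simp
    have ccw: "row_phase w l = row_phase z l" if "R < \<bar>2 * l + 1\<bar>" for l
      using eq[of "2 * l + 1" 1] that by (simp add: row_phase_def)
    have ccz: "row_phase z l = (if 0 \<le> l then row_phase z 0 else row_phase z (- 1))" for l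
      using crossless_cross[OF z c0, of 0 l] by (simp add: row_phase_def)
    have tz: "row_phase (transposed z) i" for i
      using row_phase_transposed[OF z, of i 0] crossless_cross[OF z c0, of i 0] by simp
    have tw: "row_phase (transposed w) i" for i
      using row_phase_transposed[OF w, of i R] eq[of "2 * R + 1" "2 * i + 1"] R row_phase_transposed[OF z, of i R] tz[of i] by auto
    show ?thesis
    proof (cases "\<forall>l. row_phase w (l + 1) = row_phase w l")
      case True
      then have cw: "row_phase w l = row_phase w 0" for l using int_const[of "row_phase w" l] by blast
      \<comment> \<open>Far above and far below, the phases of \<open>w\<close> are those of
        \<open>z\<close>. As they are constant for \<open>w\<close>, the two half planes of
        \<open>z\<close> have the same phase, and both configurations deflate with the same
        shift.\<close>
      have w0: "row_phase w 0 = row_phase z 0" using ccw[of R] cw[of R] ccz[of R] R by simp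
      have "row_phase w 0 = row_phase z (- 1)" using ccw[of "- R - 1"] cw[of "- R - 1"] ccz[of "- R - 1"] R by simp
      then have cz: "row_phase z (l + 1) = row_phase z l" for l using w0 ccz[of l] ccz[of "l + 1"] by auto
      obtain y where y: "valid_on UNIV y" "z = sh (phase_offset z) 0 (inflate y)"
        using valid_desub[OF z cz] tz by (auto simp: phase_offset_def[of "transposed z"])
      obtain y' where y': "valid_on UNIV y'" "w = sh (phase_offset z) 0 (inflate y')"
        using valid_desub[OF w] True tw w0 by (auto simp: phase_offset_def[of "transposed w"]) (auto simp: phase_offset_def)
      have zy: "y i j = z (2 * i + phase_offset z) (2 * j)" for i j using fun_cong[OF fun_cong[OF y(2)]] by (simp add: sh_def)
      have wy: "y' i j = w (2 * i + phase_offset z) (2 * j)" for i j using fun_cong[OF fun_cong[OF y'(2)]] by (simp add: sh_def)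
      have "nat (R div 2) < nat R" using R by linarith
      then have "y i j = y' i j" if "j \<noteq> 0" for i j
      proof (rule less.hyps[of _ j y y' i])
        show "crossless y 0" using c0 by (simp add: crossless_def zy)
        fix i j assume "R div 2 < \<bar>j\<bar>"
        then have "R < \<bar>2 * j\<bar>" by linarith
        then show "y i j = y' i j" using eq by (simp add: zy wy)
      qed (use y y' that R in auto)
      then have "inflate y (i - phase_offset z) j = inflate y' (i - phase_offset z) j" 
        using inflate_cong_off[OF y(1) y'(1)] less.prems(1) by blast
      then show ?thesis using fun_cong[OF fun_cong[OF y(2)]] fun_cong[OF fun_cong[OF y'(2)]] by (simp add: sh_def)
    next
      case False
      then obtain l where l: "row_phase w l \<noteq> row_phase w (l + 1)" by metis
      \<comment> \<open>Now \<open>w\<close> has a fault too. Outside the strip its phases are those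
        of \<open>z\<close>, which can change only at row 0, so the fault of \<open>w\<close> is
        close to the strip; \<open>half_plane_det\<close> then forces it into row 0.\<close>
      define \<rho> where "\<rho> = 2 * l + 2"
      have cr: "crossless w \<rho>" unfolding \<rho>_def by (rule fault_row(1)[OF w]) (use l in auto)
      have "2 * l + 1 \<le> R"
      proof (rule ccontr)
        assume "\<not> 2 * l + 1 \<le> R"
        then show False using ccw[of l] ccw[of "l + 1"] ccz[of l] ccz[of "l + 1"] l R by auto
      qed
      moreover have "- R \<le> 2 * l + 3"
      proof (rule ccontr)
        assume "\<not> - R \<le> 2 * l + 3"
        then show False using ccw[of l] ccw[of "l + 1"] ccz[of l] ccz[of "l + 1"] l R by auto
      qed
      ultimately have bd: "\<rho> \<le> R + 1" "- \<rho> \<le> R + 1" by (auto simp: \<rho>_def)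
      have ev: "even \<rho>" by (simp add: \<rho>_def)
      define w1 where "w1 = sh 0 (- \<rho>) w"
      have w1: "valid_on UNIV w1" "crossless w1 0"
        using valid_sh[OF w, of 0 "- \<rho>"] ev cr by (auto simp: w1_def crossless_def sh_def)
      note hz = crossless_half_plane[OF z c0] and hw = crossless_half_plane[OF w1]
      have "\<rho> = 0"
      proof (cases "0 \<le> \<rho>")
        case True
        show ?thesis by (rule half_plane_det[OF hz(1) hw(1) ev True bd(1), THEN conjunct1])
          (use eq in \<open>auto simp: w1_def sh_def\<close>)
      next
        case False
        have "- \<rho> = 0" by (rule half_plane_det[OF hw(1) hz(1), of _ "R + 1 - \<rho>", THEN conjunct1])
          (use eq ev False R in \<open>auto simp: w1_def sh_def\<close>)
        then show ?thesis by simp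
      qed
      then have "w1 = w" by (simp add: w1_def)
      have up: "\<forall>i j. 1 \<le> j \<longrightarrow> z i j = w i j"
        by (rule half_plane_det[OF hz(1) hw(1), of 0 R, unfolded \<open>w1 = w\<close>, THEN conjunct2]) (use eq R in auto)
      have dn: "\<forall>i j. 1 \<le> j \<longrightarrow> reflected z i j = reflected w i j"
        by (rule half_plane_det[OF hz(2) hw(2), of 0 R, unfolded \<open>w1 = w\<close>, THEN conjunct2]) (use eq R in \<open>auto simp: reflected_def\<close>)
      show ?thesis
      proof (cases "1 \<le> j")
        case True then show ?thesis using up by blast
      next
        case False
        then have "reflected z i (- j) = reflected w i (- j)" using dn less.prems(1) by simp
        then have "flip_atile (z i j) = flip_atile (w i j)" by (simp add: reflected_def)
        then show ?thesis by (metis flip_atile_edges(6))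
      qed
    qed
  qed
qed

section \<open>Levels\<close>

text \<open>This is the hypothesis under which phases are compared. It is weaker than equality, so
  that it holds between different \<open>seeded\<close> configurations, and it passes to
  deflations.\<close>

definition agree_widely :: "atiling \<Rightarrow> atiling \<Rightarrow> bool" where
  "agree_widely z w \<longleftrightarrow> (\<forall>B. \<exists>a b. \<forall>i j. \<bar>i - a\<bar> \<le> B \<longrightarrow> \<bar>j - b\<bar> \<le> B \<longrightarrow> z i j = w i j)"

lemma agree_widely_refl [simp]: "agree_widely z z" by (simp add: agree_widely_def)

lemma agree_widely_sh: "agree_widely (sh p q z) (sh p q w) \<Longrightarrow> agree_widely z w"
  unfolding agree_widely_def
proof (intro allI)
  fix B assume *: "\<forall>B. \<exists>a b. \<forall>i j. \<bar>i - a\<bar> \<le> B \<longrightarrow> \<bar>j - b\<bar> \<le> B \<longrightarrow> sh p q z i j = sh p q w i j"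
  then obtain a b where "\<And>i j. \<bar>i - a\<bar> \<le> B \<Longrightarrow> \<bar>j - b\<bar> \<le> B \<Longrightarrow> sh p q z i j = sh p q w i j" by meson
  from this[of "_ + p" "_ + q"] have "\<forall>i j. \<bar>i - (a - p)\<bar> \<le> B \<longrightarrow> \<bar>j - (b - q)\<bar> \<le> B \<longrightarrow> z i j = w i j"
    by (simp add: sh_def algebra_simps)
  then show "\<exists>a b. \<forall>i j. \<bar>i - a\<bar> \<le> B \<longrightarrow> \<bar>j - b\<bar> \<le> B \<longrightarrow> z i j = w i j" by blast
qed

lemma agree_widely_half: "agree_widely z w \<Longrightarrow> agree_widely (half z) (half w)"
  unfolding agree_widely_def
proof (intro allI)
  fix B assume *: "\<forall>B. \<exists>a b. \<forall>i j. \<bar>i - a\<bar> \<le> B \<longrightarrow> \<bar>j - b\<bar> \<le> B \<longrightarrow> z i j = w i j"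
  then obtain a b where ab: "\<And>i j. \<bar>i - a\<bar> \<le> 2 * B + 2 \<Longrightarrow> \<bar>j - b\<bar> \<le> 2 * B + 2 \<Longrightarrow> z i j = w i j" by meson
  have "half z i j = half w i j" if "\<bar>i - a div 2\<bar> \<le> B" "\<bar>j - b div 2\<bar> \<le> B" for i j
    unfolding half_def by (rule ab) (use that in linarith)+
  then show "\<exists>a b. \<forall>i j. \<bar>i - a\<bar> \<le> B \<longrightarrow> \<bar>j - b\<bar> \<le> B \<longrightarrow> half z i j = half w i j" by blast
qed

lemma agree_widely_inflate_pow: "agree_widely ((inflate ^^ n) y) ((inflate ^^ n) w) \<Longrightarrow> agree_widely y w"
proof (induction n)
  case (Suc n) then show ?case using agree_widely_half by fastforce
qed simp

text \<open>Some arm between these four positions is crossed by a red line and is therefore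
  vertical. Its arrow enters one of the two tiles at its ends, which cannot be a cross.\<close>

lemma valid_noncross:
  assumes z: "valid_on UNIV z" "even a" "even b"
  shows "\<exists>i\<in>{a, a + 2}. \<exists>j\<in>{b, b + 2}. \<not> is_cross (z i j)"
proof -
  have ob: "odd (b + 1)" using assms by simp
  have "\<exists>i\<in>{a, a + 2}. cross_right (z (i - 1) (b + 1))"
    using valid_on_row(1)[OF z(1) _ _ ob, of "a - 1"] z by auto
  then obtain i where i: "i \<in> {a, a + 2}" "cross_right (z (i - 1) (b + 1))" by blast
  then have "odd (i - 1)" using z by auto
  then obtain s r where "z i (b + 1) = Vert s r True"
    using valid_on_row(3)[OF z(1) _ _ ob, of "i - 1"] i by auto
  then have "upp (z i b) = (s, r)" "dwn (z i (b + 2)) = (s, r)"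
    using valid_on_v[OF z(1), of b i] valid_on_v[OF z(1), of "b + 1" i] by (simp_all add: add.assoc)
  then have "\<not> is_cross (z i b) \<or> \<not> is_cross (z i (b + 2))"
    by (cases s) (auto simp: is_cross_iff)
  then show ?thesis using i(1) by blast
qed

text \<open>The forced crosses at odd positions fix the difference of the shifts up to a common
  parity of its coordinates; that both are odd is excluded by \<open>valid_noncross\<close>.\<close>

lemma parity_unique:
  assumes y: "valid_on UNIV y" and w: "valid_on UNIV w" and ag: "agree_widely (sh p q y) (sh p' q' w)"
  shows "even (p - p') \<and> even (q - q')"
proof -
  obtain a b where ab: "\<And>i j. \<bar>i - a\<bar> \<le> 4 \<Longrightarrow> \<bar>j - b\<bar> \<le> 4 \<Longrightarrow> y (i - p) (j - q) = w (i - p') (j - q')"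
    using ag unfolding agree_widely_def sh_def by meson
  define a1 b1 where "a1 = (if even (a - p) then a else a + 1)" "b1 = (if even (b - q) then b else b + 1)"
  have e: "even (a1 - p)" "even (b1 - q)" "\<bar>a1 - a\<bar> \<le> 1" "\<bar>b1 - b\<bar> \<le> 1" by (auto simp: a1_b1_def)
  have o1: "odd (a1 + 1 - p)" "odd (b1 + 1 - q)" using e by presburger+
  then have "is_cross (y (a1 + 1 - p) (b1 + 1 - q))" using valid_on_cross[OF y] by blast
  then have "is_cross (w (a1 + 1 - p') (b1 + 1 - q'))" using ab[of "a1 + 1" "b1 + 1"] e by auto
  then have par: "odd (a1 + 1 - p') = odd (b1 + 1 - q')" using valid_on_parity[OF w] by blast
  obtain i j where ij: "i \<in> {a1 - p, a1 - p + 2}" "j \<in> {b1 - q, b1 - q + 2}" "\<not> is_cross (y i j)"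
    using valid_noncross[OF y e(1,2)] by blast
  then have "\<not> is_cross (w (i + p - p') (j + q - q'))" using ab[of "i + p" "j + q"] e by auto
  then have "\<not> (odd (i + p - p') \<and> odd (j + q - q'))" using valid_on_cross[OF w] by blast
  then show ?thesis using ij par e o1 by auto
qed

text \<open>The pair \<open>p\<close>, \<open>q\<close> is the phase of \<open>z\<close> at level
  \<open>n\<close>. By \<open>at_level_period\<close> and \<open>at_level_unique\<close> it is
  determined exactly modulo \<open>2 ^ Suc n\<close>, one factor more than the scale of the sampled
  lattice, because \<open>valid_on\<close> fixes the parity of \<open>y\<close>.\<close>

definition at_level :: "nat \<Rightarrow> int \<Rightarrow> int \<Rightarrow> atiling \<Rightarrow> bool" where
  "at_level n p q z \<longleftrightarrow> (\<exists>y. valid_on UNIV y \<and> z = sh p q ((inflate ^^ n) y))"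

lemma inflate_pow_sh: "even u \<Longrightarrow> even v \<Longrightarrow> (inflate ^^ n) (sh u v z) = sh (2 ^ n * u) (2 ^ n * v) ((inflate ^^ n) z)"
  by (induction n) (auto simp: inflate_sh mult.assoc)

lemma inflate_pow_sample: "(inflate ^^ n) y (2 ^ n * i) (2 ^ n * j) = y i j"
  by (induction n) (auto simp: mult.assoc)

lemma funpow_Suc_in: "(inflate ^^ Suc n) y = (inflate ^^ n) (inflate y)"
  by (simp only: funpow_Suc_right o_apply)

lemma at_level_Suc: "at_level (Suc n) p q z \<Longrightarrow> at_level n p q z"
  unfolding at_level_def funpow_Suc_in using valid_inflate by blast

lemma at_level_shift: "at_level n p q z \<Longrightarrow> at_level n (p + u) (q + v) (sh u v z)"
  unfolding at_level_def by (auto simp: add.commute)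

lemma at_level_period:
  assumes "at_level n p q z" "2 ^ Suc n dvd p - p'" "2 ^ Suc n dvd q - q'"
  shows "at_level n p' q' z"
proof -
  obtain y where y: "valid_on UNIV y" "z = sh p q ((inflate ^^ n) y)" using assms(1) by (auto simp: at_level_def)
  obtain u v where uv: "p - p' = 2 ^ Suc n * u" "q - q' = 2 ^ Suc n * v" using assms by (meson dvdE)
  have "sh p' q' ((inflate ^^ n) (sh (2 * u) (2 * v) y)) = z"
    using uv by (simp add: inflate_pow_sh y algebra_simps)
  then show ?thesis unfolding at_level_def using valid_sh[OF y(1), of "2 * u" "2 * v"] by auto
qed

lemma at_level_unique:
  assumes "at_level n p q z" "at_level n p' q' w" "agree_widely z w"
  shows "2 ^ Suc n dvd p - p' \<and> 2 ^ Suc n dvd q - q'"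
  using assms
proof (induction n)
  case 0
  then show ?case using parity_unique[of _ _ p q p' q'] by (auto simp: at_level_def)
next
  case (Suc n)
  then have "2 ^ Suc n dvd p - p' \<and> 2 ^ Suc n dvd q - q'" using at_level_Suc by blast
  then obtain u v where uv: "p - p' = 2 ^ Suc n * u" "q - q' = 2 ^ Suc n * v" by (meson dvdE)
  obtain y y' where y: "valid_on UNIV y" "z = sh p q ((inflate ^^ n) (inflate y))" "valid_on UNIV y'" "w = sh p' q' ((inflate ^^ n) (inflate y'))"
    using Suc.prems unfolding at_level_def funpow_Suc_in by blast
  \<comment> \<open>Written with the same shift, both points can be sampled at scale
    \<open>2 ^ Suc n\<close>. What remains is \<open>y\<close> against a shift of \<open>y'\<close>,
    and \<open>parity_unique\<close> gives one more factor 2.\<close>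
  have "w = sh p q ((inflate ^^ n) (sh (2 * - u) (2 * - v) (inflate y')))"
    unfolding y(4) by (subst inflate_pow_sh) (use uv in \<open>auto simp: algebra_simps\<close>)
  then have "agree_widely (inflate y) (sh (2 * - u) (2 * - v) (inflate y'))"
    using Suc.prems(3) y(2) agree_widely_sh agree_widely_inflate_pow by metis
  then have "agree_widely y (half (sh (2 * - u) (2 * - v) (inflate y')))" using agree_widely_half by fastforce
  moreover have "half (sh (2 * - u) (2 * - v) (inflate y')) = sh (- u) (- v) y'"
    by (auto simp: half_def sh_def fun_eq_iff) (metis inflate_simps(1) distrib_left)
  ultimately have "even u \<and> even v" using parity_unique[OF y(1,3), of 0 0 "- u" "- v"] by simp
  then show ?case using uv by auto
qed

section \<open>Fixed points of the substitution\<close>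

lemma seeded_measure:
  fixes k l :: int
  shows "\<not> (k = 0 \<and> l = 0) \<Longrightarrow> nat (\<bar>k\<bar> + \<bar>l\<bar>) < nat (\<bar>2 * k\<bar> + \<bar>2 * l\<bar>)"
    and "0 \<le> k \<Longrightarrow> nat (\<bar>k\<bar> + \<bar>l\<bar>) < nat (\<bar>2 * k + 1\<bar> + \<bar>2 * l\<bar>)"
    and "\<not> 0 \<le> k \<Longrightarrow> nat (\<bar>k + 1\<bar> + \<bar>l\<bar>) < nat (\<bar>2 * k + 1\<bar> + \<bar>2 * l\<bar>)"
    and "0 \<le> l \<Longrightarrow> nat (\<bar>k\<bar> + \<bar>l\<bar>) < nat (\<bar>2 * k\<bar> + \<bar>2 * l + 1\<bar>)"
    and "\<not> 0 \<le> l \<Longrightarrow> nat (\<bar>k\<bar> + \<bar>l + 1\<bar>) < nat (\<bar>2 * k\<bar> + \<bar>2 * l + 1\<bar>)"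
  by linarith+

text \<open>The recursion reads the arms off the neighbour that is closer to the origin.\<close>

function seeded :: "atile \<Rightarrow> int \<Rightarrow> int \<Rightarrow> atile" where
  "seeded t i j =
    (if i = 0 \<and> j = 0 then t
     else if even i \<and> even j then seeded t (i div 2) (j div 2)
     else if odd i \<and> odd j then Cross (even (i div 2)) (even (j div 2))
     else if odd i then horiz (if 0 < i then rgt (seeded t (i div 2) (j div 2)) else lft (seeded t (i div 2 + 1) (j div 2))) (odd (j div 2))
     else vert (if 0 < j then upp (seeded t (i div 2) (j div 2)) else dwn (seeded t (i div 2) (j div 2 + 1))) (odd (i div 2)))"
  by pat_completeness auto
termination
proof (relation "Wellfounded.measure (\<lambda>(t, i, j). nat (\<bar>i\<bar> + \<bar>j\<bar>))")
  fix t :: atile and i j :: int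
  show "((t, i div 2, j div 2), t, i, j) \<in> Wellfounded.measure (\<lambda>(t, i, j). nat (\<bar>i\<bar> + \<bar>j\<bar>))"
    if "\<not> (i = 0 \<and> j = 0)" "even i \<and> even j"
    using that seeded_measure(1)[of "i div 2" "j div 2"] by (auto elim!: evenE)
  show "((t, i div 2, j div 2), t, i, j) \<in> Wellfounded.measure (\<lambda>(t, i, j). nat (\<bar>i\<bar> + \<bar>j\<bar>))"
    if "\<not> (even i \<and> even j)" "\<not> (odd i \<and> odd j)" "odd i" "0 < i"
    using that seeded_measure(2)[of "i div 2" "j div 2"] by simp
  show "((t, i div 2 + 1, j div 2), t, i, j) \<in> Wellfounded.measure (\<lambda>(t, i, j). nat (\<bar>i\<bar> + \<bar>j\<bar>))"
    if "\<not> (even i \<and> even j)" "\<not> (odd i \<and> odd j)" "odd i" "\<not> 0 < i"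
    using that seeded_measure(3)[of "i div 2" "j div 2"] by (auto elim!: evenE oddE)
  show "((t, i div 2, j div 2), t, i, j) \<in> Wellfounded.measure (\<lambda>(t, i, j). nat (\<bar>i\<bar> + \<bar>j\<bar>))"
    if "\<not> (even i \<and> even j)" "\<not> (odd i \<and> odd j)" "\<not> odd i" "0 < j"
    using that seeded_measure(4)[of "j div 2" "i div 2"] by simp
  show "((t, i div 2, j div 2 + 1), t, i, j) \<in> Wellfounded.measure (\<lambda>(t, i, j). nat (\<bar>i\<bar> + \<bar>j\<bar>))"
    if "\<not> (even i \<and> even j)" "\<not> (odd i \<and> odd j)" "\<not> odd i" "\<not> 0 < j"
    using that seeded_measure(5)[of "j div 2" "i div 2"] by (auto elim!: evenE oddE)
qed simp

declare seeded.simps [simp del]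

lemma seeded_0 [simp]: "seeded t 0 0 = t" by (simp add: seeded.simps)

lemma seeded_simps [simp]:
  "seeded t (2 * i) (2 * j) = seeded t i j"
  "seeded t (2 * i + 1) (2 * j + 1) = Cross (even i) (even j)"
proof -
  have "2 * k + 1 \<noteq> (0::int)" for k by presburger
  then show "seeded t (2 * i + 1) (2 * j + 1) = Cross (even i) (even j)"
    by (simp add: seeded.simps[of t "2 * i + 1" "2 * j + 1"])
qed (simp add: seeded.simps[of t "2 * i" "2 * j"])

lemma seeded_horiz: "seeded t (2 * i + 1) (2 * j) = horiz (if 0 \<le> i then rgt (seeded t i j) else lft (seeded t (i + 1) j)) (odd j)"
  by (auto simp: seeded.simps[of t "2 * i + 1" "2 * j"])

lemma seeded_vert: "seeded t (2 * i) (2 * j + 1) = vert (if 0 \<le> j then upp (seeded t i j) else dwn (seeded t i (j + 1))) (odd i)"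
  by (auto simp: seeded.simps[of t "2 * i" "2 * j + 1"])

lemma seeded_transpose_atile: "seeded (transpose_atile t) i j = transpose_atile (seeded t j i)"
proof (induction "nat (\<bar>i\<bar> + \<bar>j\<bar>)" arbitrary: i j rule: less_induct)
  case less
  show ?case
  proof (cases rule: parity4_cases[of i j])
    case (1 k l)
    show ?thesis
    proof (cases "k = 0 \<and> l = 0")
      case False then show ?thesis using less[of k l] seeded_measure(1)[of k l] 1 by simp
    qed (use 1 in auto)
  next
    case (2 k l)
    have "0 \<le> k \<Longrightarrow> seeded (transpose_atile t) k l = transpose_atile (seeded t l k)" "\<not> 0 \<le> k \<Longrightarrow> seeded (transpose_atile t) (k + 1) l = transpose_atile (seeded t l (k + 1))"
      using less[of k l] less[of "k + 1" l] seeded_measure(2,3)[of k l] 2 by simp_all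
    then show ?thesis unfolding 2 seeded_horiz seeded_vert by simp
  next
    case (3 k l)
    have "0 \<le> l \<Longrightarrow> seeded (transpose_atile t) k l = transpose_atile (seeded t l k)" "\<not> 0 \<le> l \<Longrightarrow> seeded (transpose_atile t) k (l + 1) = transpose_atile (seeded t (l + 1) k)"
      using less[of k l] less[of k "l + 1"] seeded_measure(4,5)[of l k] 3 by simp_all
    then show ?thesis unfolding 3 seeded_horiz seeded_vert by simp
  next
    case (4 k l) then show ?thesis by simp
  qed
qed

lemma seeded_cross: "odd i \<Longrightarrow> odd j \<Longrightarrow> is_cross (seeded t i j)"
  by (cases rule: parity4_cases[of i j]) simp_all

lemma seeded_dir_v: "odd i \<Longrightarrow> fst (upp (seeded t i j)) = odd j \<and> fst (dwn (seeded t i j)) = even j"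
  by (cases rule: parity4_cases[of i j]) (auto simp: seeded_horiz)

lemma seeded_match_h: "rgt (seeded t i j) = lft (seeded t (i + 1) j)"
proof (induction "nat (\<bar>i\<bar> + \<bar>j\<bar>)" arbitrary: i j rule: less_induct)
  case less
  have e: "2 * k + 1 + 1 = 2 * (k + 1)" for k :: int by simp
  have d: "odd k \<Longrightarrow> fst (if 0 \<le> l then upp (seeded t k l) else dwn (seeded t k (l + 1))) = odd l" for k l
    by (simp add: seeded_dir_v)
  show ?case
  proof (cases rule: parity4_cases[of i j])
    case (1 k l)
    show ?thesis
    proof (cases "0 \<le> k")
      case True then show ?thesis unfolding 1 seeded_horiz by simp
    next
      case False
      then have "rgt (seeded t k l) = lft (seeded t (k + 1) l)" using less[of k l] seeded_measure(1)[of k l] 1 by simp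
      then show ?thesis unfolding 1 seeded_horiz using False by simp
    qed
  next
    case (2 k l)
    show ?thesis
    proof (cases "0 \<le> k")
      case True
      then have "rgt (seeded t k l) = lft (seeded t (k + 1) l)" using less[of k l] seeded_measure(2)[of k l] 2 by simp
      then show ?thesis unfolding 2 e seeded_horiz seeded_simps using True by simp
    next
      case False then show ?thesis unfolding 2 e seeded_horiz seeded_simps by simp
    qed
  next
    case (3 k l) then show ?thesis unfolding 3 seeded_vert using d[of k l] by auto
  next
    case (4 k l) then show ?thesis unfolding 4 e seeded_vert using d[of "k + 1" l] by auto
  qed
qed

lemma seeded_match_v: "upp (seeded t i j) = dwn (seeded t i (j + 1))"
  using seeded_match_h[of "transpose_atile t" j i] by (simp add: seeded_transpose_atile)

lemma valid_seeded: "valid_on UNIV (seeded t)"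
proof (rule valid_onI)
  fix i j assume "is_cross (seeded t i j)"
  then show "odd i = odd j" by (cases rule: parity4_cases[of i j]) (auto simp: seeded_horiz seeded_vert)
qed (auto simp: seeded_match_h seeded_match_v seeded_cross)

lemma seeded_axis_v: "j \<noteq> 0 \<Longrightarrow> seeded t 0 j = vert (if 0 < j then upp t else dwn t) False"
proof (induction "nat \<bar>j\<bar>" arbitrary: j rule: less_induct)
  case less
  show ?case
  proof (cases rule: int_parity_cases[of j])
    case (1 k)
    then have "seeded t 0 k = vert (if 0 < k then upp t else dwn t) False" using less by auto
    then show ?thesis using seeded_simps(1)[of t 0 k] 1 by simp
  next
    case (2 k)
    have *: "seeded t 0 j = vert (if 0 \<le> k then upp (seeded t 0 k) else dwn (seeded t 0 (k + 1))) False"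
      using seeded_vert[of t 0 k] 2 by simp
    consider "k = 0" | "k = -1" | "0 < k" | "k < - 1" by linarith
    then show ?thesis
    proof cases
      case 3 then show ?thesis using less.hyps[of k] 2 * by auto
    next
      case 4 then show ?thesis using less.hyps[of "k + 1"] 2 * by auto
    qed (use * 2 in auto)
  qed
qed

lemma seeded_axis_h: "i \<noteq> 0 \<Longrightarrow> seeded t i 0 = horiz (if 0 < i then rgt t else lft t) False"
  using seeded_axis_v[of i "transpose_atile t"] seeded_transpose_atile[of "transpose_atile t" i 0] by (simp add: if_distrib[of "\<lambda>e. horiz e _"])

text \<open>The tiles on the axes are arms with no red line across them, so the edges they pass
  sideways do not depend on the seed.\<close>

lemma seeded_off_axis: "i \<noteq> 0 \<Longrightarrow> j \<noteq> 0 \<Longrightarrow> seeded t i j = seeded t' i j"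
proof (induction "nat (\<bar>i\<bar> + \<bar>j\<bar>)" arbitrary: i j rule: less_induct)
  case less
  have h: "rgt (seeded t 0 l) = rgt (seeded t' 0 l)" "lft (seeded t 0 l) = lft (seeded t' 0 l)" if "l \<noteq> 0" for l
    using that by (simp_all add: seeded_axis_v)
  have v: "upp (seeded t k 0) = upp (seeded t' k 0)" "dwn (seeded t k 0) = dwn (seeded t' k 0)" if "k \<noteq> 0" for k
    using that by (simp_all add: seeded_axis_h)
  show ?case
  proof (cases rule: parity4_cases[of i j])
    case (1 k l) then show ?thesis using less.hyps[of k l] less.prems seeded_measure(1)[of k l] by auto
  next
    case (2 k l)
    have "0 \<le> k \<Longrightarrow> rgt (seeded t k l) = rgt (seeded t' k l)" 
      using less.hyps[of k l] less.prems seeded_measure(2)[of k l] 2 h[of l] by (cases "k = 0") auto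
    moreover have "\<not> 0 \<le> k \<Longrightarrow> lft (seeded t (k + 1) l) = lft (seeded t' (k + 1) l)"
      using less.hyps[of "k + 1" l] less.prems seeded_measure(3)[of k l] 2 h[of l] by (cases "k = - 1") auto
    ultimately show ?thesis unfolding 2 seeded_horiz by auto
  next
    case (3 k l)
    have "0 \<le> l \<Longrightarrow> upp (seeded t k l) = upp (seeded t' k l)" 
      using less.hyps[of k l] less.prems seeded_measure(4)[of l k] 3 v[of k] by (cases "l = 0") auto
    moreover have "\<not> 0 \<le> l \<Longrightarrow> dwn (seeded t k (l + 1)) = dwn (seeded t' k (l + 1))"
      using less.hyps[of k "l + 1"] less.prems seeded_measure(5)[of l k] 3 v[of k] by (cases "l = - 1") auto
    ultimately show ?thesis unfolding 3 seeded_vert by auto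
  next
    case (4 k l) then show ?thesis by simp
  qed
qed

lemma inflate_seeded: "inflate (seeded t) = seeded t"
proof (intro ext)
  fix i j
  show "inflate (seeded t) i j = seeded t i j"
    by (cases rule: parity4_cases[of i j]) (auto simp: seeded_horiz seeded_vert seeded_match_h seeded_match_v)
qed

lemma inflate_pow_seeded: "(inflate ^^ n) (seeded t) = seeded t"
  by (induction n) (auto simp: inflate_seeded)

lemma at_level_seeded: "at_level n 0 0 (seeded t)"
  unfolding at_level_def by (rule exI[of _ "seeded t"]) (simp add: valid_seeded inflate_pow_seeded)

text \<open>Each tile is copied from a tile or an edge closer to the origin, with
  \<open>y 0 0\<close> as the only source that is not prescribed. The case \<open>J = {1..}\<close>
  serves half planes, whose row 0 is not constrained beyond its upper edges.\<close>

lemma inflate_pow_near: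
  assumes y: "valid_on J y" and J: "J = UNIV \<or> J = {1..}" and "\<bar>i\<bar> < 2 ^ n" "\<bar>j\<bar> < 2 ^ n" "j \<in> J"
  shows "(inflate ^^ n) y i j = seeded (y 0 0) i j"
  using assms(3-)
proof (induction n arbitrary: i j)
  case 0 then show ?case by simp
next
  case (Suc n)
  define w where "w = (inflate ^^ n) y"
  have w: "valid_on J w" unfolding w_def using y J valid_inflate_pow valid_on_atLeast_inflate_pow by auto
  have w0: "w 0 0 = y 0 0" using inflate_pow_sample[of n y 0 0] by (simp add: w_def)
  have IH: "w i j = seeded (y 0 0) i j" if "\<bar>i\<bar> < 2 ^ n" "\<bar>j\<bar> < 2 ^ n" "j \<in> J" for i j
    using Suc.IH that by (simp add: w_def)
  have Sw: "(inflate ^^ Suc n) y = inflate w" by (simp add: w_def)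
  show ?case
  proof (cases rule: parity4_cases[of i j])
    case (1 k l)
    have "w k l = seeded (y 0 0) k l" by (rule IH) (use 1 Suc.prems J in auto)
    then show ?thesis unfolding 1 Sw seeded_simps inflate_simps .
  next
    case (2 k l)
    have l: "\<bar>l\<bar> < 2 ^ n" "l \<in> J" using 2 Suc.prems J by auto
    have "rgt (w k l) = (if 0 \<le> k then rgt (seeded (y 0 0) k l) else lft (seeded (y 0 0) (k + 1) l))"
    proof (cases "0 \<le> k")
      case True then show ?thesis using IH[of k l] 2 Suc.prems l by simp
    next
      case False then show ?thesis using IH[of "k + 1" l] 2 Suc.prems l valid_on_h[OF w l(2), of k] by simp
    qed
    then show ?thesis unfolding 2 Sw seeded_horiz by simp
  next
    case (3 k l)
    have k: "\<bar>k\<bar> < 2 ^ n" using 3 Suc.prems by simp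
    have v: "upp (w k l) = dwn (w k (l + 1))" by (rule valid_on_v[OF w]) (use 3 J Suc.prems in auto)
    have "upp (w k l) = (if 0 \<le> l then upp (seeded (y 0 0) k l) else dwn (seeded (y 0 0) k (l + 1)))"
    proof -
      consider "l = 0" "k = 0" | "l = 0" "k \<noteq> 0" | "l < 0" | "0 < l" by linarith
      then show ?thesis
      proof cases
        case 1 then show ?thesis using w0 by simp
      next
        case c2: 2
        \<comment> \<open>Row 0 may lie outside \<open>J\<close>, so its upper edge is read from row
          1 instead, which is in reach because \<open>k\<close> is not 0.\<close>
        then have "1 < (2::int) ^ n" using k by linarith
        then have "w k 1 = seeded (y 0 0) k 1" using IH[of k 1] k J by auto
        then show ?thesis using v c2 seeded_match_v[of "y 0 0" k 0] by simp
      next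
        case c3: 3
        then have "w k (l + 1) = seeded (y 0 0) k (l + 1)" using IH[of k "l + 1"] k J 3 Suc.prems by auto
        then show ?thesis using v c3 by simp
      next
        case 4 then show ?thesis using IH[of k l] k J 3 Suc.prems by auto
      qed
    qed
    then show ?thesis unfolding 3 Sw seeded_vert by simp
  next
    case (4 k l) then show ?thesis by (simp add: Sw)
  qed
qed

lemma inflate_pow_near_even:
  assumes y: "valid_on J y" and J: "J = UNIV \<or> (J = {1..} \<and> v = 0)"
    and "even u" "even v" "\<bar>i - 2 ^ n * u\<bar> < 2 ^ n" "\<bar>j - 2 ^ n * v\<bar> < 2 ^ n" "j \<in> J"
  shows "(inflate ^^ n) y i j = seeded (y u v) (i - 2 ^ n * u) (j - 2 ^ n * v)"
proof -
  define w where "w = sh (- u) (- v) y"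
  have "{j. j + v \<in> J} = J" using J by auto
  then have w: "valid_on J w" using valid_on_sh[OF y, of "- u" "- v"] assms(3,4) by (simp add: w_def)
  have "(inflate ^^ n) w = sh (- (2 ^ n * u)) (- (2 ^ n * v)) ((inflate ^^ n) y)"
    unfolding w_def using assms(3,4) by (subst inflate_pow_sh) auto
  then have "(inflate ^^ n) w (i - 2 ^ n * u) (j - 2 ^ n * v) = (inflate ^^ n) y i j" by (simp add: sh_def)
  moreover have "(inflate ^^ n) w (i - 2 ^ n * u) (j - 2 ^ n * v) = seeded (w 0 0) (i - 2 ^ n * u) (j - 2 ^ n * v)"
    by (rule inflate_pow_near[OF w]) (use J assms in auto)
  ultimately show ?thesis by (simp add: w_def sh_def)
qed

lemma seeded_recur:
  assumes "even u" "even v" "\<bar>i\<bar> < 2 ^ n" "\<bar>j\<bar> < 2 ^ n"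
  shows "seeded t (2 ^ n * u + i) (2 ^ n * v + j) = seeded (seeded t u v) i j"
  using inflate_pow_near_even[OF valid_seeded _ assms(1,2), of "2 ^ n * u + i" n "2 ^ n * v + j" t] assms by (simp add: inflate_pow_seeded)

text \<open>With phase zero at level \<open>n\<close>, the block of radius \<open>2 ^ n\<close>
  about the origin is determined by its central tile, and these blocks exhaust the plane.\<close>

lemma seeded_eq_of_levels:
  assumes z: "\<And>n. at_level n 0 0 z"
  shows "z = seeded (z 0 0)"
proof (intro ext)
  fix i j
  obtain n where n: "nat (\<bar>i\<bar> + \<bar>j\<bar>) < 2 ^ n" using less_exp by blast
  then have "int (nat (\<bar>i\<bar> + \<bar>j\<bar>)) < int (2 ^ n)" by linarith
  then have n: "\<bar>i\<bar> + \<bar>j\<bar> < 2 ^ n" by simp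
  obtain y where y: "valid_on UNIV y" "z = (inflate ^^ n) y" using z[of n] by (auto simp: at_level_def)
  have "z 0 0 = y 0 0" using inflate_pow_sample[of n y 0 0] y by simp
  then show "z i j = seeded (z 0 0) i j" using inflate_pow_near[OF y(1), of i n j] n y(2) by simp
qed

text \<open>The crosses at odd coordinates have all four orientations, and every edge label occurs
  beside one of them. The arm that the next inflation inserts there copies the label.\<close>

lemma seeded_occurs: "\<exists>i j. i \<noteq> 0 \<and> j \<noteq> 0 \<and> (\<forall>t'. seeded t' i j = t)"
proof -
  have 1: "\<exists>i j. i \<noteq> 0 \<and> j \<noteq> 0 \<and> (\<forall>t'. seeded t' i j = Cross a b)" for a b
  proof -
    have "seeded t' (2 * (if a then 0 else 1) + 1) (2 * (if b then 0 else 1) + 1) = Cross a b" for t'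
      unfolding seeded_simps by simp
    moreover have "2 * k + 1 \<noteq> (0::int)" for k by presburger
    ultimately show ?thesis by blast
  qed
  have 2: "\<exists>i j. i \<noteq> 0 \<and> j \<noteq> 0 \<and> (\<forall>t'. seeded t' i j = Horiz s r q)" for s r q
  proof -
    \<comment> \<open>\<open>Cross a b\<close> is to show the edge \<open>(s, r)\<close> on its
      right side if \<open>s\<close> holds and on its left side otherwise: \<open>a\<close> decides
      whether there is red, \<open>b\<close> where it is.\<close>
    define a b where "a = (if s then r \<noteq> NoRed else r = NoRed)" "b = (r = Lo)"
    define k l where "k = 2 * (if a then 0 else 1 :: int) + 1" "l = 2 * (if b then 0 else 1 :: int) + 1"
    have kl: "seeded t' k l = Cross a b" for t' unfolding k_l_def seeded_simps by simp
    have e: "(if s then rgt (Cross a b) else lft (Cross a b)) = (s, r)"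
      by (cases r) (auto simp: a_b_def red_side_def)
    \<comment> \<open>The row \<open>m * l\<close> is odd for \<open>m = 1\<close> and even for
      \<open>m = 2\<close>; its parity decides whether a red line crosses the arm.\<close>
    define m where "m = (if q then 1 else 2 :: int)"
    define i where "i = (if s then m * k else m * k - 1)"
    have mk: "seeded t' (m * k) (m * l) = Cross a b" for t'
      using kl by (auto simp: m_def)
    have kpos: "0 < k" "0 < l" "odd l" by (auto simp: k_l_def)
    have i0: "0 \<le> i" using kpos by (auto simp: i_def m_def)
    have "seeded t' (2 * i + 1) (2 * (m * l)) = Horiz s r q" for t'
    proof -
      have "rgt (seeded t' i (m * l)) = (s, r)"
        using e mk[of t'] seeded_match_h[of t' i "m * l"] by (cases s) (auto simp: i_def)
      then show ?thesis unfolding seeded_horiz using i0 kpos by (auto simp: m_def)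
    qed
    moreover have "2 * i + 1 \<noteq> 0" "2 * (m * l) \<noteq> 0" using i0 kpos by (auto simp: m_def)
    ultimately show ?thesis by blast
  qed
  show ?thesis
  proof (cases t)
    case (Vert s r q)
    obtain i j where "i \<noteq> 0" "j \<noteq> 0" "\<And>t'. seeded t' i j = Horiz s r q" using 2 by blast
    then have "\<And>t'. seeded t' j i = Vert s r q" using seeded_transpose_atile by (metis transpose_atile.simps(3) transpose_atile_edges(6))
    then show ?thesis using Vert \<open>i \<noteq> 0\<close> \<open>j \<noteq> 0\<close> by blast
  qed (use 1 2 in auto)
qed

section \<open>The abstract shift space and its symmetries\<close>

definition abs_X :: "atiling set" where "abs_X = {z. \<exists>p q. at_level 0 p q z}"

lemma abs_X_iff: "z \<in> abs_X \<longleftrightarrow> (\<exists>p q y. valid_on UNIV y \<and> z = sh p q y)"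
  by (auto simp: abs_X_def at_level_def)

lemma valid_abs_X: "valid_on UNIV z \<Longrightarrow> z \<in> abs_X"
  unfolding abs_X_iff using sh_0 by metis

lemma abs_X_sh [simp]: "sh u v z \<in> abs_X \<longleftrightarrow> z \<in> abs_X"
proof -
  have "sh u v z \<in> abs_X" if "z \<in> abs_X" for u v z using that unfolding abs_X_iff by force
  from this[of z u v] this[of "sh u v z" "- u" "- v"] show ?thesis by auto
qed

lemma abs_X_transposed [simp]: "transposed z \<in> abs_X \<longleftrightarrow> z \<in> abs_X"
proof -
  have "transposed z \<in> abs_X" if "z \<in> abs_X" for z using that valid_transposed unfolding abs_X_iff by force
  from this[of z] this[of "transposed z"] show ?thesis by auto
qed

lemma abs_X_reflected [simp]: "reflected z \<in> abs_X \<longleftrightarrow> z \<in> abs_X"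
proof -
  have "reflected z \<in> abs_X" if "z \<in> abs_X" for z using that valid_reflected unfolding abs_X_iff by force
  from this[of z] this[of "reflected z"] show ?thesis by auto
qed

lemma transposed_apply: "transposed z i j = transpose_atile (z j i)" and reflected_apply: "reflected z i j = flip_atile (z i (- j))"
  by (simp_all add: transposed_def reflected_def)

lemma abs_X_seeded [simp]: "seeded t \<in> abs_X" by (rule valid_abs_X[OF valid_seeded])

lemma abs_X_agree_widely_valid: "valid_on UNIV z \<Longrightarrow> w \<in> abs_X \<Longrightarrow> agree_widely z w \<Longrightarrow> valid_on UNIV w"
  unfolding abs_X_iff using parity_unique[of z _ 0 0] valid_sh by force

text \<open>\<open>inflate\<close> reads a vertical arm off the tile below it, the reflected
  inflation off the tile above it; in a valid tiling the two edges agree.\<close>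

lemma reflected_inflate:
  assumes "valid_on UNIV z" shows "reflected (inflate z) = inflate (reflected z)"
proof (intro ext)
  have f: "flip_atile (horiz e q) = horiz (fst e, flip_red (snd e)) q" "flip_atile (vert e q) = vert (\<not> fst e, snd e) q" for e q
    by (simp_all add: horiz_def vert_def)
  fix i j
  show "reflected (inflate z) i j = inflate (reflected z) i j"
  proof (cases rule: parity4_cases[of i j])
    case (1 k l)
    have "- (2 * l) = 2 * - l" by simp
    then show ?thesis unfolding 1 by (simp only: reflected_def inflate_simps)
  next
    case (2 k l)
    have e: "- (2 * l) = 2 * - l" by simp
    show ?thesis unfolding 2 reflected_def e inflate_simps f by simp
  next
    case (3 k l)
    have e: "- (2 * l + 1) = 2 * (- l - 1) + 1" by simp
    show ?thesis unfolding 3 reflected_def e inflate_simps f using valid_on_v[OF assms, of "- l - 1" k] by simp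
  next
    case (4 k l)
    have e: "- (2 * l + 1) = 2 * (- l - 1) + 1" by simp
    show ?thesis unfolding 4 reflected_def e inflate_simps by simp
  qed
qed

lemma reflected_seeded: "reflected (seeded t) = seeded (flip_atile t)"
proof -
  have "(inflate ^^ n) (reflected (seeded t)) = reflected (seeded t)" for n
    by (induction n) (auto simp: reflected_inflate[OF valid_seeded, symmetric] inflate_seeded)
  then have "at_level n 0 0 (reflected (seeded t))" for n unfolding at_level_def using valid_reflected[OF valid_seeded] by (metis sh_0)
  then have "reflected (seeded t) = seeded (reflected (seeded t) 0 0)" by (rule seeded_eq_of_levels)
  then show ?thesis by (simp add: reflected_def)
qed

lemma transposed_seeded: "transposed (seeded t) = seeded (transpose_atile t)"
  by (simp add: transposed_def seeded_transpose_atile fun_eq_iff)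

section \<open>Windows that look like a seeded configuration\<close>

lemma near_even_multiple:
  fixes X r :: int
  assumes r: "0 \<le> r" "2 * r < 2 ^ n" and bad: "\<not> (\<exists>w. \<bar>X - 2 ^ Suc n * w\<bar> < 2 ^ n - r)"
  shows "\<exists>w. \<bar>X - 2 ^ Suc (Suc n) * w\<bar> < 2 ^ Suc n - r"
    "\<exists>w. \<bar>X - 2 ^ Suc (Suc (Suc n)) * w\<bar> < 2 ^ Suc (Suc n) - r"
proof -
  define N :: int where "N = 2 ^ n"
  have N: "2 * r < N" "0 < N" using r by (auto simp: N_def)
  define w where "w = X div (2 * N)"
  define e where "e = X mod (2 * N)"
  have X: "X = 2 * N * w + e" "0 \<le> e" "e < 2 * N" using N by (auto simp: w_def e_def)
  have "\<not> \<bar>X - 2 * N * w\<bar> < N - r" "\<not> \<bar>X - 2 * N * (w + 1)\<bar> < N - r"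
    using bad by (auto simp: N_def)
  then have e: "N - r \<le> e" "e \<le> N + r" using X by (auto simp: algebra_simps)
  have "\<exists>w'. \<bar>X - 4 * N * w'\<bar> < 2 * N - r"
  proof (cases rule: int_parity_cases[of w])
    case (1 k) then have "\<bar>X - 4 * N * k\<bar> < 2 * N - r" using X e N by (simp add: algebra_simps)
    then show ?thesis by blast
  next
    case (2 k) then have "\<bar>X - 4 * N * (k + 1)\<bar> < 2 * N - r" using X e N by (simp add: algebra_simps)
    then show ?thesis by blast
  qed
  then show "\<exists>w. \<bar>X - 2 ^ Suc (Suc n) * w\<bar> < 2 ^ Suc n - r" by (simp add: N_def)
  have "\<exists>w'. \<bar>X - 8 * N * w'\<bar> < 4 * N - r"
  proof -
    define k where "k = w div 4"
    have "w = 4 * k \<or> w = 4 * k + 1 \<or> w = 4 * k + 2 \<or> w = 4 * k + 3" unfolding k_def by presburger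
    then have "\<bar>X - 8 * N * k\<bar> < 4 * N - r \<or> \<bar>X - 8 * N * (k + 1)\<bar> < 4 * N - r"
      using X e N by (auto simp: algebra_simps)
    then show ?thesis by blast
  qed
  then show "\<exists>w. \<bar>X - 2 ^ Suc (Suc (Suc n)) * w\<bar> < 2 ^ Suc (Suc n) - r" by (simp add: N_def)
qed

lemma pow2_large: "\<exists>n. (x::int) < 2 ^ n"
proof -
  have "nat \<bar>x\<bar> < 2 ^ nat \<bar>x\<bar>" by (rule less_exp)
  then have "int (nat \<bar>x\<bar>) < int (2 ^ nat \<bar>x\<bar>)" by linarith
  then have "x < 2 ^ nat \<bar>x\<bar>" by simp
  then show ?thesis by blast
qed

text \<open>A window meets the border of the blocks of level \<open>m\<close> only if one of its
  coordinates is close to an odd multiple of \<open>2 ^ m\<close>. By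
  \<open>near_even_multiple\<close> this happens for each coordinate at no more than one of three
  consecutive levels, so one of the three levels is good for both coordinates.\<close>

lemma window_of_levels:
  assumes z: "\<And>n. \<exists>p q. at_level n p q z" and r: "0 \<le> r"
  shows "\<exists>t u v. \<forall>i j. \<bar>i - P\<bar> \<le> r \<longrightarrow> \<bar>j - Q\<bar> \<le> r \<longrightarrow> z i j = seeded t (i - u) (j - v)"
proof -
  obtain N where N: "2 * r < 2 ^ N" using pow2_large by blast
  obtain p q where pq: "at_level (Suc (Suc N)) p q z" using z by blast
  define g where "g m X \<longleftrightarrow> (\<exists>w. \<bar>X - 2 ^ Suc m * w\<bar> < 2 ^ m - r)" for m X
  have N1: "2 * r < 2 ^ Suc N" using N r by simp
  have *: "\<not> g N X \<Longrightarrow> g (Suc N) X" "\<not> g N X \<Longrightarrow> g (Suc (Suc N)) X" 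
    "\<not> g (Suc N) X \<Longrightarrow> g (Suc (Suc N)) X" for X
    using near_even_multiple[OF r N, of X] near_even_multiple[OF r N1, of X] unfolding g_def by blast+
  obtain m where m: "m \<in> {N, Suc N, Suc (Suc N)}" "g m (P - p)" "g m (Q - q)"
    using *[of "P - p"] *[of "Q - q"] by blast
  then obtain u v where uv: "\<bar>P - p - 2 ^ Suc m * u\<bar> < 2 ^ m - r" "\<bar>Q - q - 2 ^ Suc m * v\<bar> < 2 ^ m - r"
    by (auto simp: g_def)
  have "at_level m p q z" using m(1) pq at_level_Suc by blast
  then obtain y where y: "valid_on UNIV y" "z = sh p q ((inflate ^^ m) y)" by (auto simp: at_level_def)
  have "z i j = seeded (y (2 * u) (2 * v)) (i - (p + 2 ^ Suc m * u)) (j - (q + 2 ^ Suc m * v))"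
    if "\<bar>i - P\<bar> \<le> r" "\<bar>j - Q\<bar> \<le> r" for i j
  proof -
    have "(inflate ^^ m) y (i - p) (j - q) = seeded (y (2 * u) (2 * v)) (i - p - 2 ^ m * (2 * u)) (j - q - 2 ^ m * (2 * v))"
      by (rule inflate_pow_near_even[OF y(1)]) (use uv that in auto)
    then show ?thesis by (simp add: y(2) sh_def algebra_simps)
  qed
  then show ?thesis by blast
qed

text \<open>Vertically the phase is zero at every level, so a high level suffices. Only the
  horizontal coordinate has to avoid the borders of blocks, and for this two levels offer enough
  choice.\<close>

lemma window_of_half_plane:
  assumes z: "half_plane z" and r: "0 \<le> r" "r < Q"
  shows "\<exists>t u. \<forall>i j. \<bar>i - P\<bar> \<le> r \<longrightarrow> \<bar>j - Q\<bar> \<le> r \<longrightarrow> z i j = seeded t (i - u) j"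
proof -
  obtain N where N: "2 * (Q + r) < 2 ^ N" using pow2_large by blast
  then have N1: "2 * r < 2 ^ N" using r by simp
  obtain p y where y: "half_plane y" "\<And>i j. 1 \<le> j \<Longrightarrow> z i j = (inflate ^^ Suc N) y (i - p) j"
    using half_plane_levels[OF z, of "Suc N"] by blast
  have v: "valid_on {1..} y" using y by (simp add: half_plane_def)
  define g where "g m X \<longleftrightarrow> (\<exists>w. \<bar>X - 2 ^ Suc m * w\<bar> < 2 ^ m - r)" for m X
  have "\<exists>m w. m \<ge> N \<and> valid_on {1..} w \<and> (inflate ^^ Suc N) y = (inflate ^^ m) w \<and> g m (P - p)"
  proof (cases "g N (P - p)")
    case True
    then show ?thesis using valid_on_atLeast_inflate[OF v] funpow_Suc_in by blast
  next
    case False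
    then have "g (Suc N) (P - p)" using near_even_multiple[OF r(1) N1, of "P - p"] unfolding g_def by blast
    then show ?thesis using v le_SucI by blast
  qed
  then obtain m w u where m: "m \<ge> N" "valid_on {1..} w" "(inflate ^^ Suc N) y = (inflate ^^ m) w" 
    "\<bar>P - p - 2 ^ Suc m * u\<bar> < 2 ^ m - r" unfolding g_def by blast
  have "2 * (Q + r) < 2 ^ m" by (rule less_le_trans[OF N]) (use m(1) in simp)
  moreover have "Q + r \<le> 2 * (Q + r)" using r by simp
  ultimately have Q: "Q + r < 2 ^ m" by (rule le_less_trans[rotated])
  have "z i j = seeded (w (2 * u) 0) (i - (p + 2 ^ Suc m * u)) j"
    if "\<bar>i - P\<bar> \<le> r" "\<bar>j - Q\<bar> \<le> r" for i j
  proof -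
    have "(inflate ^^ m) w (i - p) j = seeded (w (2 * u) 0) (i - p - 2 ^ m * (2 * u)) (j - 2 ^ m * 0)"
      by (rule inflate_pow_near_even[OF m(2)]) (use m that Q r in auto)
    moreover have "z i j = (inflate ^^ m) w (i - p) j" unfolding m(3)[symmetric] by (rule y(2)) (use that r in linarith)
    ultimately show ?thesis by (simp add: algebra_simps)
  qed
  then show ?thesis by blast
qed

section \<open>Automorphisms that fix every seeded configuration\<close>

locale automorphism =
  fixes F :: "atiling \<Rightarrow> atiling" and r :: int
  assumes r: "0 \<le> r"
    and F_abs_X: "z \<in> abs_X \<Longrightarrow> F z \<in> abs_X"
    and F_inj: "z \<in> abs_X \<Longrightarrow> w \<in> abs_X \<Longrightarrow> F z = F w \<Longrightarrow> z = w"
    and F_sh: "z \<in> abs_X \<Longrightarrow> F (sh u v z) = sh u v (F z)"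
    and F_loc: "z \<in> abs_X \<Longrightarrow> w \<in> abs_X \<Longrightarrow>
      (\<And>i j. \<bar>i - P\<bar> \<le> r \<Longrightarrow> \<bar>j - Q\<bar> \<le> r \<Longrightarrow> z i j = w i j) \<Longrightarrow> F z P Q = F w P Q"
    and F_seeded: "F (seeded t) = seeded t"
begin

lemma automorphism_transposed: "automorphism (\<lambda>z. transposed (F (transposed z))) r"
proof
  fix z w P Q assume *: "z \<in> abs_X" "w \<in> abs_X" "\<And>i j. \<bar>i - P\<bar> \<le> r \<Longrightarrow> \<bar>j - Q\<bar> \<le> r \<Longrightarrow> z i j = w i j"
  have "F (transposed z) Q P = F (transposed w) Q P" by (rule F_loc) (use * in \<open>auto simp: transposed_apply\<close>)
  then show "transposed (F (transposed z)) P Q = transposed (F (transposed w)) P Q" by (simp add: transposed_def)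
next
  fix z w assume "z \<in> abs_X" "w \<in> abs_X" "transposed (F (transposed z)) = transposed (F (transposed w))"
  then show "z = w" using F_inj[of "transposed z" "transposed w"] by (metis transposed_transposed abs_X_transposed)
qed (auto simp: r F_abs_X F_sh F_seeded transposed_seeded)

lemma automorphism_reflected: "automorphism (\<lambda>z. reflected (F (reflected z))) r"
proof
  fix z w P Q assume *: "z \<in> abs_X" "w \<in> abs_X" "\<And>i j. \<bar>i - P\<bar> \<le> r \<Longrightarrow> \<bar>j - Q\<bar> \<le> r \<Longrightarrow> z i j = w i j"
  have "F (reflected z) P (- Q) = F (reflected w) P (- Q)" by (rule F_loc) (use * in \<open>auto simp: reflected_apply\<close>)
  then show "reflected (F (reflected z)) P Q = reflected (F (reflected w)) P Q" by (simp add: reflected_def)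
next
  fix z w assume "z \<in> abs_X" "w \<in> abs_X" "reflected (F (reflected z)) = reflected (F (reflected w))"
  then show "z = w" using F_inj[of "reflected z" "reflected w"] by (metis reflected_reflected abs_X_reflected)
qed (auto simp: r F_abs_X F_sh F_seeded reflected_seeded)

lemma F_window:
  assumes "z \<in> abs_X" "\<And>i j. \<bar>i - P\<bar> \<le> r \<Longrightarrow> \<bar>j - Q\<bar> \<le> r \<Longrightarrow> z i j = seeded t (i - u) (j - v)"
  shows "F z P Q = z P Q"
proof -
  have "F z P Q = F (sh u v (seeded t)) P Q" by (rule F_loc) (use assms in \<open>auto simp: sh_apply\<close>)
  also have "\<dots> = sh u v (seeded t) P Q" by (simp add: F_sh F_seeded)
  also have "\<dots> = z P Q" using assms(2)[of P Q] r by (simp add: sh_def)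
  finally show ?thesis .
qed

lemma F_levels:
  assumes z: "\<And>n. \<exists>p q. at_level n p q z"
  shows "F z = z"
proof (intro ext)
  fix P Q
  obtain t u v where "\<And>i j. \<bar>i - P\<bar> \<le> r \<Longrightarrow> \<bar>j - Q\<bar> \<le> r \<Longrightarrow> z i j = seeded t (i - u) (j - v)"
    using window_of_levels[OF z r] by meson
  moreover have "z \<in> abs_X" using z[of 0] by (simp add: abs_X_def)
  ultimately show "F z P Q = z P Q" using F_window by blast
qed

lemma F_half_plane:
  assumes "z \<in> abs_X" "half_plane z" "r < Q" shows "F z P Q = z P Q"
proof -
  obtain t u where "\<And>i j. \<bar>i - P\<bar> \<le> r \<Longrightarrow> \<bar>j - Q\<bar> \<le> r \<Longrightarrow> z i j = seeded t (i - u) j"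
    using window_of_half_plane[OF assms(2) r assms(3)] by meson
  then show ?thesis using F_window[OF assms(1), of P Q t u 0] by simp
qed

lemma F_half_plane_below:
  assumes "z \<in> abs_X" "half_plane (reflected z)" "r < Q" shows "F z P (- Q) = z P (- Q)"
proof -
  have "reflected (F (reflected (reflected z))) P Q = reflected z P Q"
    using automorphism.F_half_plane[OF automorphism_reflected, of "reflected z"] assms by simp
  then show ?thesis by (simp add: reflected_def) (metis flip_atile_edges(6))
qed

text \<open>At distance more than \<open>r\<close> from the row every window lies in one half plane,
  where \<open>F\<close> changes nothing; \<open>fill_strip\<close> recovers the rows in between,
  except for the row itself.\<close>

lemma F_off_row:
  assumes z: "valid_on UNIV z" "crossless z 0"
  shows "valid_on UNIV (F z)" "j \<noteq> 0 \<Longrightarrow> F z i j = z i j"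
proof -
  have far: "z i j = F z i j" if "r < \<bar>j\<bar>" for i j
  proof (cases "0 \<le> j")
    case True then show ?thesis using F_half_plane[OF valid_abs_X[OF z(1)] crossless_half_plane(1)[OF z], of j i] that by simp
  next
    case False then show ?thesis using F_half_plane_below[OF valid_abs_X[OF z(1)] crossless_half_plane(2)[OF z], of "- j" i] that by simp
  qed
  have "agree_widely z (F z)" unfolding agree_widely_def
  proof
    fix B
    have "\<forall>i j. \<bar>i - 0\<bar> \<le> B \<longrightarrow> \<bar>j - (B + r + 1)\<bar> \<le> B \<longrightarrow> z i j = F z i j"
      by (intro allI impI far) linarith
    then show "\<exists>a b. \<forall>i j. \<bar>i - a\<bar> \<le> B \<longrightarrow> \<bar>j - b\<bar> \<le> B \<longrightarrow> z i j = F z i j" by blast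
  qed
  then show v: "valid_on UNIV (F z)" using abs_X_agree_widely_valid[OF z(1) F_abs_X[OF valid_abs_X[OF z(1)]]] by blast
  show "F z i j = z i j" if "j \<noteq> 0"
    using fill_strip[OF z(1) v z(2) far r that] by simp
qed

end

section \<open>The tiles on a fault row\<close>

lemma row_edges:
  assumes "valid_on UNIV z" "valid_on UNIV w" "\<And>i j. j \<noteq> 0 \<Longrightarrow> w i j = z i j"
  shows "upp (w i 0) = upp (z i 0)" "dwn (w i 0) = dwn (z i 0)"
  using valid_on_v[OF assms(1), of 0 i] valid_on_v[OF assms(2), of 0 i] assms(3)[of 1 i]
    valid_on_v[OF assms(1), of "- 1" i] valid_on_v[OF assms(2), of "- 1" i] assms(3)[of "- 1" i] by auto

text \<open>The vertical edges alone tell the kinds apart: both arrows point outwards at a cross,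
  inwards at a horizontal arm, and in parallel at a vertical arm. One horizontal edge supplies what
  is still open.\<close>

lemma noncross_det:
  assumes "\<not> is_cross t" "upp t' = upp t" "dwn t' = dwn t" "lft t' = lft t \<or> rgt t' = rgt t"
  shows "t' = t"
  using assms by (cases t; cases t') (auto split: if_splits)

lemma row_determined:
  assumes z: "valid_on UNIV z" "crossless z 0" and w: "valid_on UNIV w" and off: "\<And>i j. j \<noteq> 0 \<Longrightarrow> w i j = z i j"
    and eq: "w k 0 = z k 0"
  shows "w = z"
proof -
  note e = row_edges[OF z(1) w off]
  have "w i 0 = z i 0" for i
  proof (induction i rule: int_induct[where k = k])
    case (step1 i)
    have "lft (w (i + 1) 0) = lft (z (i + 1) 0)"
      using valid_on_h[OF z(1), of 0 i] valid_on_h[OF w, of 0 i] step1 by simp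
    then show ?case using e z(2) by (intro noncross_det) (auto simp: crossless_def)
  next
    case (step2 i)
    have "rgt (w (i - 1) 0) = rgt (z (i - 1) 0)"
      using valid_on_h[OF z(1), of 0 "i - 1"] valid_on_h[OF w, of 0 "i - 1"] step2 by simp
    then show ?case using e z(2) by (intro noncross_det) (auto simp: crossless_def)
  qed (rule eq)
  then show ?thesis using off by (metis ext)
qed

text \<open>In the first \<open>2 ^ n - 1\<close> rows, a column that is not a multiple of
  \<open>2 ^ n\<close> lies inside a seeded block and off its axes, where the tile does not depend
  on the seed.\<close>

lemma interior:
  assumes y: "valid_on {1..} y" "valid_on {1..} y'" and "\<not> 2 ^ n dvd X" "1 \<le> j" "j < 2 ^ n"
  shows "(inflate ^^ n) y X j = (inflate ^^ n) y' (X - 2 ^ Suc n * k) j"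
proof -
  define N :: int where "N = 2 ^ n"
  have N: "0 < N" by (simp add: N_def)
  \<comment> \<open>\<open>2 * N * u\<close> is the multiple of \<open>2 * N\<close> nearest to
    \<open>X\<close>, the centre of its block.\<close>
  define u where "u = (X + N) div (2 * N)"
  define e where "e = (X + N) mod (2 * N)"
  have X: "X = 2 * N * u + e - N" "0 \<le> e" "e < 2 * N"
    using N by (auto simp: u_def e_def)
  have "\<not> N dvd X" using assms(3) by (simp add: N_def)
  then have "e \<noteq> 0" "e \<noteq> N"
    using X(1) dvdI[of X N "2 * u - 1"] dvdI[of X N "2 * u"] by (auto simp: algebra_simps)
  then have ab: "\<bar>X - N * (2 * u)\<bar> < N" "X - N * (2 * u) \<noteq> 0" using X by auto
  have A: "(inflate ^^ n) y X j = seeded (y (2 * u) 0) (X - 2 ^ n * (2 * u)) (j - 2 ^ n * 0)"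
    by (rule inflate_pow_near_even[OF y(1)]) (use ab assms in \<open>auto simp: N_def\<close>)
  have B: "(inflate ^^ n) y' (X - 2 ^ Suc n * k) j
      = seeded (y' (2 * (u - k)) 0) (X - 2 ^ Suc n * k - 2 ^ n * (2 * (u - k))) (j - 2 ^ n * 0)"
    by (rule inflate_pow_near_even[OF y(2)]) (use ab assms in \<open>auto simp: N_def algebra_simps\<close>)
  have e: "X - 2 ^ Suc n * k - 2 ^ n * (2 * (u - k)) = X - 2 ^ n * (2 * u)"
    by (simp add: algebra_simps)
  show ?thesis unfolding A B e by (rule seeded_off_axis) (use ab(2) assms(4) in \<open>auto simp: N_def\<close>)
qed

text \<open>The vertical axis through the seed carries no red along the arm, so \<open>q\<close> has
  an effect on the row of the seed only.\<close>

definition ray_seed :: "bool \<Rightarrow> bool \<Rightarrow> atile" where "ray_seed d q = Vert d NoRed q"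

text \<open>The upper and the lower half plane come from shifts of the same seeded configuration; the row
  between them belongs to the half from which the arm at the seed enters it.\<close>

definition glued :: "bool \<Rightarrow> bool \<Rightarrow> int \<Rightarrow> int \<Rightarrow> atiling" where
  "glued d q \<alpha> \<beta> i j = (if 0 < j \<or> j = 0 \<and> d then seeded (ray_seed d q) (i - \<alpha>) j else seeded (ray_seed d q) (i - \<beta>) j)"

lemma seeded_ray_seed_row:
  "seeded (ray_seed d q) i 0 = (if i = 0 then Vert d NoRed q else Horiz (i < 0) (if q then red_side (\<not> d) else NoRed) False)"
  by (auto simp: seeded_axis_h ray_seed_def horiz_def)

lemma seeded_ray_seed_off: "j \<noteq> 0 \<Longrightarrow> seeded (ray_seed d q) i j = seeded (ray_seed d q') i j"
  using seeded_off_axis[of i j "ray_seed d q" "ray_seed d q'"] by (cases "i = 0") (auto simp: seeded_axis_v ray_seed_def)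

lemma glued_row:
  "glued d q \<alpha> \<beta> i 0 = (let \<gamma> = if d then \<alpha> else \<beta> in
     if i = \<gamma> then Vert d NoRed q else Horiz (i < \<gamma>) (if q then red_side (\<not> d) else NoRed) False)"
  unfolding glued_def Let_def seeded_ray_seed_row by auto

lemma glued_off: "j \<noteq> 0 \<Longrightarrow> glued d q \<alpha> \<beta> i j = glued d q' \<alpha> \<beta> i j"
  using seeded_ray_seed_off by (simp add: glued_def)

lemma glued_crossless: "crossless (glued d q \<alpha> \<beta>) 0"
  by (auto simp: crossless_def glued_row Let_def)

text \<open>On the side away from its half plane, the row has the same vertical edge everywhere,
  directed by \<open>d\<close> and without red. The other half plane can therefore slide along
  it.\<close>

lemma valid_glued:
  assumes "even \<alpha>" "even \<beta>" shows "valid_on UNIV (glued d q \<alpha> \<beta>)"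
proof (rule valid_onI)
  note omv = valid_seeded[of "ray_seed d q"]
  fix i j :: int
  show "rgt (glued d q \<alpha> \<beta> i j) = lft (glued d q \<alpha> \<beta> (i + 1) j)"
    using valid_on_h[OF omv, of j "i - \<alpha>"] valid_on_h[OF omv, of j "i - \<beta>"] by (simp add: glued_def algebra_simps)
  show "upp (glued d q \<alpha> \<beta> i j) = dwn (glued d q \<alpha> \<beta> i (j + 1))"
  proof -
    have row: "d \<Longrightarrow> dwn (seeded (ray_seed d q) k 0) = (True, NoRed)" "\<not> d \<Longrightarrow> upp (seeded (ray_seed d q) k 0) = (False, NoRed)" for k
      by (auto simp: seeded_ray_seed_row)
    consider "0 < j" | "j = 0" | "j = -1" | "j < - 1" by linarith
    then show ?thesis
    proof cases
      case 2
      then show ?thesis using valid_on_v[OF omv, of 0 "i - \<alpha>"] valid_on_v[OF omv, of 0 "i - \<beta>"] row(2)[of "i - \<alpha>"] row(2)[of "i - \<beta>"]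
        by (cases d) (simp_all add: glued_def)
    next
      case 3
      then show ?thesis using valid_on_v[OF omv, of "-1" "i - \<alpha>"] valid_on_v[OF omv, of "-1" "i - \<beta>"] row(1)[of "i - \<alpha>"] row(1)[of "i - \<beta>"]
        by (cases d) (simp_all add: glued_def)
    qed (use valid_on_v[OF omv, of j "i - \<alpha>"] valid_on_v[OF omv, of j "i - \<beta>"] in \<open>simp_all add: glued_def\<close>)
  qed
  show "odd i \<Longrightarrow> odd j \<Longrightarrow> is_cross (glued d q \<alpha> \<beta> i j)"
    using valid_on_cross[OF omv, of j "i - \<alpha>"] valid_on_cross[OF omv, of j "i - \<beta>"] assms by (simp add: glued_def)
  show "is_cross (glued d q \<alpha> \<beta> i j) \<Longrightarrow> odd i = odd j"
    using valid_on_parity[OF omv, of j "i - \<alpha>"] valid_on_parity[OF omv, of j "i - \<beta>"] assms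
    by (auto simp: glued_def split: if_splits)
qed

lemma lattice_gap:
  fixes a b r :: int
  assumes "4 * r + 8 < 2 ^ n" "0 \<le> r"
  shows "\<exists>k. \<forall>i. \<bar>i - k\<bar> \<le> r \<longrightarrow> \<not> 2 ^ n dvd i - a \<and> \<not> 2 ^ n dvd i - b"
proof -
  define N :: int where "N = 2 ^ n"
  have N: "4 * r + 8 < N" using assms by (simp add: N_def)
  define m where "m = (b - a) mod N"
  have m: "0 \<le> m" "m < N" using N assms by (auto simp: m_def)
  have "N dvd b - a - m" unfolding m_def minus_mod_eq_mult_div by simp
  then have bm: "N dvd i - b \<longleftrightarrow> N dvd i - a - m" for i
    using dvd_add_left_iff[of N "b - a - m" "i - b"] by (simp add: algebra_simps)
  have nd: "\<not> N dvd x" if "0 < x" "x < N" for x using that zdvd_not_zless by blast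
  have nd': "\<not> N dvd x" if "- N < x" "x < 0" for x using nd[of "- x"] that by simp
  \<comment> \<open>The two progressions cut a period into pieces of lengths \<open>m\<close> and
    \<open>N - m\<close>, one of which is long enough; the window is placed at the left end of that
    piece.\<close>
  define k where "k = (if 2 * r + 4 < m then a + r + 1 else a + m + r + 1)"
  have "\<not> N dvd i - a \<and> \<not> N dvd i - a - m" if i: "\<bar>i - k\<bar> \<le> r" for i
  proof (cases "2 * r + 4 < m")
    case True then show ?thesis using i m N nd[of "i - a"] nd'[of "i - a - m"] by (auto simp: k_def)
  next
    case False then show ?thesis using i m N nd[of "i - a"] nd[of "i - a - m"] by (auto simp: k_def)
  qed
  then show ?thesis using bm unfolding N_def by blast
qed

context automorphism begin

text \<open>The vertical edges of the row survive, and at the seed they force a vertical arm without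
  red along it. Only \<open>q\<close> is left open there, and this one tile determines the
  row.\<close>

lemma F_glued_ex:
  assumes ev: "even \<alpha>" "even \<beta>"
  shows "\<exists>q'. F (glued d q \<alpha> \<beta>) = glued d q' \<alpha> \<beta>"
proof -
  note w = valid_glued[OF ev, of d q] glued_crossless[of d q \<alpha> \<beta>]
  note f = F_off_row[OF w]
  define \<gamma> where "\<gamma> = (if d then \<alpha> else \<beta>)"
  have "upp (F (glued d q \<alpha> \<beta>) \<gamma> 0) = (d, NoRed)" "dwn (F (glued d q \<alpha> \<beta>) \<gamma> 0) = (d, NoRed)"
    using row_edges[OF w(1) f(1,2), of \<gamma>] by (auto simp: glued_row \<gamma>_def Let_def)
  then obtain q' where q': "F (glued d q \<alpha> \<beta>) \<gamma> 0 = Vert d NoRed q'"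
    by (cases "F (glued d q \<alpha> \<beta>) \<gamma> 0") auto
  have "F (glued d q \<alpha> \<beta>) = glued d q' \<alpha> \<beta>"
  proof (rule row_determined[OF valid_glued[OF ev] glued_crossless f(1)])
    show "F (glued d q \<alpha> \<beta>) i j = glued d q' \<alpha> \<beta> i j" if "j \<noteq> 0" for i j using f(2)[OF that] glued_off[OF that] by simp
    show "F (glued d q \<alpha> \<beta>) \<gamma> 0 = glued d q' \<alpha> \<beta> \<gamma> 0" using q' by (simp add: glued_row \<gamma>_def[symmetric] Let_def)
  qed
  then show ?thesis by blast
qed

text \<open>Without red, the two values of \<open>d\<close> give the same tiles to the left of both
  seeds, so their images agree there. Red in the images would have to sit at \<open>Hi\<close> for
  one value of \<open>d\<close> and at \<open>Lo\<close> for the other; hence no red appears, and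
  \<open>q = False\<close> is preserved. Injectivity then preserves \<open>q = True\<close>.\<close>

lemma F_glued:
  assumes ev: "even \<alpha>" "even \<beta>"
  shows "F (glued d q \<alpha> \<beta>) = glued d q \<alpha> \<beta>"
proof -
  \<comment> \<open>The window about \<open>k\<close> ends just before the leftmost seed.\<close>
  define k where "k = min \<alpha> \<beta> - r - 1"
  have WY: "glued d q \<alpha> \<beta> \<in> abs_X" for d q using valid_abs_X[OF valid_glued[OF ev]] .
  have "F (glued True False \<alpha> \<beta>) k 0 = F (glued False False \<alpha> \<beta>) k 0"
  proof (rule F_loc[OF WY WY])
    fix i j assume "\<bar>i - k\<bar> \<le> r" "\<bar>j - 0\<bar> \<le> r"
    then have i: "i < \<alpha>" "i < \<beta>" by (auto simp: k_def)
    show "glued True False \<alpha> \<beta> i j = glued False False \<alpha> \<beta> i j"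
    proof (cases "j = 0")
      case True then show ?thesis using i by (simp add: glued_row)
    next
      case False then show ?thesis using i seeded_off_axis[of _ j "ray_seed True False" "ray_seed False False"] by (auto simp: glued_def)
    qed
  qed
  moreover obtain q1 q2 where q: "F (glued True False \<alpha> \<beta>) = glued True q1 \<alpha> \<beta>" "F (glued False False \<alpha> \<beta>) = glued False q2 \<alpha> \<beta>"
    using F_glued_ex[OF ev] by metis
  moreover have "k < \<alpha>" "k < \<beta>" using r by (auto simp: k_def)
  ultimately have "\<not> q1" "\<not> q2" by (auto simp: glued_row split: if_splits)
  then have F0: "F (glued d False \<alpha> \<beta>) = glued d False \<alpha> \<beta>" for d using q by (cases d) auto
  obtain q' where q': "F (glued d True \<alpha> \<beta>) = glued d q' \<alpha> \<beta>" using F_glued_ex[OF ev] by blast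
  have "glued d p \<alpha> \<beta> (if d then \<alpha> else \<beta>) 0 = Vert d NoRed p" for p by (simp add: glued_row)
  then have "glued d True \<alpha> \<beta> \<noteq> glued d False \<alpha> \<beta>" by (metis atile.inject(2))
  then have q'T: "q'" using F_inj[OF WY WY, of d True d False] q' F0[of d] by (cases q') auto
  show ?thesis using F0 q' q'T by (cases q) auto
qed

text \<open>By \<open>row_determined\<close> a single tile of the row suffices. It is chosen where
  no multiple of \<open>2 ^ n\<close> of either half plane is near: there the tiles off the row are
  those of any glued configuration with these phases, and the row is a run of equal horizontal arms,
  which some glued configuration reproduces.\<close>

lemma F_crossless:
  assumes z: "valid_on UNIV z" "crossless z 0"
  shows "F z = z"
proof -
  note f = F_off_row[OF z]
  \<comment> \<open>One more than the radius, so that the rows 1 and -1 are covered even for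
    \<open>r = 0\<close>.\<close>
  define R where "R = r + 1"
  obtain n where n: "4 * R + 8 < 2 ^ n" using pow2_large by blast
  obtain \<alpha> y where \<alpha>: "even \<alpha>" "half_plane y" "\<And>i j. 1 \<le> j \<Longrightarrow> z i j = (inflate ^^ n) y (i - \<alpha>) j"
    using half_plane_levels[OF crossless_half_plane(1)[OF z], of n] by blast
  obtain \<beta> y' where \<beta>: "even \<beta>" "half_plane y'" "\<And>i j. 1 \<le> j \<Longrightarrow> reflected z i j = (inflate ^^ n) y' (i - \<beta>) j"
    using half_plane_levels[OF crossless_half_plane(2)[OF z], of n] by blast
  have R: "0 \<le> R" "r < R" using r by (auto simp: R_def)
  obtain k where k: "\<And>i. \<bar>i - k\<bar> \<le> R \<Longrightarrow> \<not> 2 ^ n dvd i - \<alpha> \<and> \<not> 2 ^ n dvd i - \<beta>"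
    using lattice_gap[OF n R(1)] by meson
  define s where "s = fst (rgt (z k 0))"
  define K0 where "K0 = \<bar>k\<bar> + \<bar>\<alpha>\<bar> + \<bar>\<beta>\<bar> + R + 1"
  \<comment> \<open>The arrows of a glued row point towards the seed. The seeds are therefore moved
    far to the right if the row points right at \<open>k\<close>, and far to the left otherwise, by
    a multiple of the period \<open>2 ^ Suc n\<close>.\<close>
  define K where "K = (if s then K0 else - K0)"
  define \<alpha>' where "\<alpha>' = \<alpha> + 2 ^ Suc n * K"
  define \<beta>' where "\<beta>' = \<beta> + 2 ^ Suc n * K"
  have ev: "even \<alpha>'" "even \<beta>'" using \<alpha>(1) \<beta>(1) by (auto simp: \<alpha>'_def \<beta>'_def)
  have yv: "valid_on {1..} y" "valid_on {1..} y'" using \<alpha>(2) \<beta>(2) by (auto simp: half_plane_def)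
  have oms: "valid_on {1..} (seeded t)" for t by (rule valid_on_mono[OF valid_seeded]) simp
  have far: "if s then i < \<alpha>' \<and> i < \<beta>' else \<alpha>' < i \<and> \<beta>' < i" if "\<bar>i - k\<bar> \<le> R" for i
  proof -
    have "(1::int) \<le> 2 ^ Suc n" by (rule one_le_power) simp
    moreover have "0 \<le> K0" using R by (simp add: K0_def)
    ultimately have "K0 \<le> 2 ^ Suc n * K0" using mult_right_mono[of 1 "2 ^ Suc n" K0] by simp
    moreover have "\<alpha>' = (if s then \<alpha> + 2 ^ Suc n * K0 else \<alpha> - 2 ^ Suc n * K0)"
      "\<beta>' = (if s then \<beta> + 2 ^ Suc n * K0 else \<beta> - 2 ^ Suc n * K0)"
      by (simp_all add: \<alpha>'_def \<beta>'_def K_def)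
    moreover have "\<bar>k\<bar> + \<bar>\<alpha>\<bar> + \<bar>\<beta>\<bar> + R < K0" by (simp add: K0_def)
    ultimately show ?thesis using that by (cases s; simp only: if_True if_False; linarith)
  qed
  have up: "z i j = glued d q \<alpha>' \<beta>' i j" if ij: "\<bar>i - k\<bar> \<le> R" "1 \<le> j" "j \<le> R" for i j d q
  proof -
    have "(inflate ^^ n) y (i - \<alpha>) j = (inflate ^^ n) (seeded (ray_seed d q)) (i - \<alpha> - 2 ^ Suc n * K) j"
      by (rule interior[OF yv(1) oms]) (use k[OF ij(1)] ij n R in auto)
    then show ?thesis using \<alpha>(3)[OF ij(2), of i] ij(2)
      by (simp add: glued_def inflate_pow_seeded \<alpha>'_def algebra_simps)
  qed
  have dn: "z i (- j) = glued d q \<alpha>' \<beta>' i (- j)" if ij: "\<bar>i - k\<bar> \<le> R" "1 \<le> j" "j \<le> R" for i j d q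
  proof -
    have "(inflate ^^ n) y' (i - \<beta>) j = (inflate ^^ n) (seeded (flip_atile (ray_seed d q))) (i - \<beta> - 2 ^ Suc n * K) j"
      by (rule interior[OF yv(2) oms]) (use k[OF ij(1)] ij n R in auto)
    also have "\<dots> = seeded (flip_atile (ray_seed d q)) (i - \<beta>') j" by (simp add: inflate_pow_seeded \<beta>'_def algebra_simps)
    also have "\<dots> = flip_atile (seeded (ray_seed d q) (i - \<beta>') (- j))" using reflected_seeded[of "ray_seed d q"] by (metis reflected_apply)
    finally have "flip_atile (z i (- j)) = flip_atile (seeded (ray_seed d q) (i - \<beta>') (- j))"
      using \<beta>(3)[OF ij(2), of i] by (simp add: reflected_apply)
    then have "z i (- j) = seeded (ray_seed d q) (i - \<beta>') (- j)" by (metis flip_atile_edges(6))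
    then show ?thesis using ij(2) by (simp add: glued_def)
  qed
  \<comment> \<open>The rows 1 and -1 agree with those of a glued configuration that has plain
    horizontal arms here, and their edges force the same kind of tile in \<open>z\<close>.\<close>
  have hz: "\<exists>s r. z i 0 = Horiz s r False" if i: "\<bar>i - k\<bar> \<le> R" for i
  proof -
    note w = valid_glued[OF ev, of True False]
    have "upp (z i 0) = upp (glued True False \<alpha>' \<beta>' i 0)"
      using valid_on_v[OF z(1), of 0 i] valid_on_v[OF w, of 0 i] up[OF i, of 1] r by (auto simp: R_def)
    moreover have "dwn (z i 0) = dwn (glued True False \<alpha>' \<beta>' i 0)"
      using valid_on_v[OF z(1), of "- 1" i] valid_on_v[OF w, of "- 1" i] dn[OF i, of 1] r by (auto simp: R_def)
    ultimately have "upp (z i 0) = (False, NoRed)" "dwn (z i 0) = (True, NoRed)"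
      using far[OF i] by (auto simp: glued_row split: if_splits)
    then show ?thesis by (cases "z i 0") (auto split: if_splits)
  qed
  obtain \<rho> where \<rho>: "z k 0 = Horiz s \<rho> False" using hz[of k] R by (auto simp: s_def)
  have row: "z i 0 = Horiz s \<rho> False" if "\<bar>i - k\<bar> \<le> R" for i
    using that
  proof (induction i rule: int_induct[where k = k])
    case (step1 i)
    then have "z i 0 = Horiz s \<rho> False" "\<bar>i + 1 - k\<bar> \<le> R" by auto
    then show ?case using hz[of "i + 1"] valid_on_h[OF z(1), of 0 i] by auto
  next
    case (step2 i)
    then have "z i 0 = Horiz s \<rho> False" "\<bar>i - 1 - k\<bar> \<le> R" by auto
    then show ?case using hz[of "i - 1"] valid_on_h[OF z(1), of 0 "i - 1"] by auto
  qed (rule \<rho>)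
  \<comment> \<open>A seed with \<open>q\<close> sends the red mark
    \<open>red_side (\<not> d)\<close> along the row, so \<open>d\<close> and \<open>q\<close> are
    read off \<open>\<rho>\<close>.\<close>
  define d q where "d = (\<rho> = Hi)" and "q = (\<rho> \<noteq> NoRed)"
  have \<rho>': "(if q then red_side (\<not> d) else NoRed) = \<rho>" by (cases \<rho>) (auto simp: d_def q_def red_side_def)
  have Wk: "glued d q \<alpha>' \<beta>' i 0 = z i 0" if "\<bar>i - k\<bar> \<le> R" for i
    using far[OF that] row[OF that] \<rho>' by (auto simp: glued_row Let_def split: if_splits)
  have "F z k 0 = F (glued d q \<alpha>' \<beta>') k 0"
  proof (rule F_loc[OF valid_abs_X[OF z(1)] valid_abs_X[OF valid_glued[OF ev]]])
    fix i j assume ij: "\<bar>i - k\<bar> \<le> r" "\<bar>j - 0\<bar> \<le> r"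
    then have i: "\<bar>i - k\<bar> \<le> R" using R by simp
    consider "j = 0" | "1 \<le> j" | "1 \<le> - j" by linarith
    then show "z i j = glued d q \<alpha>' \<beta>' i j"
    proof cases
      case 1 then show ?thesis using Wk[OF i] by simp
    next
      case 2 then show ?thesis using up[OF i] ij R by simp
    next
      case 3 then show ?thesis using dn[OF i 3] ij R by simp
    qed
  qed
  also have "\<dots> = z k 0" using F_glued[OF ev] Wk[of k] R by simp
  finally have "F z k 0 = z k 0" .
  then show ?thesis using row_determined[OF z f(1) f(2)] by blast
qed

end

text \<open>A crossless row of a deflation is one of the configuration itself, at a scaled height.
  If neither a row nor a column of the deflation is crossless, its phases are constant and one more
  deflation is possible.\<close>

lemma valid_levels_or_crossless:
  assumes z: "valid_on UNIV z"
  shows "(\<exists>p q. at_level n p q z) \<or> (\<exists>R w p q. valid_on UNIV w \<and> z = sh p q w \<and> (crossless w R \<or> crossless (transposed w) R))"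
proof (induction n)
  case 0
  have "at_level 0 0 0 z" using z by (simp add: at_level_def)
  then show ?case by blast
next
  case (Suc n)
  show ?case
  proof (cases "\<exists>p q. at_level n p q z")
    case False then show ?thesis using Suc by blast
  next
    case True
    then obtain p q y where y: "valid_on UNIV y" "z = sh p q ((inflate ^^ n) y)" by (auto simp: at_level_def)
    have inflate_row: "crossless (inflate w) (2 * R)" if "crossless w R" for w R
      unfolding crossless_def
    proof
      fix i show "\<not> is_cross (inflate w i (2 * R))"
        by (cases rule: int_parity_cases[of i]) (use that in \<open>auto simp: crossless_def\<close>)
    qed
    have inflate_pow_row: "crossless ((inflate ^^ n) w) (2 ^ n * R)" if "crossless w R" for w R
    proof (induction n)
      case (Suc n) then show ?case using inflate_row[OF Suc] by (simp add: mult.assoc)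
    qed (use that in simp)
    have inflate_pow_transposed: "transposed ((inflate ^^ n) y) = (inflate ^^ n) (transposed y)" by (induction n) (auto simp: transposed_inflate)
    show ?thesis
    proof (cases "(\<exists>R. crossless y R) \<or> (\<exists>R. crossless (transposed y) R)")
      case True
      then have "(\<exists>R. crossless ((inflate ^^ n) y) R) \<or> (\<exists>R. crossless (transposed ((inflate ^^ n) y)) R)"
        unfolding inflate_pow_transposed using inflate_pow_row by blast
      then show ?thesis using valid_inflate_pow[OF y(1)] y(2) by blast
    next
      case False
      have nf: "row_phase w (l + 1) = row_phase w l" if "valid_on UNIV w" "\<And>R. \<not> crossless w R" for w l
        using fault_row(1)[OF that(1), of l] that(2) by auto
      obtain y' where y': "valid_on UNIV y'" "y = sh (phase_offset y) (phase_offset (transposed y)) (inflate y')"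
        using valid_desub[OF y(1) nf[OF y(1)] nf[OF valid_transposed[OF y(1)]]] False by blast
      have "(inflate ^^ n) y = sh (2 ^ n * phase_offset y) (2 ^ n * phase_offset (transposed y)) ((inflate ^^ Suc n) y')"
        unfolding funpow_Suc_in by (subst y'(2)) (simp add: inflate_pow_sh even_phase_offset)
      then have "z = sh (p + 2 ^ n * phase_offset y) (q + 2 ^ n * phase_offset (transposed y)) ((inflate ^^ Suc n) y')"
        by (simp only: y(2) sh_sh)
      then show ?thesis using y'(1) unfolding at_level_def by blast
    qed
  qed
qed

context automorphism begin

lemma F_crossless_row:
  assumes z: "valid_on UNIV z" "crossless z R"
  shows "F z = z"
proof -
  define w where "w = sh 0 (- R) z"
  have "valid_on UNIV w" unfolding w_def using valid_sh[OF z(1)] valid_crossless_even[OF z] by simp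
  moreover have "crossless w 0" using z(2) by (simp add: crossless_def w_def sh_def)
  ultimately have "F w = w" by (rule F_crossless)
  moreover have "z = sh 0 R w" by (simp add: w_def)
  moreover have "w \<in> abs_X" unfolding w_def using valid_abs_X[OF z(1)] by simp
  ultimately show ?thesis by (metis F_sh)
qed

lemma F_id:
  assumes "z \<in> abs_X" shows "F z = z"
proof -
  obtain p q y where y: "valid_on UNIV y" "z = sh p q y" using assms by (auto simp: abs_X_iff)
  have "F y = y"
  proof (cases "\<forall>n. \<exists>p q. at_level n p q y")
    case True then show ?thesis by (intro F_levels) blast
  next
    case False
    then obtain R w p q where w: "valid_on UNIV w" "y = sh p q w" "crossless w R \<or> crossless (transposed w) R"
      using valid_levels_or_crossless[OF y(1)] by blast
    have "F w = w"
    proof (cases "crossless w R")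
      case True then show ?thesis using F_crossless_row[OF w(1)] by blast
    next
      case False
      then have "transposed (F (transposed (transposed w))) = transposed w"
        using automorphism.F_crossless_row[OF automorphism_transposed valid_transposed[OF w(1)]] w(3) by blast
      then show ?thesis by simp (metis transposed_transposed)
    qed
    then show ?thesis using F_sh[OF valid_abs_X[OF w(1)]] w(2) by simp
  qed
  then show ?thesis using F_sh[OF valid_abs_X[OF y(1)]] y(2) by simp
qed

end

section \<open>Configurations with many periodic boxes\<close>

definition periodic_box :: "atiling \<Rightarrow> int \<Rightarrow> nat \<Rightarrow> int \<Rightarrow> int \<Rightarrow> bool" where
  "periodic_box z B n x y \<longleftrightarrow> (\<forall>i j u v. \<bar>i - x\<bar> \<le> B \<longrightarrow> \<bar>j - y\<bar> \<le> B \<longrightarrow>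
     z (i + 2 ^ n * u) (j + 2 ^ n * v) = z i j)"

text \<open>One box of each size is asked for, and the period may grow with the size: a weak planar
  form of the Toeplitz property of sequences.\<close>

definition toeplitz :: "atiling \<Rightarrow> bool" where
  "toeplitz z \<longleftrightarrow> (\<forall>B. \<exists>n x y. periodic_box z B n x y)"

lemma periodic_boxI:
  assumes "\<And>i j u v. \<bar>i - x\<bar> \<le> B \<Longrightarrow> \<bar>j - y\<bar> \<le> B \<Longrightarrow> z (i + 2 ^ n * u) (j + 2 ^ n * v) = z i j"
  shows "periodic_box z B n x y"
  using assms unfolding periodic_box_def by blast

lemma periodic_boxD:
  "periodic_box z B n x y \<Longrightarrow> \<bar>i - x\<bar> \<le> B \<Longrightarrow> \<bar>j - y\<bar> \<le> B \<Longrightarrow> z (i + 2 ^ n * u) (j + 2 ^ n * v) = z i j"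
  unfolding periodic_box_def by blast

lemma toeplitz_seeded: "toeplitz (seeded t)"
  unfolding toeplitz_def
proof
  fix B :: int
  obtain m where m: "B < 2 ^ m" using pow2_large by blast
  \<comment> \<open>The box about \<open>(2 ^ m, 2 ^ m)\<close> lies in the open first quadrant,
    inside a block of radius \<open>2 ^ Suc m\<close>, where the central tile of the block has no
    influence.\<close>
  have "periodic_box (seeded t) B (Suc (Suc m)) (2 ^ m) (2 ^ m)"
  proof (rule periodic_boxI)
    fix i j u v :: int assume "\<bar>i - 2 ^ m\<bar> \<le> B" "\<bar>j - 2 ^ m\<bar> \<le> B"
    then have ij: "0 < i" "i < 2 ^ Suc m" "0 < j" "j < 2 ^ Suc m" using m by auto
    have "seeded t (2 ^ Suc m * (2 * u) + i) (2 ^ Suc m * (2 * v) + j) = seeded (seeded t (2 * u) (2 * v)) i j"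
      by (rule seeded_recur) (use ij in auto)
    also have "\<dots> = seeded t i j" by (rule seeded_off_axis) (use ij in auto)
    finally show "seeded t (i + 2 ^ Suc (Suc m) * u) (j + 2 ^ Suc (Suc m) * v) = seeded t i j"
      by (simp add: algebra_simps)
  qed
  then show "\<exists>n x y. periodic_box (seeded t) B n x y" by blast
qed

lemma toeplitz_half_shift:
  assumes "toeplitz z" "z = sh p q (inflate y)" shows "toeplitz y"
  unfolding toeplitz_def
proof
  fix B :: int
  obtain n x x' where *: "periodic_box z (2 * B + 2) n x x'" using assms(1) unfolding toeplitz_def by blast
  have y: "y i j = z (2 * i + p) (2 * j + q)" for i j by (simp add: assms(2) sh_def)
  have "periodic_box y B n ((x - p) div 2) ((x' - q) div 2)"
  proof (rule periodic_boxI)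
    fix i j u v assume "\<bar>i - (x - p) div 2\<bar> \<le> B" "\<bar>j - (x' - q) div 2\<bar> \<le> B"
    then have "\<bar>2 * i + p - x\<bar> \<le> 2 * B + 2" "\<bar>2 * j + q - x'\<bar> \<le> 2 * B + 2" by linarith+
    from periodic_boxD[OF * this, of "2 * u" "2 * v"]
    show "y (i + 2 ^ n * u) (j + 2 ^ n * v) = y i j" by (simp add: y algebra_simps)
  qed
  then show "\<exists>n x x'. periodic_box y B n x x'" by blast
qed

lemma toeplitz_sh:
  assumes "toeplitz z" shows "toeplitz (sh p q z)"
  unfolding toeplitz_def
proof
  fix B
  obtain n x y where *: "periodic_box z B n x y" using assms unfolding toeplitz_def by blast
  have "periodic_box (sh p q z) B n (x + p) (y + q)"
  proof (rule periodic_boxI)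
    fix i j u v assume "\<bar>i - (x + p)\<bar> \<le> B" "\<bar>j - (y + q)\<bar> \<le> B"
    then show "sh p q z (i + 2 ^ n * u) (j + 2 ^ n * v) = sh p q z i j"
      using periodic_boxD[OF *, of "i - p" "j - q" u v] by (simp add: sh_def algebra_simps)
  qed
  then show "\<exists>n x y. periodic_box (sh p q z) B n x y" by blast
qed

lemma toeplitz_transposed:
  assumes "toeplitz z" shows "toeplitz (transposed z)"
  unfolding toeplitz_def
proof
  fix B
  obtain n x y where *: "periodic_box z B n x y" using assms unfolding toeplitz_def by blast
  have "periodic_box (transposed z) B n y x"
    by (rule periodic_boxI) (simp add: transposed_def periodic_boxD[OF *])
  then show "\<exists>n x y. periodic_box (transposed z) B n x y" by blast
qed

text \<open>Above and below a fault the crosses have different horizontal phases, but the vertical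
  translates of a cross in a periodic box lie on both sides and are equal.\<close>

lemma toeplitz_no_fault:
  assumes z: "valid_on UNIV z" "toeplitz z"
  shows "row_phase z (l + 1) = row_phase z l"
proof (rule ccontr)
  assume ne: "row_phase z (l + 1) \<noteq> row_phase z l"
  define w where "w = sh 0 (- (2 * l + 2)) z"
  have w: "valid_on UNIV w" unfolding w_def by (rule valid_sh[OF z(1)]) auto
  have "crossless z (2 * l + 2)" by (rule fault_row(1)[OF z(1)]) (use ne in auto)
  then have c: "crossless w 0" by (simp add: crossless_def w_def sh_def add.commute)
  have cw: "row_phase w 0 = row_phase z (l + 1)" "row_phase w (- 1) = row_phase z l"
    by (simp_all add: row_phase_def w_def sh_def algebra_simps)
  have TPw: "toeplitz w" unfolding w_def by (rule toeplitz_sh[OF z(2)])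
  obtain n x y where per: "periodic_box w 1 n x y" using TPw unfolding toeplitz_def by blast
  define i where "i = x div 2"
  define j where "j = y div 2"
  have ij: "\<bar>2 * i + 1 - x\<bar> \<le> 1" "\<bar>2 * j + 1 - y\<bar> \<le> 1" by (auto simp: i_def j_def)
  define K :: int where "K = 2 ^ n * (\<bar>j\<bar> + 1)"
  have "1 * (\<bar>j\<bar> + 1) \<le> 2 ^ n * (\<bar>j\<bar> + 1)" by (intro mult_right_mono) auto
  then have K: "\<bar>j\<bar> + 1 \<le> K" by (simp add: K_def)
  have e: "2 * (j + K) + 1 = 2 * j + 1 + 2 ^ n * (2 * (\<bar>j\<bar> + 1))" "2 * (j - K) + 1 = 2 * j + 1 + 2 ^ n * (2 * (- \<bar>j\<bar> - 1))"
    by (simp_all add: K_def algebra_simps)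
  have "w (2 * i + 1) (2 * (j + K) + 1) = w (2 * i + 1) (2 * (j - K) + 1)"
    unfolding e using periodic_boxD[OF per ij, of 0 "2 * (\<bar>j\<bar> + 1)"] periodic_boxD[OF per ij, of 0 "2 * (- \<bar>j\<bar> - 1)"] by simp
  moreover have "0 \<le> j + K" "\<not> 0 \<le> j - K" using K by linarith+
  ultimately show False
    using crossless_cross[OF w c, of i "j + K"] crossless_cross[OF w c, of i "j - K"] ne cw by auto
qed

lemma toeplitz_levels:
  assumes "toeplitz z" "z \<in> abs_X"
  shows "\<exists>p q. at_level n p q z"
  using assms
proof (induction n arbitrary: z)
  case 0 then show ?case by (simp add: abs_X_def)
next
  case (Suc n)
  obtain p q w where w: "valid_on UNIV w" "z = sh p q w" using Suc.prems by (auto simp: abs_X_iff)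
  have TPw: "toeplitz w" using toeplitz_sh[OF Suc.prems(1), of "- p" "- q"] w(2) by simp
  obtain y where y: "valid_on UNIV y" "w = sh (phase_offset w) (phase_offset (transposed w)) (inflate y)"
    using valid_desub[OF w(1) toeplitz_no_fault[OF w(1) TPw] toeplitz_no_fault[OF valid_transposed[OF w(1)] toeplitz_transposed[OF TPw]]] by blast
  obtain p' q' where pq: "at_level n p' q' y" using Suc.IH[OF toeplitz_half_shift[OF TPw y(2)] valid_abs_X[OF y(1)]] by blast
  then obtain y' where y': "valid_on UNIV y'" "y = sh p' q' ((inflate ^^ n) y')" by (auto simp: at_level_def)
  have "even p'" "even q'" using parity_unique[OF y(1) valid_inflate_pow[OF y'(1)], of 0 0 p' q' n] y'(2) by auto
  then have "inflate y = sh (2 * p') (2 * q') ((inflate ^^ Suc n) y')" using y'(2) by (simp add: inflate_sh)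
  then have "z = sh (p + phase_offset w + 2 * p') (q + phase_offset (transposed w) + 2 * q') ((inflate ^^ Suc n) y')"
    unfolding w(2) by (subst y(2)) (simp add: add.assoc)
  then show ?case using y'(1) unfolding at_level_def by blast
qed

section \<open>Difference sets\<close>

definition all_levels :: "atiling \<Rightarrow> bool" where "all_levels z \<longleftrightarrow> (\<forall>n. \<exists>p q. at_level n p q z)"

definition diffs :: "atiling \<Rightarrow> atiling \<Rightarrow> (int \<times> int) set" where "diffs z w = {(i, j). z i j \<noteq> w i j}"

lemma all_levels_desub:
  assumes "all_levels (sh p q (inflate y))" "valid_on UNIV y" shows "all_levels y"
  unfolding all_levels_def
proof
  fix n
  obtain p' q' where L: "at_level (Suc n) p' q' (sh p q (inflate y))" using assms(1) unfolding all_levels_def by blast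
  then obtain y' where y': "valid_on UNIV y'" "sh p q (inflate y) = sh p' q' (inflate ((inflate ^^ n) y'))" by (auto simp: at_level_def)
  have "at_level 1 p q (sh p q (inflate y))" unfolding at_level_def by (rule exI[of _ y]) (simp add: assms(2))
  moreover have "at_level 1 p' q' (sh p q (inflate y))"
    unfolding at_level_def by (rule exI[of _ "(inflate ^^ n) y'"]) (simp add: y' valid_inflate_pow)
  ultimately have "2 ^ Suc 1 dvd p - p' \<and> 2 ^ Suc 1 dvd q - q'" by (rule at_level_unique) simp
  then obtain u v where uv: "p = p' + 2 * (2 * u)" "q = q' + 2 * (2 * v)" by (auto simp: dvd_def algebra_simps)
  have "inflate y = sh (- p) (- q) (sh p q (inflate y))" by simp
  also have "\<dots> = sh (2 * - (2 * u)) (2 * - (2 * v)) (inflate ((inflate ^^ n) y'))" unfolding y'(2) by (simp add: uv)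
  also have "\<dots> = inflate (sh (- (2 * u)) (- (2 * v)) ((inflate ^^ n) y'))" by (subst inflate_sh) auto
  finally have "y = sh (- (2 * u)) (- (2 * v)) ((inflate ^^ n) y')" by (rule inj_inflate)
  then show "\<exists>p q. at_level n p q y" using y'(1) unfolding at_level_def by blast
qed

text \<open>Points that agree on large boxes have the same phase modulo 4, so one shift serves for
  deflating both.\<close>

lemma pair_desub_at:
  assumes "all_levels z" "all_levels w" "agree_widely z w" "z = sh p q (inflate y)" "valid_on UNIV y"
  shows "\<exists>y'. w = sh p q (inflate y') \<and> valid_on UNIV y' \<and> all_levels y \<and> all_levels y' \<and> agree_widely y y'"
proof -
  obtain p' q' where L: "at_level 1 p' q' w" using assms(2) unfolding all_levels_def by blast
  have "at_level 1 p q z" unfolding at_level_def using assms(4,5) by auto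
  then have "2 ^ Suc 1 dvd p' - p \<and> 2 ^ Suc 1 dvd q' - q"
    using at_level_unique[OF _ L assms(3)] by (simp add: dvd_diff_commute)
  then have "at_level 1 p q w" using at_level_period[OF L] by blast
  then obtain y' where y': "valid_on UNIV y'" "w = sh p q (inflate y')" by (auto simp: at_level_def)
  have "agree_widely (inflate y) (inflate y')" using assms(3,4) y'(2) agree_widely_sh by blast
  then have "agree_widely y y'" using agree_widely_half by fastforce
  then show ?thesis using y' assms all_levels_desub by metis
qed

lemma pair_desub:
  assumes "all_levels z" "all_levels w" "agree_widely z w"
  obtains p q y y' where "z = sh p q (inflate y)" "w = sh p q (inflate y')" "valid_on UNIV y" "valid_on UNIV y'" "all_levels y" "all_levels y'" "agree_widely y y'"
proof -
  obtain p q where "at_level 1 p q z" using assms(1) unfolding all_levels_def by blast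
  then obtain y where "valid_on UNIV y" "z = sh p q (inflate y)" by (auto simp: at_level_def)
  then show ?thesis using pair_desub_at[OF assms] that by metis
qed

text \<open>An inserted arm copies the common edge of two neighbouring tiles; where the arms of two
  inflations differ, both of these neighbours differ.\<close>

lemma diffs_inflate:
  assumes "valid_on UNIV y" "valid_on UNIV y'"
  shows "(i, j) \<in> diffs (sh p q (inflate y)) (sh p q (inflate y')) \<Longrightarrow>
      (\<exists>k l. i = p + 2 * k \<and> j = q + 2 * l \<and> (k, l) \<in> diffs y y')
    \<or> (\<exists>k l. i = p + 2 * k + 1 \<and> j = q + 2 * l \<and> (k, l) \<in> diffs y y' \<and> (k + 1, l) \<in> diffs y y')
    \<or> (\<exists>k l. i = p + 2 * k \<and> j = q + 2 * l + 1 \<and> (k, l) \<in> diffs y y' \<and> (k, l + 1) \<in> diffs y y')"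
    and "(k, l) \<in> diffs y y' \<Longrightarrow> (p + 2 * k, q + 2 * l) \<in> diffs (sh p q (inflate y)) (sh p q (inflate y'))"
proof -
  assume "(i, j) \<in> diffs (sh p q (inflate y)) (sh p q (inflate y'))"
  then have ne: "inflate y (i - p) (j - q) \<noteq> inflate y' (i - p) (j - q)" by (simp add: diffs_def sh_def)
  have h: "rgt (y k l) \<noteq> rgt (y' k l) \<Longrightarrow> (k, l) \<in> diffs y y' \<and> (k + 1, l) \<in> diffs y y'" for k l
    using valid_on_h[OF assms(1), of l k] valid_on_h[OF assms(2), of l k] by (auto simp: diffs_def)
  have v: "upp (y k l) \<noteq> upp (y' k l) \<Longrightarrow> (k, l) \<in> diffs y y' \<and> (k, l + 1) \<in> diffs y y'" for k l
    using valid_on_v[OF assms(1), of l k] valid_on_v[OF assms(2), of l k] by (auto simp: diffs_def)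
  show "(\<exists>k l. i = p + 2 * k \<and> j = q + 2 * l \<and> (k, l) \<in> diffs y y')
    \<or> (\<exists>k l. i = p + 2 * k + 1 \<and> j = q + 2 * l \<and> (k, l) \<in> diffs y y' \<and> (k + 1, l) \<in> diffs y y')
    \<or> (\<exists>k l. i = p + 2 * k \<and> j = q + 2 * l + 1 \<and> (k, l) \<in> diffs y y' \<and> (k, l + 1) \<in> diffs y y')"
  proof (cases rule: parity4_cases[of "i - p" "j - q"])
    case (1 k l)
    then have "i = p + 2 * k" "j = q + 2 * l" by auto
    moreover have "(k, l) \<in> diffs y y'" using ne unfolding 1 by (simp add: diffs_def)
    ultimately show ?thesis by blast
  next
    case (2 k l)
    then have "i = p + 2 * k + 1" "j = q + 2 * l" by auto
    moreover have "(k, l) \<in> diffs y y' \<and> (k + 1, l) \<in> diffs y y'" by (rule h) (use ne in \<open>simp add: 2\<close>)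
    ultimately show ?thesis by blast
  next
    case (3 k l)
    then have "i = p + 2 * k" "j = q + 2 * l + 1" by auto
    moreover have "(k, l) \<in> diffs y y' \<and> (k, l + 1) \<in> diffs y y'" by (rule v) (use ne in \<open>simp add: 3\<close>)
    ultimately show ?thesis by blast
  next
    case (4 k l) then show ?thesis using ne by simp
  qed
next
  show "(k, l) \<in> diffs y y' \<Longrightarrow> (p + 2 * k, q + 2 * l) \<in> diffs (sh p q (inflate y)) (sh p q (inflate y'))"
    by (simp add: diffs_def sh_def)
qed

text \<open>The values of a linear functional on the difference set spread by a factor two under substitution,
  so that a bounded spread vanishes.\<close>

lemma diffs_spread:
  fixes a b i j i' j' :: int and n :: nat
  assumes "all_levels z" "all_levels w" "agree_widely z w"
    and "\<And>i j i' j'. (i, j) \<in> diffs z w \<Longrightarrow> (i', j') \<in> diffs z w \<Longrightarrow> \<bar>(a * i + b * j) - (a * i' + b * j')\<bar> < 2 ^ n"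
    and "(i, j) \<in> diffs z w" "(i', j') \<in> diffs z w"
  shows "a * i + b * j = a * i' + b * (j' :: int)"
  using assms
proof (induction n arbitrary: z w i j i' j')
  case 0
  from 0(4)[OF 0(5,6)] show ?case unfolding power_0 by linarith
next
  case (Suc n)
  obtain p q y y' where y: "z = sh p q (inflate y)" "w = sh p q (inflate y')" "valid_on UNIV y" "valid_on UNIV y'" "all_levels y" "all_levels y'" "agree_widely y y'"
    using pair_desub[OF Suc.prems(1-3)] by blast
  note DS = diffs_inflate[OF y(3,4), of _ _ p q, folded y(1,2)]
  have "\<bar>(a * k + b * l) - (a * k' + b * l')\<bar> < 2 ^ n" if "(k, l) \<in> diffs y y'" "(k', l') \<in> diffs y y'" for k l k' l'
  proof -
    have "a * (p + 2 * k) + b * (q + 2 * l) - (a * (p + 2 * k') + b * (q + 2 * l'))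
        = 2 * (a * k + b * l - (a * k' + b * l'))" by (simp add: algebra_simps)
    with Suc.prems(4)[OF DS(2)[OF that(1)] DS(2)[OF that(2)]]
    have "\<bar>2 * (a * k + b * l - (a * k' + b * l'))\<bar> < 2 * 2 ^ n" by (simp only: power_Suc)
    then show ?thesis unfolding abs_mult by simp
  qed
  then have c: "a * k + b * l = a * k' + b * l'" if "(k, l) \<in> diffs y y'" "(k', l') \<in> diffs y y'" for k l k' l'
    using Suc.IH[OF y(5-7) _ that] by blast
  obtain k0 l0 where kl0: "(k0, l0) \<in> diffs y y'" using DS(1)[OF Suc.prems(5)] by blast
  define C where "C = a * k0 + b * l0"
  have C: "a * k + b * l = C" if "(k, l) \<in> diffs y y'" for k l using c[OF that kl0] by (simp add: C_def)
  \<comment> \<open>An arm contributes the mean of the values at the two differences beside it, and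
    both of these are \<open>C\<close>.\<close>
  have v: "a * i + b * j = a * p + b * q + 2 * C" if ij: "(i, j) \<in> diffs z w" for i j
    using DS(1)[OF ij]
  proof (elim disjE exE conjE)
    fix k l assume "i = p + 2 * k" "j = q + 2 * l" "(k, l) \<in> diffs y y'"
    then have e: "i = p + 2 * k" "j = q + 2 * l" and c: "a * k + b * l = C" using C by auto
    show ?thesis unfolding c[symmetric] e by (simp add: algebra_simps)
  next
    fix k l assume "i = p + 2 * k + 1" "j = q + 2 * l" "(k, l) \<in> diffs y y'" "(k + 1, l) \<in> diffs y y'"
    then have e: "i = p + 2 * k + 1" "j = q + 2 * l" and c: "C = a * k + b * l" "C = a * (k + 1) + b * l"
      using C by auto
    have "2 * C = (a * k + b * l) + (a * (k + 1) + b * l)" using c by simp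
    then show ?thesis unfolding e by (simp add: algebra_simps)
  next
    fix k l assume "i = p + 2 * k" "j = q + 2 * l + 1" "(k, l) \<in> diffs y y'" "(k, l + 1) \<in> diffs y y'"
    then have e: "i = p + 2 * k" "j = q + 2 * l + 1" and c: "C = a * k + b * l" "C = a * k + b * (l + 1)"
      using C by auto
    have "2 * C = (a * k + b * l) + (a * k + b * (l + 1))" using c by simp
    then show ?thesis unfolding e by (simp add: algebra_simps)
  qed
  show ?case using v[OF Suc.prems(5)] v[OF Suc.prems(6)] by simp
qed

text \<open>On a line not parallel to an axis no two neighbouring positions are both differences.
  Hence no inserted arm differs, and all differences lie on one coset of the even sublattice, at
  every level.\<close>

lemma diffs_skew:
  fixes a b i j i' j' :: int and n :: nat
  assumes "all_levels z" "all_levels w" "agree_widely z w" "a \<noteq> 0" "b \<noteq> 0"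
    and "\<And>i j i' j'. (i, j) \<in> diffs z w \<Longrightarrow> (i', j') \<in> diffs z w \<Longrightarrow> a * i + b * j = a * i' + b * (j' :: int)"
    and "(i, j) \<in> diffs z w" "(i', j') \<in> diffs z w"
  shows "2 ^ n dvd i - i' \<and> 2 ^ n dvd j - j'"
  using assms
proof (induction n arbitrary: z w i j i' j')
  case 0 then show ?case by simp
next
  case (Suc n)
  obtain p q y y' where y: "z = sh p q (inflate y)" "w = sh p q (inflate y')" "valid_on UNIV y" "valid_on UNIV y'" "all_levels y" "all_levels y'" "agree_widely y y'"
    using pair_desub[OF Suc.prems(1-3)] by blast
  note DS = diffs_inflate[OF y(3,4), of _ _ p q, folded y(1,2)]
  have c: "a * k + b * l = a * k' + b * l'" if "(k, l) \<in> diffs y y'" "(k', l') \<in> diffs y y'" for k l k' l'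
    using Suc.prems(6)[OF DS(2)[OF that(1)] DS(2)[OF that(2)]] by (simp add: algebra_simps)
  have e: "\<exists>k l. i = p + 2 * k \<and> j = q + 2 * l \<and> (k, l) \<in> diffs y y'" if "(i, j) \<in> diffs z w" for i j
    using DS(1)[OF that]
  proof (elim disjE exE conjE)
    fix k l assume "i = p + 2 * k" "j = q + 2 * l" "(k, l) \<in> diffs y y'"
    then show ?thesis by blast
  next
    fix k l assume "(k, l) \<in> diffs y y'" "(k + 1, l) \<in> diffs y y'"
    then show ?thesis using c[of k l "k + 1" l] Suc.prems(4) by (simp add: algebra_simps)
  next
    fix k l assume "(k, l) \<in> diffs y y'" "(k, l + 1) \<in> diffs y y'"
    then show ?thesis using c[of k l k "l + 1"] Suc.prems(5) by (simp add: algebra_simps)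
  qed
  obtain k l where kl: "i = p + 2 * k" "j = q + 2 * l" "(k, l) \<in> diffs y y'" using e[OF Suc.prems(7)] by blast
  obtain k' l' where kl': "i' = p + 2 * k'" "j' = q + 2 * l'" "(k', l') \<in> diffs y y'" using e[OF Suc.prems(8)] by blast
  have "2 ^ n dvd k - k' \<and> 2 ^ n dvd l - l'" by (rule Suc.IH[OF y(5-7) Suc.prems(4,5) c kl(3) kl'(3)])
  moreover have "i - i' = 2 * (k - k')" "j - j' = 2 * (l - l')" using kl kl' by simp_all
  ultimately show ?case by (simp only: power_Suc mult_dvd_mono dvd_refl)
qed

lemma dvd_all_pow2: "(\<And>n. 2 ^ n dvd (x::int)) \<Longrightarrow> x = 0"
proof (rule ccontr)
  assume d: "\<And>n. 2 ^ n dvd x" and "x \<noteq> 0"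
  obtain n where "\<bar>x\<bar> < 2 ^ n" using pow2_large by blast
  then show False using dvd_imp_le_int[OF \<open>x \<noteq> 0\<close> d[of n]] by simp
qed

text \<open>Within one column no horizontal neighbours differ, so no inserted horizontal arm does;
  at each level the column has the parity of the phase.\<close>

lemma diffs_column:
  assumes "all_levels z" "all_levels w" "agree_widely z w"
    and "\<And>i j i' j'. (i, j) \<in> diffs z w \<Longrightarrow> (i', j') \<in> diffs z w \<Longrightarrow> i = i'"
    and "(i, j) \<in> diffs z w" "at_level n p q z"
  shows "2 ^ n dvd i - p"
  using assms
proof (induction n arbitrary: z w i j p q)
  case 0 then show ?case by simp
next
  case (Suc n)
  obtain y0 where y0: "valid_on UNIV y0" "z = sh p q ((inflate ^^ Suc n) y0)" using Suc.prems(6) by (auto simp: at_level_def)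
  define y where "y = (inflate ^^ n) y0"
  have y: "z = sh p q (inflate y)" "valid_on UNIV y" "at_level n 0 0 y" using y0 valid_inflate_pow by (auto simp: y_def at_level_def)
  obtain y' where y': "w = sh p q (inflate y')" "valid_on UNIV y'" "all_levels y" "all_levels y'" "agree_widely y y'"
    using pair_desub_at[OF Suc.prems(1-3) y(1,2)] by blast
  note DS = diffs_inflate[OF y(2) y'(2), of _ _ p q, folded y(1) y'(1)]
  have c: "k = k'" if "(k, l) \<in> diffs y y'" "(k', l') \<in> diffs y y'" for k l k' l'
    using Suc.prems(4)[OF DS(2)[OF that(1)] DS(2)[OF that(2)]] by simp
  have "\<exists>k l. i = p + 2 * k \<and> (k, l) \<in> diffs y y'"
    using DS(1)[OF Suc.prems(5)]
  proof (elim disjE exE conjE)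
    fix k l assume "(k, l) \<in> diffs y y'" "(k + 1, l) \<in> diffs y y'"
    then show ?thesis using c[of k l "k + 1" l] by simp
  qed blast+
  then obtain k l where kl: "i = p + 2 * k" "(k, l) \<in> diffs y y'" by blast
  have "2 ^ n dvd k - 0" by (rule Suc.IH[OF y'(3-5) c kl(2) y(3)])
  then show ?case using kl by simp
qed

section \<open>The matrix of an extended symmetry\<close>

lemma abs_lin_le:
  fixes a b X Z B :: int
  assumes "\<bar>X\<bar> \<le> B" "\<bar>Z\<bar> \<le> B"
  shows "\<bar>a * X + b * Z\<bar> \<le> (\<bar>a\<bar> + \<bar>b\<bar>) * B"
proof -
  have "\<bar>a * X + b * Z\<bar> \<le> \<bar>a\<bar> * \<bar>X\<bar> + \<bar>b\<bar> * \<bar>Z\<bar>" unfolding abs_mult[symmetric] by (rule abs_triangle_ineq)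
  also have "\<dots> \<le> \<bar>a\<bar> * B + \<bar>b\<bar> * B" using assms by (intro add_mono mult_left_mono) auto
  finally show ?thesis by (simp only: distrib_right)
qed

text \<open>Two such seeds have the same horizontal edges and differ in the red of both vertical
  edges, so their configurations differ along the whole vertical axis and nowhere else.\<close>

definition column_seed :: "red \<Rightarrow> atile" where "column_seed r = Vert False r False"

lemma diffs_column_seed: "(i, j) \<in> diffs (seeded (column_seed NoRed)) (seeded (column_seed Lo)) \<longleftrightarrow> i = 0"
proof (cases "i = 0")
  case True then show ?thesis by (cases "j = 0") (auto simp: diffs_def seeded_axis_v column_seed_def)
next
  case False then show ?thesis using seeded_off_axis[of i j "column_seed NoRed" "column_seed Lo"]
    by (cases "j = 0") (auto simp: diffs_def seeded_axis_h column_seed_def)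
qed

lemma lvI: "toeplitz z \<Longrightarrow> z \<in> abs_X \<Longrightarrow> all_levels z"
  unfolding all_levels_def using toeplitz_levels by blast

text \<open>The primed letters are the entries of the inverse matrix. \<open>F_loc'\<close> is the
  block map of the inverse of \<open>F\<close>, expressed without that inverse.\<close>

locale ext_sym =
  fixes F :: "atiling \<Rightarrow> atiling" and a b c d a' b' c' d' r :: int
  assumes r: "0 \<le> r"
    and F_abs_X: "z \<in> abs_X \<Longrightarrow> F z \<in> abs_X"
    and F_inj: "z \<in> abs_X \<Longrightarrow> w \<in> abs_X \<Longrightarrow> F z = F w \<Longrightarrow> z = w"
    and F_sh: "z \<in> abs_X \<Longrightarrow> F (sh u v z) = sh (a * u + b * v) (c * u + d * v) (F z)"
    and F_loc: "z \<in> abs_X \<Longrightarrow> w \<in> abs_X \<Longrightarrow>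
      (\<And>i j. \<bar>i - P\<bar> \<le> r \<Longrightarrow> \<bar>j - Q\<bar> \<le> r \<Longrightarrow> z i j = w i j) \<Longrightarrow>
      F z (a * P + b * Q) (c * P + d * Q) = F w (a * P + b * Q) (c * P + d * Q)"
    and F_loc': "z \<in> abs_X \<Longrightarrow> w \<in> abs_X \<Longrightarrow>
      (\<And>i j. \<bar>i - (a * P + b * Q)\<bar> \<le> r \<Longrightarrow> \<bar>j - (c * P + d * Q)\<bar> \<le> r \<Longrightarrow> F z i j = F w i j) \<Longrightarrow>
      z P Q = w P Q"
    and inv: "a * (a' * i + b' * j) + b * (c' * i + d' * j) = i" "c * (a' * i + b' * j) + d * (c' * i + d' * j) = j"
    and inv': "a' * (a * i + b * j) + b' * (c * i + d * j) = i" "c' * (a * i + b * j) + d' * (c * i + d * j) = j"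
begin

text \<open>Conjugation by the transposition exchanges the rows and the columns of both matrices, so
  facts on the first row of the inverse matrix carry over to the second.\<close>

lemma ext_sym_transposed: "ext_sym (\<lambda>z. transposed (F (transposed z))) d c b a d' c' b' a' r"
proof
  show "0 \<le> r" by (rule r)
  show "transposed (F (transposed z)) \<in> abs_X" if "z \<in> abs_X" for z using that F_abs_X by simp
  show "z = w" if "z \<in> abs_X" "w \<in> abs_X" "transposed (F (transposed z)) = transposed (F (transposed w))" for z w
    using F_inj[of "transposed z" "transposed w"] that by (metis transposed_transposed abs_X_transposed)
  show "transposed (F (transposed (sh u v z))) = sh (d * u + c * v) (b * u + a * v) (transposed (F (transposed z)))" if "z \<in> abs_X" for z u v
    using that by (simp add: F_sh add.commute)
  show "transposed (F (transposed z)) (d * P + c * Q) (b * P + a * Q) = transposed (F (transposed w)) (d * P + c * Q) (b * P + a * Q)"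
    if "z \<in> abs_X" "w \<in> abs_X" "\<And>i j. \<bar>i - P\<bar> \<le> r \<Longrightarrow> \<bar>j - Q\<bar> \<le> r \<Longrightarrow> z i j = w i j" for z w P Q
    using F_loc[of "transposed z" "transposed w" Q P] that by (simp add: transposed_apply add.commute)
  show "z P Q = w P Q" if "z \<in> abs_X" "w \<in> abs_X"
    "\<And>i j. \<bar>i - (d * P + c * Q)\<bar> \<le> r \<Longrightarrow> \<bar>j - (b * P + a * Q)\<bar> \<le> r \<Longrightarrow> transposed (F (transposed z)) i j = transposed (F (transposed w)) i j"
    for z w P Q
  proof -
    have "transposed z Q P = transposed w Q P"
    proof (rule F_loc')
      fix i j assume "\<bar>i - (a * Q + b * P)\<bar> \<le> r" "\<bar>j - (c * Q + d * P)\<bar> \<le> r"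
      then show "F (transposed z) i j = F (transposed w) i j"
        using that(3)[of j i] by (simp add: transposed_apply add.commute) (metis transpose_atile_edges(6))
    qed (use that in simp_all)
    then show ?thesis by (simp add: transposed_apply) (metis transpose_atile_edges(6))
  qed
  show "d * (d' * i + c' * j) + c * (b' * i + a' * j) = i" "b * (d' * i + c' * j) + a * (b' * i + a' * j) = j" for i j
    using inv(2)[of j i] inv(1)[of j i] by (simp_all add: add.commute)
  show "d' * (d * i + c * j) + c' * (b * i + a * j) = i" "b' * (d * i + c * j) + a' * (b * i + a * j) = j" for i j
    using inv'(2)[of j i] inv'(1)[of j i] by (simp_all add: add.commute)
qed

lemma diffs_F:
  assumes "z \<in> abs_X" "w \<in> abs_X" "(i, j) \<in> diffs (F z) (F w)"
  shows "\<exists>i' j'. \<bar>i' - (a' * i + b' * j)\<bar> \<le> r \<and> \<bar>j' - (c' * i + d' * j)\<bar> \<le> r \<and> (i', j') \<in> diffs z w"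
proof (rule ccontr)
  assume "\<not> ?thesis"
  then have *: "z i' j' = w i' j'" if "\<bar>i' - (a' * i + b' * j)\<bar> \<le> r" "\<bar>j' - (c' * i + d' * j)\<bar> \<le> r" for i' j'
    using that by (auto simp: diffs_def)
  from F_loc[OF assms(1,2), of "a' * i + b' * j" "c' * i + d' * j"] * have "F z i j = F w i j"
    unfolding inv by blast
  then show False using assms(3) by (simp add: diffs_def)
qed

definition inv_norm :: int where "inv_norm = \<bar>a'\<bar> + \<bar>b'\<bar> + \<bar>c'\<bar> + \<bar>d'\<bar>"

lemma box_preimage:
  assumes "\<bar>i - (a * x + b * y)\<bar> \<le> B" "\<bar>j - (c * x + d * y)\<bar> \<le> B"
  shows "\<bar>a' * i + b' * j - x\<bar> \<le> inv_norm * B" "\<bar>c' * i + d' * j - y\<bar> \<le> inv_norm * B"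
proof -
  have B: "0 \<le> B" using assms(1) by linarith
  have "a' * i + b' * j - x = a' * (i - (a * x + b * y)) + b' * (j - (c * x + d * y))"
    using inv'(1)[of x y] by (simp add: right_diff_distrib)
  then have "\<bar>a' * i + b' * j - x\<bar> \<le> (\<bar>a'\<bar> + \<bar>b'\<bar>) * B" using abs_lin_le[OF assms] by simp
  also have "\<dots> \<le> inv_norm * B" using B by (intro mult_right_mono) (auto simp: inv_norm_def)
  finally show "\<bar>a' * i + b' * j - x\<bar> \<le> inv_norm * B" .
  have "c' * i + d' * j - y = c' * (i - (a * x + b * y)) + d' * (j - (c * x + d * y))"
    using inv'(2)[of x y] by (simp add: right_diff_distrib)
  then have "\<bar>c' * i + d' * j - y\<bar> \<le> (\<bar>c'\<bar> + \<bar>d'\<bar>) * B" using abs_lin_le[OF assms] by simp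
  also have "\<dots> \<le> inv_norm * B" using B by (intro mult_right_mono) (auto simp: inv_norm_def)
  finally show "\<bar>c' * i + d' * j - y\<bar> \<le> inv_norm * B" .
qed

text \<open>An integer matrix with integer inverse maps the multiples of \<open>2 ^ n\<close> onto
  themselves, so the period survives. The box has to be larger by the norm of the inverse and the
  radius.\<close>

lemma toeplitz_F:
  assumes "z \<in> abs_X" "toeplitz z" shows "toeplitz (F z)"
  unfolding toeplitz_def
proof
  fix B
  obtain n x y where box: "periodic_box z (inv_norm * B + r) n x y" using assms(2) unfolding toeplitz_def by blast
  have "periodic_box (F z) B n (a * x + b * y) (c * x + d * y)"
  proof (rule periodic_boxI)
    fix i j u v assume ij: "\<bar>i - (a * x + b * y)\<bar> \<le> B" "\<bar>j - (c * x + d * y)\<bar> \<le> B"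
    note pre = box_preimage[OF ij]
    define U where "U = a' * u + b' * v"
    define W where "W = c' * u + d' * v"
    have uv: "a * U + b * W = u" "c * U + d * W = v" unfolding U_def W_def by (rule inv)+
    define w where "w = sh (- (2 ^ n * U)) (- (2 ^ n * W)) z"
    have "F w = sh (- (2 ^ n * u)) (- (2 ^ n * v)) (F z)"
    proof -
      have "a * - (2 ^ n * U) + b * - (2 ^ n * W) = - (2 ^ n * (a * U + b * W))"
        "c * - (2 ^ n * U) + d * - (2 ^ n * W) = - (2 ^ n * (c * U + d * W))" by (simp_all add: algebra_simps)
      then show ?thesis unfolding w_def F_sh[OF assms(1)] uv by simp
    qed
    moreover have "F z (a * (a' * i + b' * j) + b * (c' * i + d' * j)) (c * (a' * i + b' * j) + d * (c' * i + d' * j))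
        = F w (a * (a' * i + b' * j) + b * (c' * i + d' * j)) (c * (a' * i + b' * j) + d * (c' * i + d' * j))"
    proof (rule F_loc)
      fix i' j' assume "\<bar>i' - (a' * i + b' * j)\<bar> \<le> r" "\<bar>j' - (c' * i + d' * j)\<bar> \<le> r"
      then have "\<bar>i' - x\<bar> \<le> inv_norm * B + r" "\<bar>j' - y\<bar> \<le> inv_norm * B + r" using pre by linarith+
      then show "z i' j' = w i' j'" using periodic_boxD[OF box, of i' j' U W] by (simp add: w_def sh_def)
    qed (use assms in \<open>auto simp: w_def\<close>)
    ultimately show "F z (i + 2 ^ n * u) (j + 2 ^ n * v) = F z i j" unfolding inv by (simp add: sh_def)
  qed
  then show "\<exists>n x y. periodic_box (F z) B n x y" by blast
qed

lemma all_levels_F_seeded: "all_levels (F (seeded t))"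
  by (intro lvI toeplitz_F toeplitz_seeded F_abs_X) auto

lemma agree_widely_F_seeded: "agree_widely (F (seeded t)) (F (seeded t'))"
  unfolding agree_widely_def
proof
  fix B
  \<comment> \<open>So far out on the diagonal, the preimage of the box together with its
    \<open>r\<close>-neighbourhood avoids both axes.\<close>
  define X where "X = inv_norm * B + r + 1"
  have "F (seeded t) i j = F (seeded t') i j"
    if ij: "\<bar>i - (a * X + b * X)\<bar> \<le> B" "\<bar>j - (c * X + d * X)\<bar> \<le> B" for i j
  proof (rule ccontr)
    assume "F (seeded t) i j \<noteq> F (seeded t') i j"
    then have "(i, j) \<in> diffs (F (seeded t)) (F (seeded t'))" by (simp add: diffs_def)
    then obtain i' j' where i': "\<bar>i' - (a' * i + b' * j)\<bar> \<le> r" "\<bar>j' - (c' * i + d' * j)\<bar> \<le> r" "seeded t i' j' \<noteq> seeded t' i' j'"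
      using diffs_F[of "seeded t" "seeded t'" i j] by (auto simp: diffs_def)
    then have "i' = 0 \<or> j' = 0" using seeded_off_axis by blast
    then show False using i' box_preimage[OF ij] unfolding X_def by linarith
  qed
  then show "\<exists>x y. \<forall>i j. \<bar>i - x\<bar> \<le> B \<longrightarrow> \<bar>j - y\<bar> \<le> B \<longrightarrow> F (seeded t) i j = F (seeded t') i j" by blast
qed

text \<open>The functional is the first coordinate of the preimage, which for a difference is within
  \<open>r\<close> of the column 0; its spread is thus bounded, and \<open>diffs_spread\<close>
  applies.\<close>

lemma diffs_col_const:
  assumes "(i, j) \<in> diffs (F (seeded (column_seed NoRed))) (F (seeded (column_seed Lo)))" "(i', j') \<in> diffs (F (seeded (column_seed NoRed))) (F (seeded (column_seed Lo)))"
  shows "a' * i + b' * j = a' * i' + b' * j'"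
proof -
  obtain n where n: "2 * r < 2 ^ n" using pow2_large by blast
  have near: "\<bar>a' * i + b' * j\<bar> \<le> r" if "(i, j) \<in> diffs (F (seeded (column_seed NoRed))) (F (seeded (column_seed Lo)))" for i j
    using diffs_F[OF _ _ that] by (auto simp: diffs_column_seed)
  show ?thesis
  proof (rule diffs_spread[where a = a' and b = b' and n = n, OF all_levels_F_seeded all_levels_F_seeded agree_widely_F_seeded _ assms])
    fix i j i' j' assume "(i, j) \<in> diffs (F (seeded (column_seed NoRed))) (F (seeded (column_seed Lo)))" "(i', j') \<in> diffs (F (seeded (column_seed NoRed))) (F (seeded (column_seed Lo)))"
    from near[OF this(1)] near[OF this(2)] have "\<bar>(a' * i + b' * j) - (a' * i' + b' * j')\<bar> \<le> 2 * r" by linarith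
    then show "\<bar>(a' * i + b' * j) - (a' * i' + b' * j')\<bar> < 2 ^ n" using n by (rule le_less_trans)
  qed
qed

lemma diffs_col_ex: "\<exists>i j. \<bar>i - b * Q\<bar> \<le> r \<and> \<bar>j - d * Q\<bar> \<le> r \<and> (i, j) \<in> diffs (F (seeded (column_seed NoRed))) (F (seeded (column_seed Lo)))"
proof (rule ccontr)
  assume *: "\<not> ?thesis"
  have "seeded (column_seed NoRed) 0 Q = seeded (column_seed Lo) 0 Q"
    by (rule F_loc') (use * in \<open>auto simp: diffs_def\<close>)
  then show False using diffs_column_seed[of 0 Q] by (simp add: diffs_def)
qed

lemma first_row: "a' = 0 \<or> b' = 0"
proof (rule ccontr)
  assume "\<not> ?thesis"
  then have nz: "a' \<noteq> 0" "b' \<noteq> 0" by auto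
  have *: "i = i' \<and> j = j'" if "(i, j) \<in> diffs (F (seeded (column_seed NoRed))) (F (seeded (column_seed Lo)))" "(i', j') \<in> diffs (F (seeded (column_seed NoRed))) (F (seeded (column_seed Lo)))" for i j i' j'
  proof -
    have "2 ^ n dvd i - i' \<and> 2 ^ n dvd j - j'" for n
      by (rule diffs_skew[OF all_levels_F_seeded all_levels_F_seeded agree_widely_F_seeded nz diffs_col_const that])
    then have "i - i' = 0" "j - j' = 0" using dvd_all_pow2 by blast+
    then show ?thesis by simp
  qed
  \<comment> \<open>There are differences near the images of \<open>(0, 0)\<close> and of
    \<open>(0, Q)\<close>. If they are the same point, the image of \<open>(0, Q)\<close> has
    coordinates below \<open>Q\<close> in absolute value, which forces
    \<open>b = d = 0\<close>.\<close>
  define Q where "Q = 2 * r + 1"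
  obtain i j where 1: "\<bar>i - b * 0\<bar> \<le> r" "\<bar>j - d * 0\<bar> \<le> r" "(i, j) \<in> diffs (F (seeded (column_seed NoRed))) (F (seeded (column_seed Lo)))"
    using diffs_col_ex[of 0] by blast
  obtain i' j' where 2: "\<bar>i' - b * Q\<bar> \<le> r" "\<bar>j' - d * Q\<bar> \<le> r" "(i', j') \<in> diffs (F (seeded (column_seed NoRed))) (F (seeded (column_seed Lo)))"
    using diffs_col_ex[of Q] by blast
  have "\<bar>b * Q\<bar> < Q" "\<bar>d * Q\<bar> < Q" using 1 2 *[OF 1(3) 2(3)] unfolding Q_def by linarith+
  moreover have "0 < Q" using r by (simp add: Q_def)
  ultimately have "b = 0" "d = 0" by (auto simp: abs_mult mult_less_cancel_right2)
  then show False using inv'(2)[of 0 1] by simp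
qed

lemma second_row: "c' = 0 \<or> d' = 0"
  using ext_sym.first_row[OF ext_sym_transposed] by blast

end

section \<open>Symmetries with the identity matrix\<close>

lemma at_level_transposed: "at_level n p q z \<Longrightarrow> at_level n q p (transposed z)"
proof -
  have "transposed ((inflate ^^ n) y) = (inflate ^^ n) (transposed y)" for y by (induction n) (auto simp: transposed_inflate)
  then show "at_level n p q z \<Longrightarrow> at_level n q p (transposed z)" unfolding at_level_def using valid_transposed by force
qed

lemma ext_sym_column:
  assumes "ext_sym F 1 0 0 1 1 0 0 1 r"
  shows "\<exists>c0. \<forall>n p q. at_level n p q (F (seeded (column_seed NoRed))) \<longrightarrow> 2 ^ n dvd c0 - p"
proof -
  interpret ext_sym F 1 0 0 1 1 0 0 1 r by fact
  obtain i j where ij: "(i, j) \<in> diffs (F (seeded (column_seed NoRed))) (F (seeded (column_seed Lo)))" using diffs_col_ex by blast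
  have "2 ^ n dvd i - p" if "at_level n p q (F (seeded (column_seed NoRed)))" for n p q
    by (rule diffs_column[OF all_levels_F_seeded all_levels_F_seeded agree_widely_F_seeded _ ij that]) (use diffs_col_const in auto)
  then show ?thesis by blast
qed

lemma ext_sym_id_shift:
  assumes "ext_sym F 1 0 0 1 1 0 0 1 r"
  shows "\<exists>u v. \<forall>z\<in>abs_X. F z = sh u v z"
proof -
  interpret ext_sym F 1 0 0 1 1 0 0 1 r by fact
  obtain p0 where p0: "\<And>n p q. at_level n p q (F (seeded (column_seed NoRed))) \<Longrightarrow> 2 ^ n dvd p0 - p"
    using ext_sym_column[OF assms] by blast
  have "transposed (seeded (column_seed NoRed)) = seeded (transpose_atile (column_seed NoRed))" by (rule transposed_seeded)
  then obtain q0 where q0: "\<And>n p q. at_level n q p (transposed (F (seeded (transpose_atile (column_seed NoRed))))) \<Longrightarrow> 2 ^ n dvd q0 - q"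
    using ext_sym_column[OF ext_sym_transposed] by auto
  have lev: "at_level n p0 q0 (F (seeded t))" for n t
  proof -
    \<comment> \<open>Level \<open>Suc n\<close> is used because the differing column gives the
      phase at a level only modulo the scale of that level, whereas \<open>at_level_period\<close>
      at level \<open>n\<close> needs it modulo \<open>2 ^ Suc n\<close>.\<close>
    obtain p q where pq: "at_level (Suc n) p q (F (seeded t))" using all_levels_F_seeded unfolding all_levels_def by blast
    obtain p1 q1 where pq1: "at_level (Suc n) p1 q1 (F (seeded (column_seed NoRed)))" using all_levels_F_seeded unfolding all_levels_def by blast
    obtain p2 q2 where pq2: "at_level (Suc n) p2 q2 (F (seeded (transpose_atile (column_seed NoRed))))" using all_levels_F_seeded unfolding all_levels_def by blast
    have "2 ^ Suc (Suc n) dvd p - p1" "2 ^ Suc (Suc n) dvd q - q2"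
      using at_level_unique[OF pq pq1 agree_widely_F_seeded] at_level_unique[OF pq pq2 agree_widely_F_seeded] by auto
    then have "2 ^ Suc n dvd p - p1" "2 ^ Suc n dvd q - q2" by (meson dvd_trans le_imp_power_dvd le_SucI order_refl)+
    moreover have "2 ^ Suc n dvd p0 - p1" "2 ^ Suc n dvd q0 - q2" using p0[OF pq1] q0[OF at_level_transposed[OF pq2]] by auto
    ultimately have "2 ^ Suc n dvd (p - p1) - (p0 - p1)" "2 ^ Suc n dvd (q - q2) - (q0 - q2)" using dvd_diff by blast+
    then have "2 ^ Suc n dvd p - p0" "2 ^ Suc n dvd q - q0" by simp_all
    then show ?thesis using at_level_period[OF at_level_Suc[OF pq]] by blast
  qed
  define G where "G z = sh (- p0) (- q0) (F z)" for z
  define \<rho> where "\<rho> = r + \<bar>p0\<bar> + \<bar>q0\<bar>"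
  have G_sh: "G (sh u v z) = sh u v (G z)" if "z \<in> abs_X" for u v z
    using F_sh[OF that, of u v] by (simp add: G_def add.commute)
  have G_loc: "G z P Q = G w P Q" if "z \<in> abs_X" "w \<in> abs_X"
    "\<And>i j. \<bar>i - P\<bar> \<le> \<rho> \<Longrightarrow> \<bar>j - Q\<bar> \<le> \<rho> \<Longrightarrow> z i j = w i j" for z w P Q
  proof -
    have "F z (1 * (P + p0) + 0 * (Q + q0)) (0 * (P + p0) + 1 * (Q + q0)) = F w (1 * (P + p0) + 0 * (Q + q0)) (0 * (P + p0) + 1 * (Q + q0))"
      by (rule F_loc[OF that(1,2)], rule that(3)) (auto simp: \<rho>_def)
    then show ?thesis by (simp add: G_def sh_def)
  qed
  have psi: "G (seeded t) = seeded (G (seeded t) 0 0)" for t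
  proof (rule seeded_eq_of_levels)
    fix n show "at_level n 0 0 (G (seeded t))" using at_level_shift[OF lev[of n t], of "- p0" "- q0"] by (simp add: G_def)
  qed
  have G_seeded: "G (seeded t) = seeded t" for t
  proof -
    \<comment> \<open>The window about the origin reappears at
      \<open>(2 ^ n * (2 * i), 2 ^ n * (2 * j))\<close>. There every \<open>seeded\<close>
      configuration has the tile \<open>t\<close>, hence so has the image. The factor 2 makes the
      coordinates even, as \<open>seeded_recur\<close> demands.\<close>
    obtain i j where ij: "i \<noteq> 0" "j \<noteq> 0" "\<And>t'. seeded t' i j = t" using seeded_occurs by blast
    obtain n where n: "\<rho> < 2 ^ n" using pow2_large by blast
    define w where "w = sh (- (2 ^ n * (2 * i))) (- (2 ^ n * (2 * j))) (seeded t)"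
    have "G (seeded t) 0 0 = G w 0 0"
    proof (rule G_loc)
      fix x y assume "\<bar>x - 0\<bar> \<le> \<rho>" "\<bar>y - 0\<bar> \<le> \<rho>"
      then have "seeded t (2 ^ n * (2 * i) + x) (2 ^ n * (2 * j) + y) = seeded (seeded t (2 * i) (2 * j)) x y"
        using n by (intro seeded_recur) auto
      then show "seeded t x y = w x y" using ij(3)[of t] by (simp add: w_def sh_def add.commute)
    qed (auto simp: w_def)
    also have "\<dots> = G (seeded t) (2 ^ n * (2 * i)) (2 ^ n * (2 * j))" by (simp add: w_def G_sh sh_apply)
    also have "\<dots> = seeded (G (seeded t) 0 0) (2 ^ n * (2 * i) + 0) (2 ^ n * (2 * j) + 0)" by (subst psi) simp
    also have "\<dots> = seeded (seeded (G (seeded t) 0 0) (2 * i) (2 * j)) 0 0" by (rule seeded_recur) auto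
    also have "\<dots> = t" using ij(3) by simp
    finally show ?thesis using psi by metis
  qed
  interpret G: automorphism G \<rho>
  proof
    show "0 \<le> \<rho>" using r by (simp add: \<rho>_def)
    show "z = w" if "z \<in> abs_X" "w \<in> abs_X" "G z = G w" for z w
    proof -
      have "sh p0 q0 (G z) = sh p0 q0 (G w)" using that by simp
      then show ?thesis using F_inj that by (simp add: G_def)
    qed
    show "G z \<in> abs_X" if "z \<in> abs_X" for z using F_abs_X[OF that] by (simp add: G_def)
    show "G (seeded t) = seeded t" for t by (rule G_seeded)
    show "G (sh u v z) = sh u v (G z)" if "z \<in> abs_X" for u v z by (rule G_sh[OF that])
    show "G z P Q = G w P Q" if "z \<in> abs_X" "w \<in> abs_X"
      "\<And>i j. \<bar>i - P\<bar> \<le> \<rho> \<Longrightarrow> \<bar>j - Q\<bar> \<le> \<rho> \<Longrightarrow> z i j = w i j" for z w P Q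
      by (rule G_loc[OF that])
  qed
  have "F z = sh p0 q0 z" if "z \<in> abs_X" for z
  proof -
    have "sh p0 q0 (G z) = sh p0 q0 z" using G.F_id[OF that] by simp
    then show ?thesis by (simp add: G_def)
  qed
  then show ?thesis by blast
qed

section \<open>Encoding of tiles\<close>

definition side_marks :: "(real \<Rightarrow> real \<times> real) \<Rightarrow> arrow_end \<Rightarrow> red \<Rightarrow> marking set" where
  "side_marks g h r = insert (g (1/2), Black, h)
     (case r of NoRed \<Rightarrow> {} | Lo \<Rightarrow> {(g (1/4), Red, h)} | Hi \<Rightarrow> {(g (3/4), Red, h)})"

text \<open>An arrow shows its head on the edge through which it leaves the tile, so
  \<open>True\<close> is a head on the right and upper edges and a tail on the left and lower
  ones.\<close>

definition tile_of :: "atile \<Rightarrow> tile" where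
  "tile_of t =
     side_marks (\<lambda>x. (1, x)) (if fst (rgt t) then Head else Tail) (snd (rgt t)) \<union>
     side_marks (\<lambda>x. (0, x)) (if fst (lft t) then Tail else Head) (snd (lft t)) \<union>
     side_marks (\<lambda>x. (x, 1)) (if fst (upp t) then Head else Tail) (snd (upp t)) \<union>
     side_marks (\<lambda>x. (x, 0)) (if fst (dwn t) then Tail else Head) (snd (dwn t))"

definition mark :: "bool \<times> red \<Rightarrow> real \<Rightarrow> colour \<Rightarrow> bool" where
  "mark e x c \<longleftrightarrow> (c = Black \<and> x = 1/2) \<or> (c = Red \<and> (snd e = Lo \<and> x = 1/4 \<or> snd e = Hi \<and> x = 3/4))"

lemma tile_of_edges:
  "((1, x), c, h) \<in> tile_of t \<longleftrightarrow> mark (rgt t) x c \<and> h = (if fst (rgt t) then Head else Tail)"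
  "((0, x), c, h) \<in> tile_of t \<longleftrightarrow> mark (lft t) x c \<and> h = (if fst (lft t) then Tail else Head)"
  "((x, 1), c, h) \<in> tile_of t \<longleftrightarrow> mark (upp t) x c \<and> h = (if fst (upp t) then Head else Tail)"
  "((x, 0), c, h) \<in> tile_of t \<longleftrightarrow> mark (dwn t) x c \<and> h = (if fst (dwn t) then Tail else Head)"
  by (auto simp: tile_of_def side_marks_def mark_def split: red.splits)

lemma mark_eq_iff: "(\<forall>x c. mark e x c = mark e' x c) \<longleftrightarrow> snd e = snd e'"
proof
  assume *: "\<forall>x c. mark e x c = mark e' x c"
  from *[rule_format, of "1/4" Red] *[rule_format, of "3/4" Red] show "snd e = snd e'"
    by (cases "snd e"; cases "snd e'") (auto simp: mark_def)
qed (auto simp: mark_def)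

lemma edges_determine:
  "rgt t = rgt t' \<Longrightarrow> lft t = lft t' \<Longrightarrow> upp t = upp t' \<Longrightarrow> dwn t = dwn t' \<Longrightarrow> t = t'"
  by (cases t; cases t') (auto split: if_splits)

lemma mark_black [simp]: "mark e (1/2) Black" by (simp add: mark_def)

lemma inj_tile_of: "inj tile_of"
proof (rule injI)
  fix t t' assume eq: "tile_of t = tile_of t'"
  have *: "e = e'" if "\<And>x c h. (mark e x c \<and> h = (if fst e then a else b)) = (mark e' x c \<and> h = (if fst e' then a else b))"
    and "a \<noteq> b" for e e' and a b :: arrow_end
  proof (rule prod_eqI)
    show "fst e = fst e'" using that(1)[of "1/2" Black a] that(2) by (auto split: if_splits)
    then show "snd e = snd e'" using that(1) by (subst mark_eq_iff[symmetric]) blast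
  qed
  show "t = t'"
  proof (rule edges_determine)
    show "rgt t = rgt t'" by (rule *[where a = Head and b = Tail]) (simp_all flip: tile_of_edges add: eq)
    show "lft t = lft t'" by (rule *[where a = Tail and b = Head]) (simp_all flip: tile_of_edges add: eq)
    show "upp t = upp t'" by (rule *[where a = Head and b = Tail]) (simp_all flip: tile_of_edges add: eq)
    show "dwn t = dwn t'" by (rule *[where a = Tail and b = Head]) (simp_all flip: tile_of_edges add: eq)
  qed
qed

definition mirror_atile :: "atile \<Rightarrow> atile" where "mirror_atile t = transpose_atile (flip_atile (transpose_atile t))"

lemma mirror_atile_simps [simp]:
  "mirror_atile (Cross a b) = Cross (\<not> a) b" "mirror_atile (Vert s r q) = Vert s (flip_red r) q" "mirror_atile (Horiz s r q) = Horiz (\<not> s) r q"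
  by (simp_all add: mirror_atile_def)

definition transpose_tile :: "tile \<Rightarrow> tile" where
  "transpose_tile = image (\<lambda>((a, b), m). ((b, a), m))"

lemma transpose_tile_of: "transpose_tile (tile_of t) = tile_of (transpose_atile t)"
  by (cases t) (auto simp: tile_of_def transpose_tile_def side_marks_def image_Un red_side_def split: red.splits)

lemma reflect_tile_of: "reflect_tile (tile_of t) = tile_of (mirror_atile t)"
  by (cases t) (auto simp: tile_of_def reflect_tile_def side_marks_def image_Un red_side_def flip_red.simps split: red.splits)

lemma rotate_tile_of: "rotate_tile (tile_of t) = tile_of (mirror_atile (transpose_atile t))"
proof -
  have "rotate_tile (tile_of t) = reflect_tile (transpose_tile (tile_of t))"
    unfolding rotate_tile_def reflect_tile_def transpose_tile_def image_image by (rule image_cong) auto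
  then show ?thesis by (simp add: transpose_tile_of reflect_tile_of)
qed

lemma tile_tile_of:
  "tile1 = tile_of (Vert False NoRed False)" "tile2 = tile_of (Vert False Lo True)" "tile3 = tile_of (Cross True True)"
  "tile4 = tile_of (Vert False NoRed True)" "tile5 = tile_of (Vert False Lo False)"
  by (auto simp: tile1_def tile2_def tile3_def tile4_def tile5_def tile_of_def side_marks_def red_side_def)

text \<open>This accounts for the 28 symbols: 4 crosses, 12 vertical and 12 horizontal arms.\<close>

lemma alphabet_tile_of: "robinson_alphabet = range tile_of"
proof
  show "robinson_alphabet \<subseteq> range tile_of"
  proof
    fix t assume "t \<in> robinson_alphabet"
    then show "t \<in> range tile_of"
      by induction (auto simp: tile_tile_of rotate_tile_of reflect_tile_of)
  qed
  have ro: "tile_of (mirror_atile (transpose_atile t)) \<in> robinson_alphabet" if "tile_of t \<in> robinson_alphabet" for t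
    using robinson_alphabet.rotate[OF that] by (simp add: rotate_tile_of)
  have re: "tile_of (mirror_atile t) \<in> robinson_alphabet" if "tile_of t \<in> robinson_alphabet" for t
    using robinson_alphabet.reflect[OF that] by (simp add: reflect_tile_of)
  have b: "tile_of (Vert False NoRed q) \<in> robinson_alphabet" "tile_of (Vert False Lo q) \<in> robinson_alphabet" for q
    by (cases q; simp flip: tile_tile_of; rule robinson_alphabet.basic; simp)+
  have c: "tile_of (Cross True True) \<in> robinson_alphabet"
    by (simp flip: tile_tile_of; rule robinson_alphabet.basic; simp)
  have h: "tile_of (Vert False r q) \<in> robinson_alphabet" for r q
    using b[of q] re[OF b(2)[of q]] by (cases r) auto
  have h2: "tile_of (Horiz s r q) \<in> robinson_alphabet" for s r q
    using ro[OF h[of r q]] re[OF ro[OF h[of r q]]] by (cases s) auto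
  have h3: "tile_of (Vert s r q) \<in> robinson_alphabet" for s r q
    using ro[OF h2[of s r q]] ro[OF h2[of s "flip_red r" q]] by (cases r) auto
  have c4: "tile_of (Cross a b) \<in> robinson_alphabet" for a b
    using c re[OF c] ro[OF c] ro[OF ro[OF c]] ro[OF ro[OF ro[OF c]]] re[OF ro[OF ro[OF c]]] by (cases a; cases b) auto
  show "range tile_of \<subseteq> robinson_alphabet"
  proof
    fix x assume "x \<in> range tile_of"
    then obtain t where "x = tile_of t" by blast
    then show "x \<in> robinson_alphabet" using h2 h3 c4 by (cases t) auto
  qed
qed

lemma crosses_tile_of: "tile_of t \<in> crosses \<longleftrightarrow> is_cross t"
proof -
  have r: "\<exists>a b. (rotate_tile ^^ n) tile3 = tile_of (Cross a b)" for n
  proof (induction n)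
    case 0 show ?case by (auto simp: tile_tile_of)
  next
    case (Suc n)
    then obtain a b where "(rotate_tile ^^ n) tile3 = tile_of (Cross a b)" by blast
    then have "(rotate_tile ^^ Suc n) tile3 = tile_of (Cross (\<not> b) a)" by (simp add: rotate_tile_of)
    then show ?case by blast
  qed
  have "tile_of (Cross a b) \<in> crosses" for a b
  proof -
    have "(rotate_tile ^^ 0) tile3 = tile_of (Cross True True)" "(rotate_tile ^^ 1) tile3 = tile_of (Cross False True)"
      "(rotate_tile ^^ 2) tile3 = tile_of (Cross False False)" "(rotate_tile ^^ 3) tile3 = tile_of (Cross True False)"
      by (simp_all add: tile_tile_of rotate_tile_of numeral_2_eq_2 numeral_3_eq_3)
    then show ?thesis unfolding crosses_def by (cases a; cases b) (metis (mono_tags, lifting) mem_Collect_eq)+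
  qed
  moreover have "is_cross t" if cr: "tile_of t \<in> crosses"
  proof -
    obtain n where "tile_of t = (rotate_tile ^^ n) tile3" using cr unfolding crosses_def by blast
    then obtain a b where "tile_of t = tile_of (Cross a b)" using r[of n] by auto
    then show ?thesis using inj_tile_of by (metis injD is_cross.simps(1))
  qed
  ultimately show ?thesis using is_cross_iff by metis
qed

section \<open>Encoding of configurations\<close>

definition realize :: "atiling \<Rightarrow> tile config" where "realize y = (\<lambda>p. tile_of (y (p $ 1) (p $ 2)))"

lemma vec2_eq: "p = q \<longleftrightarrow> p $ 1 = q $ 1 \<and> p $ 2 = q $ 2" for p q :: "'a^2"
  by (simp add: vec_eq_iff forall_2)

lemma inj_realize: "realize y = realize y' \<longleftrightarrow> y = y'"
proof
  assume eq: "realize y = realize y'"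
  show "y = y'"
  proof (intro ext)
    fix i j
    have "tile_of (y i j) = tile_of (y' i j)" using fun_cong[OF eq, of "vector [i, j]"] by (simp add: realize_def)
    then show "y i j = y' i j" using inj_tile_of by (simp add: inj_eq)
  qed
qed simp

lemma ex_realize:
  assumes "\<And>p. x p \<in> robinson_alphabet" shows "\<exists>y. x = realize y"
proof -
  have "x p = tile_of (the_inv tile_of (x p))" for p using assms[of p] f_the_inv_into_f[OF inj_tile_of] by (simp add: alphabet_tile_of)
  moreover have "vector [p $ 1, p $ 2] = p" for p :: "int^2" by (simp add: vec2_eq)
  ultimately have "x = realize (\<lambda>i j. the_inv tile_of (x (vector [i, j])))" by (simp add: realize_def fun_eq_iff)
  then show ?thesis by blast
qed

lemma placed_iff:
  "((u, v), m) \<in> placed_markings x p \<longleftrightarrow> ((u - of_int (p $ 1), v - of_int (p $ 2)), m) \<in> x p"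
  unfolding placed_markings_def by (force simp: image_iff)

lemma adjacent_cases:
  assumes "adjacent p q"
  obtains "q = p + vector [1, 0]" | "p = q + vector [1, 0]" | "q = p + vector [0, 1]" | "p = q + vector [0, 1]"
proof -
  have "q$1 = p$1 + 1 \<and> q$2 = p$2 \<or> p$1 = q$1 + 1 \<and> q$2 = p$2 \<or> q$2 = p$2 + 1 \<and> q$1 = p$1 \<or> p$2 = q$2 + 1 \<and> q$1 = p$1"
    using assms unfolding adjacent_def by linarith
  then show ?thesis using that by (auto simp: vec2_eq)
qed

lemma arrow_end_if [simp]:
  "(Head = (if b then Head else Tail)) = b" "(Tail = (if b then Head else Tail)) = (\<not> b)"
  "(Head = (if b then Tail else Head)) = (\<not> b)" "(Tail = (if b then Tail else Head)) = b"
  by auto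

lemma edges_match_realize:
  "edges_match (realize y) \<longleftrightarrow> (\<forall>i j. rgt (y i j) = lft (y (i + 1) j)) \<and> (\<forall>i j. upp (y i j) = dwn (y i (j + 1)))"
proof
  assume m: "edges_match (realize y)"
  have eqI: "e = e'" if "\<And>x c. mark e x c \<Longrightarrow> 0 \<le> x \<Longrightarrow> x \<le> 1 \<Longrightarrow> mark e' x c" "\<And>x c. mark e' x c \<Longrightarrow> 0 \<le> x \<Longrightarrow> x \<le> 1 \<Longrightarrow> mark e x c"
    "fst e = fst e'" for e e'
  proof (rule prod_eqI)
    have "0 \<le> x \<and> x \<le> 1" if "mark e x c" for e x c using that by (auto simp: mark_def)
    then show "snd e = snd e'" using that(1,2) by (subst mark_eq_iff[symmetric]) blast
  qed fact
  have m': "(((z1, z2), c, Head) \<in> placed_markings (realize y) p \<longleftrightarrow> ((z1, z2), c, Tail) \<in> placed_markings (realize y) q) \<and>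
     (((z1, z2), c, Tail) \<in> placed_markings (realize y) p \<longleftrightarrow> ((z1, z2), c, Head) \<in> placed_markings (realize y) q)"
    if "adjacent p q" "(z1, z2) \<in> unit_square p \<inter> unit_square q" for p q z1 z2 c
  proof -
    have "adjacent q p" using that(1) by (simp add: adjacent_def abs_minus_commute)
    moreover have "(z1, z2) \<in> unit_square q \<inter> unit_square p" using that by blast
    ultimately show ?thesis using m that unfolding edges_match_def by blast
  qed
  show "(\<forall>i j. rgt (y i j) = lft (y (i + 1) j)) \<and> (\<forall>i j. upp (y i j) = dwn (y i (j + 1)))"
  proof (intro conjI allI)
    fix i j
    define p q where "p = (vector [i, j] :: int^2)" and "q = (vector [i + 1, j] :: int^2)"
    have a: "adjacent p q" by (simp add: adjacent_def p_def q_def)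
    have sq: "(of_int i + 1, of_int j + x) \<in> unit_square p \<inter> unit_square q" if "0 \<le> x" "x \<le> 1" for x
      using that by (simp add: unit_square_def p_def q_def)
    have *: "(mark (rgt (y i j)) x c \<and> fst (rgt (y i j))) = (mark (lft (y (i + 1) j)) x c \<and> fst (lft (y (i + 1) j)))"
      "(mark (rgt (y i j)) x c \<and> \<not> fst (rgt (y i j))) = (mark (lft (y (i + 1) j)) x c \<and> \<not> fst (lft (y (i + 1) j)))"
      if "0 \<le> x" "x \<le> 1" for x c
      using m'[OF a sq[OF that], of c] by (simp_all add: placed_iff realize_def p_def q_def tile_of_edges)
    show "rgt (y i j) = lft (y (i + 1) j)"
    proof (rule eqI)
      show f: "fst (rgt (y i j)) = fst (lft (y (i + 1) j))" using *[of "1/2" Black] by simp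
    qed (use * in blast)+
  next
    fix i j
    define p q where "p = (vector [i, j] :: int^2)" and "q = (vector [i, j + 1] :: int^2)"
    have a: "adjacent p q" by (simp add: adjacent_def p_def q_def)
    have sq: "(of_int i + x, of_int j + 1) \<in> unit_square p \<inter> unit_square q" if "0 \<le> x" "x \<le> 1" for x
      using that by (simp add: unit_square_def p_def q_def)
    have *: "(mark (upp (y i j)) x c \<and> fst (upp (y i j))) = (mark (dwn (y i (j + 1))) x c \<and> fst (dwn (y i (j + 1))))"
      "(mark (upp (y i j)) x c \<and> \<not> fst (upp (y i j))) = (mark (dwn (y i (j + 1))) x c \<and> \<not> fst (dwn (y i (j + 1))))"
      if "0 \<le> x" "x \<le> 1" for x c
      using m'[OF a sq[OF that], of c] by (simp_all add: placed_iff realize_def p_def q_def tile_of_edges)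
    show "upp (y i j) = dwn (y i (j + 1))"
    proof (rule eqI)
      show f: "fst (upp (y i j)) = fst (dwn (y i (j + 1)))" using *[of "1/2" Black] by simp
    qed (use * in blast)+
  qed
next
  assume m: "(\<forall>i j. rgt (y i j) = lft (y (i + 1) j)) \<and> (\<forall>i j. upp (y i j) = dwn (y i (j + 1)))"
  have hd: "h = (if b then Head else Tail) \<longleftrightarrow> h' = (if b then Tail else Head)"
    if "(h, h') = (Head, Tail) \<or> (h, h') = (Tail, Head)" for h h' b using that by auto
  have H: "(z, c, h) \<in> placed_markings (realize y) p \<longleftrightarrow> (z, c, h') \<in> placed_markings (realize y) (p + vector [1, 0])"
    if z: "z \<in> unit_square p \<inter> unit_square (p + vector [1, 0])" and "(h, h') = (Head, Tail) \<or> (h, h') = (Tail, Head)" for p z c h h'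
  proof -
    obtain z2 where z: "z = (of_int (p $ 1) + 1, z2)" using z by (cases z) (auto simp: unit_square_def)
    show ?thesis using m hd[OF that(2), of "fst (lft (y (p $ 1 + 1) (p $ 2)))"] by (simp add: z placed_iff realize_def tile_of_edges)
  qed
  have V: "(z, c, h) \<in> placed_markings (realize y) p \<longleftrightarrow> (z, c, h') \<in> placed_markings (realize y) (p + vector [0, 1])"
    if z: "z \<in> unit_square p \<inter> unit_square (p + vector [0, 1])" and "(h, h') = (Head, Tail) \<or> (h, h') = (Tail, Head)" for p z c h h'
  proof -
    obtain z1 where z: "z = (z1, of_int (p $ 2) + 1)" using z by (cases z) (auto simp: unit_square_def)
    show ?thesis using m hd[OF that(2), of "fst (dwn (y (p $ 1) (p $ 2 + 1)))"] by (simp add: z placed_iff realize_def tile_of_edges)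
  qed
  show "edges_match (realize y)" unfolding edges_match_def
  proof (intro allI impI ballI)
    fix p q z c assume "adjacent p q" and z: "z \<in> unit_square p \<inter> unit_square q"
    then show "((z, c, Head) \<in> placed_markings (realize y) p \<longrightarrow> (z, c, Tail) \<in> placed_markings (realize y) q) \<and>
       ((z, c, Tail) \<in> placed_markings (realize y) p \<longrightarrow> (z, c, Head) \<in> placed_markings (realize y) q)"
    proof (cases rule: adjacent_cases)
      case 1 then show ?thesis using H[of z p] z by blast
    next
      case 2 then show ?thesis using H[of z q] z by blast
    next
      case 3 then show ?thesis using V[of z p] z by blast
    next
      case 4 then show ?thesis using V[of z q] z by blast
    qed
  qed
qed

lemma even_coset_iff: "p \<in> even_coset k \<longleftrightarrow> even (p $ 1 - k $ 1) \<and> even (p $ 2 - k $ 2)"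
proof
  assume "even (p $ 1 - k $ 1) \<and> even (p $ 2 - k $ 2)"
  then obtain a b where "p $ 1 - k $ 1 = 2 * a" "p $ 2 - k $ 2 = 2 * b" by (meson evenE)
  then have "p = 2 *s vector [a, b] + k" by (simp add: vec2_eq)
  then show "p \<in> even_coset k" unfolding even_coset_def by blast
qed (auto simp: even_coset_def)

lemma X_Rob_realize: "X_Rob = realize ` abs_X"
proof -
  have *: "realize y \<in> X_Rob \<longleftrightarrow> y \<in> abs_X" for y
  proof -
    have "realize y \<in> X_Rob \<longleftrightarrow> edges_match (realize y) \<and>
       (\<exists>k1 k2. (\<forall>i j. even (i - k1) \<and> even (j - k2) \<longrightarrow> is_cross (y i j)) \<and>
         (\<forall>i j. is_cross (y i j) \<and> \<not> (even (i - k1) \<and> even (j - k2)) \<longrightarrow> even (i - (k1 + 1)) \<and> even (j - (k2 + 1))))"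
      (is "_ \<longleftrightarrow> _ \<and> (\<exists>k1 k2. ?P k1 k2)")
    proof -
      have v: "(\<forall>p :: int^2. Q (p $ 1) (p $ 2)) \<longleftrightarrow> (\<forall>i j. Q i j)" for Q
        by (metis vector_2)
      have ve: "(\<exists>p :: int^2. Q (p $ 1) (p $ 2)) \<longleftrightarrow> (\<exists>i j. Q i j)" for Q
        by (metis vector_2)
      show ?thesis unfolding X_Rob_def even_coset_iff Ball_def
        by (simp add: realize_def crosses_tile_of alphabet_tile_of v ve[symmetric] flip: v)
    qed
    also have "\<dots> \<longleftrightarrow> y \<in> abs_X"
    proof
      assume l: "edges_match (realize y) \<and> (\<exists>k1 k2. ?P k1 k2)"
      then obtain k1 k2 where k: "?P k1 k2" by blast
      have m: "\<And>i j. rgt (y i j) = lft (y (i + 1) j)" "\<And>i j. upp (y i j) = dwn (y i (j + 1))"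
        using l unfolding edges_match_realize by blast+
      \<comment> \<open>The shift carries the coset of forced crosses to the positions with odd
        coordinates.\<close>
      define w where "w = sh (1 - k1) (1 - k2) y"
      have "valid_on UNIV w"
      proof (rule valid_onI)
        fix i j :: int
        have e: "i + 1 - (1 - k1) = i - (1 - k1) + 1" "j + 1 - (1 - k2) = j - (1 - k2) + 1" by simp_all
        show "rgt (w i j) = lft (w (i + 1) j)" "upp (w i j) = dwn (w i (j + 1))" unfolding w_def sh_def e by (rule m)+
        show "is_cross (w i j)" if "odd i" "odd j" using k that by (simp add: w_def sh_def)
        show "odd i = odd j" if "is_cross (w i j)"
        proof -
          have "(even (i - (1 - k1) - k1) \<and> even (j - (1 - k2) - k2)) \<or> (even (i - (1 - k1) - (k1 + 1)) \<and> even (j - (1 - k2) - (k2 + 1)))"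
            using k that unfolding w_def sh_def by blast
          then show ?thesis by auto
        qed
      qed
      moreover have "y = sh (k1 - 1) (k2 - 1) w" by (simp add: w_def)
      ultimately show "y \<in> abs_X" unfolding abs_X_iff by blast
    next
      assume "y \<in> abs_X"
      then obtain p q w where w: "valid_on UNIV w" "y = sh p q w" unfolding abs_X_iff by blast
      have e: "i + 1 - p = i - p + 1" "j + 1 - q = j - q + 1" for i j by simp_all
      have "edges_match (realize y)" unfolding edges_match_realize w(2) sh_def e
        using valid_on_h[OF w(1)] valid_on_v[OF w(1)] by blast
      moreover have "?P (p + 1) (q + 1)"
      proof (intro conjI allI impI; (elim conjE)?)
        fix i j :: int assume "even (i - (p + 1))" "even (j - (q + 1))"
        then have "odd (i - p)" "odd (j - q)" by simp_all
        then show "is_cross (y i j)" unfolding w(2) sh_def using valid_on_cross[OF w(1)] by blast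
      next
        fix i j :: int assume "is_cross (y i j)" "\<not> (even (i - (p + 1)) \<and> even (j - (q + 1)))"
        then show "even (i - (p + 1 + 1))" "even (j - (q + 1 + 1))"
          using valid_on_parity[OF w(1), of "j - q" "i - p"] unfolding w(2) sh_def by auto
      qed
      ultimately show "edges_match (realize y) \<and> (\<exists>k1 k2. ?P k1 k2)" by blast
    qed
    finally show ?thesis .
  qed
  have "x \<in> realize ` abs_X" if "x \<in> X_Rob" for x
  proof -
    have "\<And>p. x p \<in> robinson_alphabet" using that by (simp add: X_Rob_def)
    then obtain y where "x = realize y" using ex_realize by blast
    then show ?thesis using that * by blast
  qed
  then show ?thesis using * by blast
qed

lemma shift_realize: "shift p (realize y) = realize (sh (p $ 1) (p $ 2) y)"
  by (simp add: shift_def realize_def sh_def fun_eq_iff)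

section \<open>Topology\<close>

lemma valid_on_local:
  assumes "\<not> valid_on UNIV w"
  shows "\<exists>R\<ge>0. \<forall>w'. (\<forall>i j. \<bar>i\<bar> \<le> R \<longrightarrow> \<bar>j\<bar> \<le> R \<longrightarrow> w' i j = w i j) \<longrightarrow> \<not> valid_on UNIV w'"
proof -
  have "\<exists>i j. rgt (w i j) \<noteq> lft (w (i + 1) j) \<or> upp (w i j) \<noteq> dwn (w i (j + 1)) \<or>
     (odd i \<and> odd j \<and> \<not> is_cross (w i j)) \<or> (is_cross (w i j) \<and> odd i \<noteq> odd j)"
    using assms unfolding valid_on_def by auto
  then obtain i j where ij: "rgt (w i j) \<noteq> lft (w (i + 1) j) \<or> upp (w i j) \<noteq> dwn (w i (j + 1)) \<or>
     (odd i \<and> odd j \<and> \<not> is_cross (w i j)) \<or> (is_cross (w i j) \<and> odd i \<noteq> odd j)" by blast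
  define R where "R = \<bar>i\<bar> + \<bar>j\<bar> + 1"
  have "\<not> valid_on UNIV w'" if a: "\<forall>i j. \<bar>i\<bar> \<le> R \<longrightarrow> \<bar>j\<bar> \<le> R \<longrightarrow> w' i j = w i j" for w'
  proof
    assume v: "valid_on UNIV w'"
    have "w' i j = w i j" "w' (i + 1) j = w (i + 1) j" "w' i (j + 1) = w i (j + 1)"
      using a by (auto simp: R_def)
    then show False using ij valid_on_h[OF v, of j i] valid_on_v[OF v, of j i] valid_on_cross[OF v, of j i] valid_on_parity[OF v, of j i] by auto
  qed
  then show ?thesis by (intro exI[of _ R]) (auto simp: R_def)
qed

text \<open>Even shifts preserve validity, so four shifts decide membership; a finite union of
  closed conditions is closed.\<close>

lemma abs_X_parity: "z \<in> abs_X \<longleftrightarrow> (\<exists>p\<in>{0, 1}. \<exists>q\<in>{0, 1}. valid_on UNIV (sh p q z))"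
proof
  assume "z \<in> abs_X"
  then obtain p q y where y: "valid_on UNIV y" "z = sh p q y" unfolding abs_X_iff by blast
  define p' q' where "p' = p mod 2" and "q' = q mod 2"
  have "even (p' + p)" "even (q' + q)" by (simp_all add: p'_def q'_def)
  then have "valid_on UNIV (sh p' q' z)" using valid_sh[OF y(1)] by (simp add: y(2))
  moreover have "p' \<in> {0, 1}" "q' \<in> {0, 1}" by (auto simp: p'_def q'_def)
  ultimately show "\<exists>p\<in>{0, 1}. \<exists>q\<in>{0, 1}. valid_on UNIV (sh p q z)" by blast
next
  assume "\<exists>p\<in>{0, 1}. \<exists>q\<in>{0, 1}. valid_on UNIV (sh p q z)"
  then obtain p q where "valid_on UNIV (sh p q z)" by blast
  then have "sh p q z \<in> abs_X" by (rule valid_abs_X)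
  then show "z \<in> abs_X" by simp
qed

lemma abs_X_local:
  assumes "y \<notin> abs_X"
  shows "\<exists>R\<ge>0. \<forall>z. (\<forall>i j. \<bar>i\<bar> \<le> R \<longrightarrow> \<bar>j\<bar> \<le> R \<longrightarrow> z i j = y i j) \<longrightarrow> z \<notin> abs_X"
proof -
  define P where "P p q R \<longleftrightarrow> (\<forall>z. (\<forall>i j. \<bar>i\<bar> \<le> R \<longrightarrow> \<bar>j\<bar> \<le> R \<longrightarrow> z i j = y i j) \<longrightarrow> \<not> valid_on UNIV (sh p q z))" for p q R
  have "\<exists>R\<ge>0. \<forall>z. (\<forall>i j. \<bar>i\<bar> \<le> R \<longrightarrow> \<bar>j\<bar> \<le> R \<longrightarrow> z i j = y i j) \<longrightarrow> \<not> valid_on UNIV (sh p q z)"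
    if pq: "p \<in> {0, 1}" "q \<in> {0, 1}" for p q
  proof -
    have "\<not> valid_on UNIV (sh p q y)" using assms pq unfolding abs_X_parity by blast
    then obtain R where R: "0 \<le> R" "\<And>w'. (\<And>i j. \<bar>i\<bar> \<le> R \<Longrightarrow> \<bar>j\<bar> \<le> R \<Longrightarrow> w' i j = sh p q y i j) \<Longrightarrow> \<not> valid_on UNIV w'"
      using valid_on_local by blast
    have "\<not> valid_on UNIV (sh p q z)" if "\<forall>i j. \<bar>i\<bar> \<le> R + 1 \<longrightarrow> \<bar>j\<bar> \<le> R + 1 \<longrightarrow> z i j = y i j" for z
      by (rule R(2)) (use that pq in \<open>auto simp: sh_def\<close>)
    then show ?thesis using R(1) by (intro exI[of _ "R + 1"]) auto
  qed
  then have ex: "\<exists>R\<ge>0. P p q R" if "p \<in> {0, 1}" "q \<in> {0, 1}" for p q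
    unfolding P_def using that by blast
  have mono: "P p q R'" if "P p q R" "R \<le> R'" for p q R R'
    unfolding P_def
  proof (intro allI impI)
    fix z assume "\<forall>i j. \<bar>i\<bar> \<le> R' \<longrightarrow> \<bar>j\<bar> \<le> R' \<longrightarrow> z i j = y i j"
    then have "\<forall>i j. \<bar>i\<bar> \<le> R \<longrightarrow> \<bar>j\<bar> \<le> R \<longrightarrow> z i j = y i j"
      using order_trans[OF _ that(2)] by simp
    then show "\<not> valid_on UNIV (sh p q z)" using that(1) unfolding P_def by blast
  qed
  obtain a where a: "0 \<le> a" "P 0 0 a" using ex[of 0 0] by auto
  obtain b where b: "0 \<le> b" "P 0 1 b" using ex[of 0 1] by auto
  obtain c where c: "0 \<le> c" "P 1 0 c" using ex[of 1 0] by auto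
  obtain d where d: "0 \<le> d" "P 1 1 d" using ex[of 1 1] by auto
  define M where "M = a + b + c + d"
  have M: "P p q M" if "p \<in> {0, 1}" "q \<in> {0, 1}" for p q
    using that mono[OF a(2), of M] mono[OF b(2), of M] mono[OF c(2), of M] mono[OF d(2), of M] a(1) b(1) c(1) d(1)
    by (auto simp: M_def)
  have "z \<notin> abs_X" if "\<forall>i j. \<bar>i\<bar> \<le> M \<longrightarrow> \<bar>j\<bar> \<le> M \<longrightarrow> z i j = y i j" for z
    using M that unfolding abs_X_parity P_def by blast
  moreover have "0 \<le> M" using a(1) b(1) c(1) d(1) by (simp add: M_def)
  ultimately show ?thesis by blast
qed

definition window :: "int \<Rightarrow> (int^2) set" where "window r = {p. \<bar>p $ 1\<bar> \<le> r \<and> \<bar>p $ 2\<bar> \<le> r}"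

lemma finite_window: "finite (window r)"
proof -
  have "window r \<subseteq> (\<lambda>(i, j). vector [i, j]) ` ({- r..r} \<times> {- r..r})"
  proof
    fix p assume "p \<in> window r"
    then have "(p $ 1, p $ 2) \<in> {- r..r} \<times> {- r..r}" by (auto simp: window_def)
    moreover have "p = vector [p $ 1, p $ 2]" by (simp add: vec2_eq)
    ultimately show "p \<in> (\<lambda>(i, j). vector [i, j]) ` ({- r..r} \<times> {- r..r})" by force
  qed
  then show ?thesis by (rule finite_subset) simp
qed

lemma window_mono: "r \<le> r' \<Longrightarrow> window r \<subseteq> window r'"
  by (auto simp: window_def)

lemma finite_in_window: "finite B \<Longrightarrow> \<exists>r\<ge>0. B \<subseteq> window r"
proof (induction B rule: finite_induct)
  case empty then show ?case by auto
next
  case (insert p B)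
  then obtain r where r: "0 \<le> r" "B \<subseteq> window r" by blast
  define r' where "r' = max r (max \<bar>p $ 1\<bar> \<bar>p $ 2\<bar>)"
  have "B \<subseteq> window r'" using r(2) window_mono[of r r'] by (auto simp: r'_def)
  moreover have "p \<in> window r'" by (auto simp: window_def r'_def)
  ultimately show ?case using r(1) by (intro exI[of _ r']) (auto simp: r'_def)
qed

lemma finite_alphabet: "finite robinson_alphabet"
proof -
  have "(UNIV :: red set) = {NoRed, Lo, Hi}" using red.exhaust by auto
  then have f: "finite (UNIV :: red set)" by (metis finite.emptyI finite_insert)
  have "t \<in> range (case_prod Cross) \<union> range (\<lambda>(s, r, q). Vert s r q) \<union> range (\<lambda>(s, r, q). Horiz s r q)" for t
    by (cases t) (auto simp: image_iff)
  then have "(UNIV :: atile set) \<subseteq> range (case_prod Cross) \<union> range (\<lambda>(s, r, q). Vert s r q) \<union> range (\<lambda>(s, r, q). Horiz s r q)"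
    by blast
  moreover have "finite (range (case_prod Cross) \<union> range (\<lambda>(s, r, q). Vert s r q) \<union> range (\<lambda>(s, r, q). Horiz s r q))"
    using f by (intro finite_UnI finite_imageI) (auto simp: finite_Prod_UNIV)
  ultimately have "finite (UNIV :: atile set)" by (rule finite_subset)
  then show ?thesis unfolding alphabet_tile_of by (rule finite_imageI)
qed

lemma topspace_full_shift: "topspace (full_shift_topology A) = {x. \<forall>p. x p \<in> A}"
  by (auto simp: full_shift_topology_def)

lemma openin_cylinder:
  assumes "finite B"
  shows "openin (full_shift_topology A) {y \<in> topspace (full_shift_topology A). \<forall>p\<in>B. y p = x p}"
  using assms
proof (induction B rule: finite_induct)
  case empty then show ?case by simp
next
  case (insert p B)
  have "continuous_map (full_shift_topology A) (discrete_topology A) (\<lambda>y. y p)"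
    unfolding full_shift_topology_def by (rule continuous_map_product_projection) simp
  then have "openin (full_shift_topology A) {y \<in> topspace (full_shift_topology A). y p \<in> {x p} \<inter> A}"
    by (rule openin_continuous_map_preimage) simp
  moreover have "{y \<in> topspace (full_shift_topology A). \<forall>p\<in>insert p B. y p = x p}
     = {y \<in> topspace (full_shift_topology A). y p \<in> {x p} \<inter> A} \<inter> {y \<in> topspace (full_shift_topology A). \<forall>p\<in>B. y p = x p}"
    by (auto simp: topspace_full_shift)
  ultimately show ?case using insert.IH by (simp add: openin_Int)
qed

abbreviation X_topology :: "tile config topology" where
  "X_topology \<equiv> subtopology (full_shift_topology robinson_alphabet) X_Rob"

lemma X_Rob_sub: "X_Rob \<subseteq> topspace (full_shift_topology robinson_alphabet)"
  by (auto simp: topspace_full_shift X_Rob_def)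

lemma topspace_X_topology [simp]: "topspace X_topology = X_Rob"
  using X_Rob_sub by auto

lemma closedin_X_Rob: "closedin (full_shift_topology robinson_alphabet) X_Rob"
  unfolding closedin_def
proof
  show "X_Rob \<subseteq> topspace (full_shift_topology robinson_alphabet)" by (rule X_Rob_sub)
  show "openin (full_shift_topology robinson_alphabet) (topspace (full_shift_topology robinson_alphabet) - X_Rob)"
  proof (subst openin_subopen, intro ballI)
    fix x assume x: "x \<in> topspace (full_shift_topology robinson_alphabet) - X_Rob"
    then obtain y where y: "x = realize y" using ex_realize by (auto simp: topspace_full_shift)
    then have "y \<notin> abs_X" using x by (auto simp: X_Rob_realize)
    then obtain R where R: "\<And>z. (\<And>i j. \<bar>i\<bar> \<le> R \<Longrightarrow> \<bar>j\<bar> \<le> R \<Longrightarrow> z i j = y i j) \<Longrightarrow> z \<notin> abs_X"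
      using abs_X_local by blast
    define C where "C = {x' \<in> topspace (full_shift_topology robinson_alphabet). \<forall>p\<in>window R. x' p = x p}"
    have "C \<inter> X_Rob = {}"
    proof -
      have False if z: "z \<in> abs_X" "\<forall>p\<in>window R. realize z p = x p" for z
      proof -
        have "z i j = y i j" if "\<bar>i\<bar> \<le> R" "\<bar>j\<bar> \<le> R" for i j
        proof -
          have "vector [i, j] \<in> window R" using that by (simp add: window_def)
          then have "tile_of (z i j) = tile_of (y i j)" using z(2) y by (force simp: realize_def)
          then show ?thesis using inj_tile_of by (simp add: inj_eq)
        qed
        then show False using R z(1) by blast
      qed
      then show ?thesis unfolding C_def X_Rob_realize by blast
    qed
    moreover have "openin (full_shift_topology robinson_alphabet) C"
      unfolding C_def by (rule openin_cylinder[OF finite_window])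
    moreover have "x \<in> C" using x by (simp add: C_def)
    moreover have "C \<subseteq> topspace (full_shift_topology robinson_alphabet)" by (auto simp: C_def)
    ultimately show "\<exists>T. openin (full_shift_topology robinson_alphabet) T \<and> x \<in> T \<and>
        T \<subseteq> topspace (full_shift_topology robinson_alphabet) - X_Rob" by blast
  qed
qed

lemma compact_X_topology: "compact_space X_topology"
proof -
  have "compact_space (full_shift_topology robinson_alphabet)"
    unfolding full_shift_topology_def compact_space_product_topology
    using finite_alphabet by (simp add: compact_space_discrete_topology)
  then show ?thesis using closedin_compact_space[OF _ closedin_X_Rob] compact_space_subtopology by blast
qed

lemma Hausdorff_X_topology: "Hausdorff_space X_topology"
  by (rule Hausdorff_space_subtopology)
    (simp add: full_shift_topology_def Hausdorff_space_product_topology)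

text \<open>The compactness argument of the Curtis-Hedlund-Lyndon theorem: each point has a cylinder
  on which the value of the image at 0 is constant, and finitely many of these cylinders cover the
  space.\<close>

lemma local_rule:
  assumes f: "continuous_map X_topology X_topology f"
  shows "\<exists>r\<ge>0. \<forall>x\<in>X_Rob. \<forall>y\<in>X_Rob. (\<forall>p\<in>window r. x p = y p) \<longrightarrow> f x 0 = f y 0"
proof -
  let ?A = "robinson_alphabet" and ?F = "full_shift_topology robinson_alphabet"
  have "continuous_map X_topology ?F f" using f continuous_map_in_subtopology by blast
  moreover have "continuous_map ?F (discrete_topology ?A) (\<lambda>y. y 0)"
    unfolding full_shift_topology_def by (rule continuous_map_product_projection) simp
  ultimately have f0: "continuous_map X_topology (discrete_topology ?A) (\<lambda>y. f y 0)"
    using continuous_map_compose[of X_topology ?F f _ "\<lambda>y. y 0"] by (simp add: o_def)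
  have fX: "f x \<in> X_Rob" if "x \<in> X_Rob" for x
    using continuous_map_image_subset_topspace[OF f] that unfolding topspace_X_topology by blast
  have ex: "\<exists>r\<ge>0. \<forall>y\<in>X_Rob. (\<forall>p\<in>window r. y p = x p) \<longrightarrow> f y 0 = f x 0" if x: "x \<in> X_Rob" for x
  proof -
    have "f x 0 \<in> ?A" using fX[OF x] by (simp add: X_Rob_def)
    then have "openin X_topology {y \<in> topspace X_topology. f y 0 \<in> {f x 0}}"
      by (intro openin_continuous_map_preimage[OF f0]) simp
    then have "openin X_topology {y \<in> X_Rob. f y 0 = f x 0}" unfolding topspace_X_topology by simp
    then obtain W where W: "openin ?F W" "{y \<in> X_Rob. f y 0 = f x 0} = W \<inter> X_Rob"
      unfolding openin_subtopology by blast
    then have "x \<in> W" using x by auto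
    then obtain U where U: "finite {i. U i \<noteq> ?A}" "x \<in> Pi\<^sub>E UNIV U" "Pi\<^sub>E UNIV U \<subseteq> W"
      using W(1) unfolding full_shift_topology_def openin_product_topology_alt by auto
    obtain r where r: "0 \<le> r" "{i. U i \<noteq> ?A} \<subseteq> window r" using finite_in_window[OF U(1)] by blast
    have "f y 0 = f x 0" if y: "y \<in> X_Rob" "\<forall>p\<in>window r. y p = x p" for y
    proof -
      have "y p \<in> U p" for p
      proof (cases "U p = ?A")
        case True then show ?thesis using y(1) by (simp add: X_Rob_def)
      next
        case False
        then have "p \<in> window r" using r by blast
        then show ?thesis using y(2) U(2) by (auto simp: PiE_iff)
      qed
      then have "y \<in> Pi\<^sub>E UNIV U" by (simp add: PiE_iff)
      then show ?thesis using U(3) W(2) y(1) by blast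
    qed
    then show ?thesis using r(1) by blast
  qed
  define \<rho> where "\<rho> x = (SOME r. r \<ge> 0 \<and> (\<forall>y\<in>X_Rob. (\<forall>p\<in>window r. y p = x p) \<longrightarrow> f y 0 = f x 0))" for x
  have \<rho>: "\<rho> x \<ge> 0 \<and> (\<forall>y\<in>X_Rob. (\<forall>p\<in>window (\<rho> x). y p = x p) \<longrightarrow> f y 0 = f x 0)" if "x \<in> X_Rob" for x
    unfolding \<rho>_def using ex[OF that] by (rule someI_ex)
  define C where "C x = {y \<in> topspace ?F. \<forall>p\<in>window (\<rho> x). y p = x p} \<inter> X_Rob" for x
  have op: "openin X_topology U" if "U \<in> C ` X_Rob" for U
  proof -
    obtain x where "U = C x" using \<open>U \<in> C ` X_Rob\<close> by blast
    then show ?thesis unfolding C_def openin_subtopology using openin_cylinder[OF finite_window] by blast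
  qed
  have "topspace X_topology \<subseteq> \<Union> (C ` X_Rob)" using X_Rob_sub by (auto simp: C_def)
  then obtain \<F> where F: "finite \<F>" "\<F> \<subseteq> C ` X_Rob" "topspace X_topology \<subseteq> \<Union>\<F>"
    using compact_X_topology op unfolding compact_space_alt by meson
  obtain K where K: "K \<subseteq> X_Rob" "finite K" "\<F> = C ` K" using finite_subset_image[OF F(1,2)] by blast
  define r where "r = Max (insert 0 (\<rho> ` K))"
  have r: "\<rho> x \<le> r" if "x \<in> K" for x unfolding r_def using K(2) that by (intro Max_ge) auto
  have "f x 0 = f y 0" if xy: "x \<in> X_Rob" "y \<in> X_Rob" "\<forall>p\<in>window r. x p = y p" for x y
  proof -
    obtain k where k: "k \<in> K" "x \<in> C k" using F(3)[unfolded topspace_X_topology] xy(1) K(3) by blast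
    have kX: "k \<in> X_Rob" using k K by blast
    have "\<forall>p\<in>window (\<rho> k). x p = k p" using k(2) by (simp add: C_def)
    moreover from this have "\<forall>p\<in>window (\<rho> k). y p = k p" using xy(3) window_mono[OF r[OF k(1)]] by (metis subsetD)
    ultimately show ?thesis using \<rho>[OF kX] xy by metis
  qed
  moreover have "0 \<le> r" unfolding r_def using K(2) by (intro Max_ge) auto
  ultimately show ?thesis by blast
qed

section \<open>Signed permutation matrices\<close>

definition matrix2 :: "int \<Rightarrow> int \<Rightarrow> int \<Rightarrow> int \<Rightarrow> int^2^2" where
  "matrix2 a b c d = vector [vector [a, b], vector [c, d]]"

lemma matrix2_entries [simp]: "matrix2 a b c d $ 1 $ 1 = a" "matrix2 a b c d $ 1 $ 2 = b" "matrix2 a b c d $ 2 $ 1 = c" "matrix2 a b c d $ 2 $ 2 = d"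
  by (simp_all add: matrix2_def)

lemma mat2_eq: "A = B \<longleftrightarrow> A$1$1 = B$1$1 \<and> A$1$2 = B$1$2 \<and> A$2$1 = B$2$1 \<and> A$2$2 = B$2$2" for A B :: "'a^2^2"
  by (auto simp: vec_eq_iff forall_2)

lemma mat2_mult:
  "(A ** B)$1$1 = A$1$1 * B$1$1 + A$1$2 * B$2$1" "(A ** B)$1$2 = A$1$1 * B$1$2 + A$1$2 * B$2$2"
  "(A ** B)$2$1 = A$2$1 * B$1$1 + A$2$2 * B$2$1" "(A ** B)$2$2 = A$2$1 * B$1$2 + A$2$2 * B$2$2" for A B :: "'a::semiring_1^2^2"
  by (simp_all add: matrix_matrix_mult_def sum_2)

lemma mat2_vec: "(A *v p)$1 = A$1$1 * p$1 + A$1$2 * p$2" "(A *v p)$2 = A$2$1 * p$1 + A$2$2 * p$2" for A :: "'a::semiring_1^2^2"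
  by (simp_all add: matrix_vector_mult_def sum_2)

lemma mat2_one: "(mat 1 :: int^2^2)$1$1 = 1" "(mat 1 :: int^2^2)$1$2 = 0" "(mat 1 :: int^2^2)$2$1 = 0" "(mat 1 :: int^2^2)$2$2 = 1"
  by (simp_all add: mat_def)

lemma matrix2_mult: "matrix2 a b c d ** matrix2 a' b' c' d' = matrix2 (a * a' + b * c') (a * b' + b * d') (c * a' + d * c') (c * b' + d * d')"
  by (simp add: mat2_eq mat2_mult)

lemma mat_one_matrix2: "mat 1 = matrix2 1 0 0 1" by (simp add: mat2_eq mat2_one)

lemma matrix2_ex: "A = matrix2 (A$1$1) (A$1$2) (A$2$1) (A$2$2)" by (simp add: mat2_eq)

definition adj :: "int^2^2 \<Rightarrow> int^2^2" where "adj A = transpose A"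

lemma adj_matrix2: "adj (matrix2 a b c d) = matrix2 a c b d" by (simp add: adj_def mat2_eq transpose_def)

lemma adj_mult: "adj (A ** B) = adj B ** adj A" by (simp add: adj_def matrix_transpose_mul)
lemma adj_adj [simp]: "adj (adj A) = A" by (simp add: adj_def)
lemma adj_one [simp]: "adj (mat 1) = mat 1" by (simp add: adj_def)

text \<open>These are the integral orthogonal matrices, with the transpose \<open>adj\<close> as
  inverse; \<open>signed_perm_matrix2\<close> lists them.\<close>

definition signed_perm :: "(int^2^2) set" where "signed_perm = {A. A ** adj A = mat 1 \<and> adj A ** A = mat 1}"

lemma signed_perm_adj: "A \<in> signed_perm \<Longrightarrow> adj A \<in> signed_perm" by (simp add: signed_perm_def)

lemma signed_perm_mult: "A \<in> signed_perm \<Longrightarrow> B \<in> signed_perm \<Longrightarrow> A ** B \<in> signed_perm"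
proof -
  assume "A \<in> signed_perm" "B \<in> signed_perm"
  then have 1: "A ** adj A = mat 1" "adj A ** A = mat 1" "B ** adj B = mat 1" "adj B ** B = mat 1" by (auto simp: signed_perm_def)
  have "(A ** B) ** (adj B ** adj A) = A ** (B ** adj B) ** adj A" by (simp add: matrix_mul_assoc)
  moreover have "(adj B ** adj A) ** (A ** B) = adj B ** (adj A ** A) ** B" by (simp add: matrix_mul_assoc)
  ultimately show ?thesis using 1 by (simp add: signed_perm_def adj_mult)
qed

lemma signed_perm_one: "mat 1 \<in> signed_perm" by (simp add: signed_perm_def)

lemma signed_perm_vec: "A \<in> signed_perm \<Longrightarrow> adj A *v (A *v p) = p" "A \<in> signed_perm \<Longrightarrow> A *v (adj A *v p) = p"
  by (simp_all add: signed_perm_def matrix_vector_mul_assoc)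

lemma int_sq_sum: "(a::int) * a + b * b = 1 \<longleftrightarrow> (a = 0 \<and> (b = 1 \<or> b = - 1)) \<or> (b = 0 \<and> (a = 1 \<or> a = - 1))"
proof
  assume s: "a * a + b * b = 1"
  have sq: "x = 0 \<or> x = 1 \<or> x = -1" if "x * x \<le> 1" for x :: int
  proof (rule ccontr)
    assume "\<not> ?thesis"
    then have "2 \<le> \<bar>x\<bar>" by linarith
    then have "2 * 2 \<le> \<bar>x\<bar> * \<bar>x\<bar>" by (intro mult_mono) auto
    then show False using that by simp
  qed
  have "a * a \<le> 1" "b * b \<le> 1" using s zero_le_square[of a] zero_le_square[of b] by linarith+
  then show "(a = 0 \<and> (b = 1 \<or> b = - 1)) \<or> (b = 0 \<and> (a = 1 \<or> a = - 1))" using sq[of a] sq[of b] s by auto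
qed auto

definition swapM :: "int^2^2" where "swapM = matrix2 0 1 1 0"
definition reflM :: "int^2^2" where "reflM = matrix2 (-1) 0 0 1"

lemma signed_perm_matrix2: "matrix2 a b c d \<in> signed_perm \<longleftrightarrow> (b = 0 \<and> c = 0 \<and> (a = 1 \<or> a = - 1) \<and> (d = 1 \<or> d = - 1)) \<or>
   (a = 0 \<and> d = 0 \<and> (b = 1 \<or> b = - 1) \<and> (c = 1 \<or> c = - 1))"
proof
  assume "matrix2 a b c d \<in> signed_perm"
  then have "a * a + b * b = 1" "c * c + d * d = 1" "a * c + b * d = 0"
    by (auto simp: signed_perm_def adj_matrix2 matrix2_mult mat_one_matrix2 mat2_eq)
  then show "(b = 0 \<and> c = 0 \<and> (a = 1 \<or> a = - 1) \<and> (d = 1 \<or> d = - 1)) \<or>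
   (a = 0 \<and> d = 0 \<and> (b = 1 \<or> b = - 1) \<and> (c = 1 \<or> c = - 1))"
    unfolding int_sq_sum by auto
qed (auto simp: signed_perm_def adj_matrix2 matrix2_mult mat_one_matrix2)

text \<open>The eight elements are the alternating words of length at most four in the two
  involutions; the two words of length four coincide.\<close>

lemma signed_perm_induct:
  assumes "A \<in> signed_perm" "P (mat 1)" "P swapM" "P reflM" "\<And>A B. P A \<Longrightarrow> P B \<Longrightarrow> P (A ** B)"
  shows "P A"
proof -
  have 1: "P (swapM ** reflM)" "P (reflM ** swapM)" "P (swapM ** reflM ** swapM)" "P (reflM ** swapM ** reflM)"
    using assms by blast+
  then have 2: "P (swapM ** reflM ** swapM ** reflM)" using assms by blast
  note all = assms(2-4) 1 2
  show ?thesis using assms(1) all unfolding signed_perm_matrix2[of "A$1$1" "A$1$2" "A$2$1" "A$2$2", folded matrix2_ex] swapM_def reflM_def matrix2_mult mat_one_matrix2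
    by (elim disjE conjE) (subst matrix2_ex[of A]; simp)+
qed

lemma carrier_GL2Z: "carrier GL2Z = {A. invertible A}" by (simp add: GL2Z_def)
lemma mult_GL2Z: "A \<otimes>\<^bsub>GL2Z\<^esub> B = A ** B" by (simp add: GL2Z_def)
lemma one_GL2Z: "\<one>\<^bsub>GL2Z\<^esub> = mat 1" by (simp add: GL2Z_def)

lemma group_GL2Z: "group GL2Z"
proof (rule groupI)
  show "x \<otimes>\<^bsub>GL2Z\<^esub> y \<in> carrier GL2Z" if "x \<in> carrier GL2Z" "y \<in> carrier GL2Z" for x y
    using that by (simp add: carrier_GL2Z mult_GL2Z invertible_mult)
  show "\<exists>y\<in>carrier GL2Z. y \<otimes>\<^bsub>GL2Z\<^esub> x = \<one>\<^bsub>GL2Z\<^esub>" if "x \<in> carrier GL2Z" for x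
    using that by (auto simp: carrier_GL2Z mult_GL2Z one_GL2Z invertible_def)
qed (auto simp: carrier_GL2Z mult_GL2Z one_GL2Z matrix_mul_assoc invertible_def intro!: exI[of _ "mat 1"])

lemma signed_perm_GL2Z: "signed_perm \<subseteq> carrier GL2Z"
  by (auto simp: signed_perm_def carrier_GL2Z invertible_def)

lemma signed_perm_subgroup: "subgroup signed_perm GL2Z"
proof -
  interpret group GL2Z by (rule group_GL2Z)
  show ?thesis
  proof (rule subgroupI[OF signed_perm_GL2Z])
    show "signed_perm \<noteq> {}" using signed_perm_one by blast
    show "inv\<^bsub>GL2Z\<^esub> A \<in> signed_perm" if "A \<in> signed_perm" for A
    proof -
      have "inv\<^bsub>GL2Z\<^esub> A = adj A"
        by (rule inv_equality) (use that signed_perm_GL2Z signed_perm_adj in \<open>auto simp: mult_GL2Z one_GL2Z signed_perm_def\<close>)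
      then show ?thesis using signed_perm_adj[OF that] by simp
    qed
  qed (simp add: mult_GL2Z signed_perm_mult)
qed

lemma carrier_D4: "carrier D4 = signed_perm"
proof -
  interpret group GL2Z by (rule group_GL2Z)
  define R where "R = matrix2 0 (-1) 1 0"
  have g: "carrier D4 = generate GL2Z (carrier GL2Z \<inter> {R, reflM})"
    by (simp add: D4_def carrier_subgroup_generated R_def reflM_def matrix2_def)
  have gens: "R \<in> signed_perm" "reflM \<in> signed_perm" by (simp_all add: R_def reflM_def signed_perm_matrix2)
  show ?thesis
  proof
    show "carrier D4 \<subseteq> signed_perm" unfolding g
      by (rule generate_subgroup_incl[OF _ signed_perm_subgroup]) (use gens in auto)
    have i: "R \<in> carrier D4" "reflM \<in> carrier D4" unfolding g by (rule generate.incl; use gens signed_perm_GL2Z in blast)+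
    have m: "A ** B \<in> carrier D4" if "A \<in> carrier D4" "B \<in> carrier D4" for A B
      using generate.eng[of A GL2Z _ B] that unfolding g mult_GL2Z by blast
    have o: "mat 1 \<in> carrier D4" using generate.one[of GL2Z] unfolding g one_GL2Z by blast
    have "swapM = reflM ** R" by (simp add: swapM_def reflM_def R_def matrix2_mult)
    then have s: "swapM \<in> carrier D4" using m[OF i(2) i(1)] by simp
    show "signed_perm \<subseteq> carrier D4"
    proof
      fix A assume "A \<in> signed_perm"
      then show "A \<in> carrier D4" by (rule signed_perm_induct) (fact o s i(2) m)+
    qed
  qed
qed

lemma mult_D4: "A \<otimes>\<^bsub>D4\<^esub> B = A ** B"
  by (simp add: D4_def subgroup_generated_def mult_GL2Z)

section \<open>Rotations and reflections of configurations\<close>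

text \<open>The matrix acts about the centre of the square, so that the signed permutation matrices
  map the unit square to itself.\<close>

definition act_tile :: "int^2^2 \<Rightarrow> tile \<Rightarrow> tile" where
  "act_tile A = image (\<lambda>((a, b), m). ((1/2 + of_int (A$1$1) * (a - 1/2) + of_int (A$1$2) * (b - 1/2),
      1/2 + of_int (A$2$1) * (a - 1/2) + of_int (A$2$2) * (b - 1/2)), m))"

lemma act_tile_mult: "act_tile (A ** B) t = act_tile A (act_tile B t)"
  unfolding act_tile_def image_image
  by (rule image_cong[OF refl]) (auto simp: mat2_mult algebra_simps)

lemma act_tile_one: "act_tile (mat 1) t = t"
  unfolding act_tile_def mat_one_matrix2 by (auto simp: image_iff)

lemma act_tile_swap: "act_tile swapM t = transpose_tile t"
  unfolding act_tile_def transpose_tile_def swapM_def by (rule image_cong) auto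

lemma act_tile_refl: "act_tile reflM t = reflect_tile t"
  unfolding act_tile_def reflect_tile_def reflM_def by (rule image_cong) auto

definition act_conf :: "int^2^2 \<Rightarrow> tile config \<Rightarrow> tile config" where
  "act_conf A x = (\<lambda>p. act_tile A (x (adj A *v p)))"

lemma act_conf_mult: "act_conf (A ** B) x = act_conf A (act_conf B x)"
  by (simp add: act_conf_def act_tile_mult adj_mult matrix_vector_mul_assoc)

lemma act_conf_one: "act_conf (mat 1) x = x"
  by (simp add: act_conf_def act_tile_one)

lemma act_conf_shift: "A \<in> signed_perm \<Longrightarrow> act_conf A (shift q x) = shift (A *v q) (act_conf A x)"
  by (simp add: act_conf_def shift_def matrix_vector_mult_diff_distrib signed_perm_vec)

lemma act_conf_swap: "act_conf swapM (realize y) = realize (transposed y)"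
proof
  fix p
  have "(adj swapM *v p) $ 1 = p $ 2" "(adj swapM *v p) $ 2 = p $ 1" by (simp_all add: swapM_def adj_matrix2 mat2_vec)
  then show "act_conf swapM (realize y) p = realize (transposed y) p"
    by (simp add: act_conf_def realize_def act_tile_swap transpose_tile_of transposed_def)
qed

lemma act_conf_refl: "act_conf reflM (realize y) = realize (transposed (reflected (transposed y)))"
proof
  fix p
  have "(adj reflM *v p) $ 1 = - (p $ 1)" "(adj reflM *v p) $ 2 = p $ 2" by (simp_all add: reflM_def adj_matrix2 mat2_vec)
  then show "act_conf reflM (realize y) p = realize (transposed (reflected (transposed y))) p"
    by (simp add: act_conf_def realize_def act_tile_refl reflect_tile_of transposed_def reflected_def mirror_atile_def)
qed

lemma act_conf_X:
  assumes "A \<in> signed_perm" shows "\<forall>x\<in>X_Rob. act_conf A x \<in> X_Rob"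
proof (rule signed_perm_induct[OF assms])
  show "\<forall>x\<in>X_Rob. act_conf swapM x \<in> X_Rob" "\<forall>x\<in>X_Rob. act_conf reflM x \<in> X_Rob"
    by (auto simp: X_Rob_realize act_conf_swap act_conf_refl)
qed (simp_all add: act_conf_one act_conf_mult)

lemma shift_X: "x \<in> X_Rob \<Longrightarrow> shift p x \<in> X_Rob"
  by (auto simp: X_Rob_realize shift_realize)

lemma shift_shift: "shift p (shift q x) = shift (p + q) x"
  by (simp add: shift_def algebra_simps)

lemma shift_0: "shift 0 x = x" by (simp add: shift_def)

lemma act_tile_alphabet:
  assumes "A \<in> signed_perm" shows "\<forall>t\<in>robinson_alphabet. act_tile A t \<in> robinson_alphabet"
proof (rule signed_perm_induct[OF assms])
  show "\<forall>t\<in>robinson_alphabet. act_tile swapM t \<in> robinson_alphabet" "\<forall>t\<in>robinson_alphabet. act_tile reflM t \<in> robinson_alphabet"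
    by (auto simp: act_tile_swap act_tile_refl alphabet_tile_of transpose_tile_of reflect_tile_of)
qed (simp_all add: act_tile_one act_tile_mult)

definition sym_of :: "int^2 \<Rightarrow> int^2^2 \<Rightarrow> tile config \<Rightarrow> tile config" where
  "sym_of p A = (\<lambda>x\<in>X_Rob. shift p (act_conf A x))"

lemma sym_of_X: "A \<in> signed_perm \<Longrightarrow> x \<in> X_Rob \<Longrightarrow> shift p (act_conf A x) \<in> X_Rob"
  using act_conf_X shift_X by blast

lemma continuous_sym_of:
  assumes "A \<in> signed_perm" shows "continuous_map X_topology X_topology (\<lambda>x. shift p (act_conf A x))"
  unfolding continuous_map_in_subtopology
proof
  show "(\<lambda>x. shift p (act_conf A x)) \<in> topspace X_topology \<rightarrow> X_Rob"
    unfolding topspace_X_topology using sym_of_X[OF assms] by blast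
  show "continuous_map X_topology (full_shift_topology robinson_alphabet) (\<lambda>x. shift p (act_conf A x))"
    unfolding full_shift_topology_def continuous_map_componentwise_UNIV
  proof
    fix k
    have "continuous_map X_topology (discrete_topology robinson_alphabet) (\<lambda>x. x (adj A *v (k - p)))"
      unfolding full_shift_topology_def
      by (intro continuous_map_from_subtopology continuous_map_product_projection) simp
    moreover have "continuous_map (discrete_topology robinson_alphabet) (discrete_topology robinson_alphabet) (act_tile A)"
      using act_tile_alphabet[OF assms] by (auto simp: continuous_map_def)
    ultimately have "continuous_map X_topology (discrete_topology robinson_alphabet) (act_tile A \<circ> (\<lambda>x. x (adj A *v (k - p))))"
      by (rule continuous_map_compose)
    then show "continuous_map (subtopology (product_topology (\<lambda>_. discrete_topology robinson_alphabet) UNIV) X_Rob)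
        (discrete_topology robinson_alphabet) (\<lambda>x. shift p (act_conf A x) k)"
      by (simp add: o_def shift_def act_conf_def full_shift_topology_def)
  qed
qed

lemma carrier_Sym: "f \<in> carrier (Sym robinson_alphabet X_Rob) \<longleftrightarrow>
    f \<in> extensional X_Rob \<and> bij_betw f X_Rob X_Rob \<and> continuous_map X_topology X_topology f \<and>
    (\<exists>A. invertible A \<and> (\<forall>p. \<forall>x\<in>X_Rob. f (shift p x) = shift (A *v p) (f x)))"
  by (auto simp: Sym_def Bij_def extended_symmetry_def carrier_GL2Z)

lemma mult_Sym: "f \<in> carrier (Sym robinson_alphabet X_Rob) \<Longrightarrow> g \<in> carrier (Sym robinson_alphabet X_Rob) \<Longrightarrow>
    f \<otimes>\<^bsub>Sym robinson_alphabet X_Rob\<^esub> g = compose X_Rob f g"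
  by (simp add: Sym_def BijGroup_def)

lemma sym_of_Sym:
  assumes "A \<in> signed_perm" shows "sym_of p A \<in> carrier (Sym robinson_alphabet X_Rob)"
  unfolding carrier_Sym
proof (intro conjI exI[of _ A])
  show "sym_of p A \<in> extensional X_Rob" by (simp add: sym_of_def)
  show "bij_betw (sym_of p A) X_Rob X_Rob"
  proof (rule bij_betw_byWitness[where f' = "\<lambda>x. act_conf (adj A) (shift (- p) x)"])
    show "\<forall>x\<in>X_Rob. act_conf (adj A) (shift (- p) (sym_of p A x)) = x"
      using assms by (simp add: sym_of_def shift_shift shift_0 act_conf_one signed_perm_def flip: act_conf_mult)
    show "\<forall>x\<in>X_Rob. sym_of p A (act_conf (adj A) (shift (- p) x)) = x"
      using assms act_conf_X[OF signed_perm_adj[OF assms]] shift_X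
      by (simp add: sym_of_def shift_shift shift_0 act_conf_one signed_perm_def flip: act_conf_mult)
    show "sym_of p A ` X_Rob \<subseteq> X_Rob" using sym_of_X[OF assms] by (auto simp: sym_of_def)
    show "(\<lambda>x. act_conf (adj A) (shift (- p) x)) ` X_Rob \<subseteq> X_Rob"
      using act_conf_X[OF signed_perm_adj[OF assms]] shift_X by blast
  qed
  show "continuous_map X_topology X_topology (sym_of p A)"
    by (rule continuous_map_eq[OF continuous_sym_of[OF assms, of p]]) (simp add: sym_of_def topspace_X_topology del: topspace_subtopology)
  show "invertible A" using assms signed_perm_GL2Z by (auto simp: carrier_GL2Z)
  show "\<forall>q. \<forall>x\<in>X_Rob. sym_of p A (shift q x) = shift (A *v q) (sym_of p A x)"
    using act_conf_shift[OF assms] shift_X by (simp add: sym_of_def shift_shift add.commute)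
qed

lemma sym_of_mult:
  assumes "A \<in> signed_perm" "B \<in> signed_perm"
  shows "compose X_Rob (sym_of p A) (sym_of q B) = sym_of (p + A *v q) (A ** B)"
proof
  fix x
  show "compose X_Rob (sym_of p A) (sym_of q B) x = sym_of (p + A *v q) (A ** B) x"
    using sym_of_X[OF assms(2), of x q]
    by (simp add: sym_of_def compose_def act_conf_shift[OF assms(1)] shift_shift act_conf_mult)
qed

section \<open>From topological symmetries to block maps\<close>

definition abstract_conf :: "tile config \<Rightarrow> atiling" where "abstract_conf x = the_inv realize x"

lemma abstract_conf_realize [simp]: "abstract_conf (realize y) = y"
  unfolding abstract_conf_def by (rule the_inv_f_f) (simp add: inj_def inj_realize)

lemma realize_abstract_conf: "x \<in> X_Rob \<Longrightarrow> realize (abstract_conf x) = x"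
  by (auto simp: X_Rob_realize)

lemma abstract_conf_abs_X: "x \<in> X_Rob \<Longrightarrow> abstract_conf x \<in> abs_X"
  by (auto simp: X_Rob_realize)

lemma realize_X: "y \<in> abs_X \<Longrightarrow> realize y \<in> X_Rob"
  by (simp add: X_Rob_realize)

lemma local_rule_at:
  assumes loc: "\<forall>x\<in>X_Rob. \<forall>y\<in>X_Rob. (\<forall>p\<in>window r. x p = y p) \<longrightarrow> f x 0 = f y 0"
    and sh: "\<And>p x. x \<in> X_Rob \<Longrightarrow> f (shift p x) = shift (A *v p) (f x)"
    and xy: "x \<in> X_Rob" "y \<in> X_Rob"
    and eq: "\<And>q. \<bar>q $ 1 - p $ 1\<bar> \<le> r \<Longrightarrow> \<bar>q $ 2 - p $ 2\<bar> \<le> r \<Longrightarrow> x q = y q"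
  shows "f x (A *v p) = f y (A *v (p :: int^2))"
proof -
  have "shift (- p) x q = shift (- p) y q" if "q \<in> window r" for q
    using that eq[of "q + p"] by (simp add: shift_def window_def)
  then have "f (shift (- p) x) 0 = f (shift (- p) y) 0" using loc shift_X xy by blast
  moreover have "f (shift (- p) z) 0 = f z (A *v p)" if "z \<in> X_Rob" for z
  proof -
    have "A *v (- p) = - (A *v p)" by (simp add: vec2_eq mat2_vec)
    then show ?thesis unfolding sh[OF that] by (simp add: shift_def)
  qed
  ultimately show ?thesis using xy by simp
qed

text \<open>The inverse of \<open>f\<close> is continuous because the space is compact and
  Hausdorff. Both directions therefore have a local rule, and the larger radius serves for
  both.\<close>

lemma ext_sym_of_symmetry:
  assumes bij: "bij_betw f X_Rob X_Rob" and cont: "continuous_map X_topology X_topology f"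
    and AB: "A ** B = mat 1" "B ** A = mat 1"
    and sh: "\<And>p x. x \<in> X_Rob \<Longrightarrow> f (shift p x) = shift (A *v p) (f x)"
  shows "\<exists>r. ext_sym (\<lambda>y. abstract_conf (f (realize y))) (A$1$1) (A$1$2) (A$2$1) (A$2$2) (B$1$1) (B$1$2) (B$2$1) (B$2$2) r"
proof -
  have fX: "f x \<in> X_Rob" if "x \<in> X_Rob" for x using bij that by (auto simp: bij_betw_def)
  have inj: "inj_on f X_Rob" and im: "f ` X_Rob = X_Rob" using bij by (auto simp: bij_betw_def)
  have "homeomorphic_map X_topology X_topology f"
    by (rule continuous_imp_homeomorphic_map[OF cont compact_X_topology Hausdorff_X_topology])
      (use inj im in \<open>simp_all add: topspace_X_topology del: topspace_subtopology\<close>)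
  then obtain g where "homeomorphic_maps X_topology X_topology f g" unfolding homeomorphic_map_maps by blast
  then have g: "continuous_map X_topology X_topology g" "\<And>x. x \<in> X_Rob \<Longrightarrow> g (f x) = x" "\<And>x. x \<in> X_Rob \<Longrightarrow> f (g x) = x"
    unfolding homeomorphic_maps_def topspace_X_topology by auto
  have gX: "g x \<in> X_Rob" if "x \<in> X_Rob" for x
    using continuous_map_image_subset_topspace[OF g(1)] that unfolding topspace_X_topology by blast
  have gsh: "g (shift p x) = shift (B *v p) (g x)" if x: "x \<in> X_Rob" for p x
  proof -
    have "f (shift (B *v p) (g x)) = shift p x"
      using sh[OF gX[OF x], of "B *v p"] g(3)[OF x] by (simp add: matrix_vector_mul_assoc AB)
    then show ?thesis using g(2)[OF shift_X[OF gX[OF x]]] by metis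
  qed
  obtain r1 where r1: "0 \<le> r1" "\<forall>x\<in>X_Rob. \<forall>y\<in>X_Rob. (\<forall>p\<in>window r1. x p = y p) \<longrightarrow> f x 0 = f y 0"
    using local_rule[OF cont] by blast
  obtain r2 where r2: "0 \<le> r2" "\<forall>x\<in>X_Rob. \<forall>y\<in>X_Rob. (\<forall>p\<in>window r2. x p = y p) \<longrightarrow> g x 0 = g y 0"
    using local_rule[OF g(1)] by blast
  define r where "r = max r1 r2"
  define F where "F = (\<lambda>y. abstract_conf (f (realize y)))"
  have cF: "realize (F y) = f (realize y)" if "y \<in> abs_X" for y
    unfolding F_def by (rule realize_abstract_conf[OF fX[OF realize_X[OF that]]])
  have at: "realize y p = realize w p \<longleftrightarrow> y (p $ 1) (p $ 2) = w (p $ 1) (p $ 2)" for y w p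
    using inj_tile_of by (simp add: realize_def inj_eq)
  have vv: "(A *v vector [P, Q]) $ 1 = A$1$1 * P + A$1$2 * Q" "(A *v vector [P, Q]) $ 2 = A$2$1 * P + A$2$2 * Q" for P Q
    by (simp_all add: mat2_vec)
  have inv: "A *v (B *v vector [i, j]) = vector [i, j]" "B *v (A *v vector [i, j]) = vector [i, j]" for i j :: int
    by (simp_all add: matrix_vector_mul_assoc AB)
  have "ext_sym F (A$1$1) (A$1$2) (A$2$1) (A$2$2) (B$1$1) (B$1$2) (B$2$1) (B$2$2) r"
  proof
    show "0 \<le> r" using r1(1) by (simp add: r_def)
    show "F z \<in> abs_X" if "z \<in> abs_X" for z unfolding F_def by (rule abstract_conf_abs_X[OF fX[OF realize_X[OF that]]])
    show "z = w" if "z \<in> abs_X" "w \<in> abs_X" "F z = F w" for z w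
      using cF[OF that(1)] cF[OF that(2)] that inj_onD[OF inj] realize_X inj_realize by metis
    show "F (sh u v z) = sh (A$1$1 * u + A$1$2 * v) (A$2$1 * u + A$2$2 * v) (F z)" if z: "z \<in> abs_X" for z u v
    proof -
      have "realize (F (sh u v z)) = f (realize (sh u v z))" by (rule cF) (simp add: z)
      also have "\<dots> = f (shift (vector [u, v]) (realize z))" by (simp add: shift_realize)
      also have "\<dots> = shift (A *v vector [u, v]) (realize (F z))" using sh[OF realize_X[OF z]] cF[OF z] by simp
      also have "\<dots> = realize (sh (A$1$1 * u + A$1$2 * v) (A$2$1 * u + A$2$2 * v) (F z))"
        unfolding shift_realize vv ..
      finally show ?thesis unfolding inj_realize .
    qed
    show "F z (A$1$1 * P + A$1$2 * Q) (A$2$1 * P + A$2$2 * Q) = F w (A$1$1 * P + A$1$2 * Q) (A$2$1 * P + A$2$2 * Q)"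
      if zw: "z \<in> abs_X" "w \<in> abs_X" and eq: "\<And>i j. \<bar>i - P\<bar> \<le> r \<Longrightarrow> \<bar>j - Q\<bar> \<le> r \<Longrightarrow> z i j = w i j" for z w P Q
    proof -
      have "f (realize z) (A *v vector [P, Q]) = f (realize w) (A *v vector [P, Q])"
        by (rule local_rule_at[OF r1(2) sh realize_X[OF zw(1)] realize_X[OF zw(2)]])
          (use eq in \<open>auto simp: at r_def\<close>)
      then have "realize (F z) (A *v vector [P, Q]) = realize (F w) (A *v vector [P, Q])" using cF zw by simp
      then show ?thesis unfolding at vv .
    qed
    show "z P Q = w P Q" if zw: "z \<in> abs_X" "w \<in> abs_X"
      and eq: "\<And>i j. \<bar>i - (A$1$1 * P + A$1$2 * Q)\<bar> \<le> r \<Longrightarrow> \<bar>j - (A$2$1 * P + A$2$2 * Q)\<bar> \<le> r \<Longrightarrow> F z i j = F w i j"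
      for z w P Q
    proof -
      have "g (realize (F z)) (B *v (A *v vector [P, Q])) = g (realize (F w)) (B *v (A *v vector [P, Q]))"
      proof (rule local_rule_at[OF r2(2) gsh])
        show "realize (F z) \<in> X_Rob" "realize (F w) \<in> X_Rob" using cF fX realize_X zw by auto
        fix q :: "int^2" assume "\<bar>q $ 1 - (A *v vector [P, Q]) $ 1\<bar> \<le> r2" "\<bar>q $ 2 - (A *v vector [P, Q]) $ 2\<bar> \<le> r2"
        then show "realize (F z) q = realize (F w) q" unfolding at vv by (intro eq) (auto simp: r_def)
      qed
      then have "realize z (vector [P, Q]) = realize w (vector [P, Q])"
        unfolding inv cF[OF zw(1)] cF[OF zw(2)] g(2)[OF realize_X[OF zw(1)]] g(2)[OF realize_X[OF zw(2)]] .
      then show ?thesis unfolding at by simp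
    qed
    fix i j
    show "A$1$1 * (B$1$1 * i + B$1$2 * j) + A$1$2 * (B$2$1 * i + B$2$2 * j) = i"
      "A$2$1 * (B$1$1 * i + B$1$2 * j) + A$2$2 * (B$2$1 * i + B$2$2 * j) = j"
      using inv(1)[of i j] unfolding vec2_eq mat2_vec vector_2 by simp_all
    show "B$1$1 * (A$1$1 * i + A$1$2 * j) + B$1$2 * (A$2$1 * i + A$2$2 * j) = i"
      "B$2$1 * (A$1$1 * i + A$1$2 * j) + B$2$2 * (A$2$1 * i + A$2$2 * j) = j"
      using inv(2)[of i j] unfolding vec2_eq mat2_vec vector_2 by simp_all
  qed
  then show ?thesis unfolding F_def by blast
qed

lemma int_unit: "(a::int) * b = 1 \<Longrightarrow> (a = 1 \<or> a = - 1) \<and> (b = 1 \<or> b = - 1)"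
  using zmult_eq_1_iff by auto

lemma zero_rows_signed_perm:
  assumes "B ** A = mat 1" "A ** B = mat 1" "B$1$1 = 0 \<or> B$1$2 = 0" "B$2$1 = 0 \<or> B$2$2 = 0"
  shows "B \<in> signed_perm"
proof -
  have e: "B$1$1 * A$1$1 + B$1$2 * A$2$1 = 1" "B$1$1 * A$1$2 + B$1$2 * A$2$2 = 0"
    "B$2$1 * A$1$1 + B$2$2 * A$2$1 = 0" "B$2$1 * A$1$2 + B$2$2 * A$2$2 = 1"
    using assms(1) unfolding mat2_eq mat2_mult mat2_one by simp_all
  have "matrix2 (B$1$1) (B$1$2) (B$2$1) (B$2$2) \<in> signed_perm"
    unfolding signed_perm_matrix2
  proof -
    \<comment> \<open>The first and the last case have a zero column and contradict
      invertibility.\<close>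
    consider "B$1$1 = 0" "B$2$1 = 0" | "B$1$1 = 0" "B$2$2 = 0" | "B$1$2 = 0" "B$2$1 = 0" | "B$1$2 = 0" "B$2$2 = 0"
      using assms(3,4) by blast
    then show "(B$1$2 = 0 \<and> B$2$1 = 0 \<and> (B$1$1 = 1 \<or> B$1$1 = - 1) \<and> (B$2$2 = 1 \<or> B$2$2 = - 1)) \<or>
       (B$1$1 = 0 \<and> B$2$2 = 0 \<and> (B$1$2 = 1 \<or> B$1$2 = - 1) \<and> (B$2$1 = 1 \<or> B$2$1 = - 1))"
    proof cases
      case 1 then show ?thesis using e int_unit[of "B$1$2" "A$2$1"] by auto
    next
      case 2 then show ?thesis using e int_unit[of "B$1$2" "A$2$1"] int_unit[of "B$2$1" "A$1$2"] by auto
    next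
      case 3 then show ?thesis using e int_unit[of "B$1$1" "A$1$1"] int_unit[of "B$2$2" "A$2$2"] by auto
    next
      case 4 then show ?thesis using e int_unit[of "B$1$1" "A$1$1"] by auto
    qed
  qed
  then show ?thesis by (simp flip: matrix2_ex)
qed

lemma matrix_signed_perm:
  assumes "bij_betw f X_Rob X_Rob" "continuous_map X_topology X_topology f" "A ** B = mat 1" "B ** A = mat 1"
    and "\<And>p x. x \<in> X_Rob \<Longrightarrow> f (shift p x) = shift (A *v p) (f x)"
  shows "A \<in> signed_perm"
proof -
  obtain r where r: "ext_sym (\<lambda>y. abstract_conf (f (realize y))) (A$1$1) (A$1$2) (A$2$1) (A$2$2) (B$1$1) (B$1$2) (B$2$1) (B$2$2) r"
    using ext_sym_of_symmetry[OF assms] by blast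
  have B: "B \<in> signed_perm" by (rule zero_rows_signed_perm[OF assms(4,3) ext_sym.first_row[OF r] ext_sym.second_row[OF r]])
  have "A = A ** (B ** adj B)" using B by (simp add: signed_perm_def)
  also have "\<dots> = adj B" by (simp add: matrix_mul_assoc assms(3))
  finally show ?thesis using signed_perm_adj[OF B] by simp
qed

lemma Sym_eq_sym_of:
  assumes f: "f \<in> carrier (Sym robinson_alphabet X_Rob)"
  shows "\<exists>p. \<exists>A\<in>signed_perm. f = sym_of p A"
proof -
  obtain A where A: "invertible A" "\<And>p x. x \<in> X_Rob \<Longrightarrow> f (shift p x) = shift (A *v p) (f x)"
    and fe: "f \<in> extensional X_Rob" and bij: "bij_betw f X_Rob X_Rob" and cont: "continuous_map X_topology X_topology f"
    using f unfolding carrier_Sym by blast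
  obtain B where B: "A ** B = mat 1" "B ** A = mat 1" using A(1) by (auto simp: invertible_def)
  have signed_perm: "A \<in> signed_perm" by (rule matrix_signed_perm[OF bij cont B A(2)])
  then have tA: "adj A \<in> signed_perm" "adj A ** A = mat 1" "A ** adj A = mat 1" by (auto simp: signed_perm_def)
  have fX: "f x \<in> X_Rob" if "x \<in> X_Rob" for x using bij that by (auto simp: bij_betw_def)
  \<comment> \<open>Undoing the matrix of \<open>f\<close> leaves a symmetry that commutes with all
    shifts.\<close>
  define h where "h = (\<lambda>x. act_conf (adj A) (f x))"
  have hsh: "h (shift p x) = shift (mat 1 *v p) (h x)" if "x \<in> X_Rob" for p x
    using that signed_perm by (simp add: h_def A(2) act_conf_shift[OF tA(1)] signed_perm_vec)
  have rb: "bij_betw (act_conf (adj A)) X_Rob X_Rob"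
  proof (rule bij_betw_byWitness[where f' = "act_conf A"])
    show "\<forall>x\<in>X_Rob. act_conf A (act_conf (adj A) x) = x" "\<forall>x\<in>X_Rob. act_conf (adj A) (act_conf A x) = x"
      using tA by (simp_all add: act_conf_one flip: act_conf_mult)
    show "act_conf (adj A) ` X_Rob \<subseteq> X_Rob" "act_conf A ` X_Rob \<subseteq> X_Rob" using act_conf_X[OF tA(1)] act_conf_X[OF signed_perm] by blast+
  qed
  have hb: "bij_betw h X_Rob X_Rob" using bij_betw_trans[OF bij rb] by (simp add: h_def o_def)
  have hc: "continuous_map X_topology X_topology h"
    using continuous_map_compose[OF cont continuous_sym_of[OF tA(1), of 0]] by (simp add: h_def o_def shift_0)
  obtain r where "ext_sym (\<lambda>y. abstract_conf (h (realize y))) ((mat 1 :: int^2^2)$1$1) ((mat 1 :: int^2^2)$1$2) ((mat 1 :: int^2^2)$2$1) ((mat 1 :: int^2^2)$2$2)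
      ((mat 1 :: int^2^2)$1$1) ((mat 1 :: int^2^2)$1$2) ((mat 1 :: int^2^2)$2$1) ((mat 1 :: int^2^2)$2$2) r"
    using ext_sym_of_symmetry[OF hb hc _ _ hsh, of "mat 1"] by auto
  then have "ext_sym (\<lambda>y. abstract_conf (h (realize y))) 1 0 0 1 1 0 0 1 r" unfolding mat2_one .
  then obtain u v where uv: "\<And>z. z \<in> abs_X \<Longrightarrow> abstract_conf (h (realize z)) = sh u v z" using ext_sym_id_shift by blast
  define q where "q = (vector [u, v] :: int^2)"
  have h: "h x = shift q x" if x: "x \<in> X_Rob" for x
  proof -
    have "h x \<in> X_Rob" using hb x by (auto simp: bij_betw_def)
    then have "h x = realize (abstract_conf (h (realize (abstract_conf x))))" using x by (simp add: realize_abstract_conf)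
    also have "\<dots> = shift q (realize (abstract_conf x))" by (simp add: uv abstract_conf_abs_X[OF x] shift_realize q_def)
    finally show ?thesis using x by (simp add: realize_abstract_conf)
  qed
  have "f x = shift (A *v q) (act_conf A x)" if x: "x \<in> X_Rob" for x
  proof -
    have "f x = act_conf A (h x)" using tA by (simp add: h_def act_conf_one flip: act_conf_mult)
    also have "\<dots> = shift (A *v q) (act_conf A x)" using h[OF x] by (simp add: act_conf_shift[OF signed_perm])
    finally show ?thesis .
  qed
  then have "f = sym_of (A *v q) A"
    unfolding sym_of_def using fe by (intro ext) (auto simp: extensional_def restrict_def)
  then show ?thesis using signed_perm by blast
qed

section \<open>Uniqueness of the parameters and the isomorphism\<close>

lemma seeded_aperiodic:
  assumes "sh u v (seeded t) = seeded t" shows "u = 0 \<and> v = 0"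
proof -
  \<comment> \<open>A period is also a phase, and the phase is zero modulo every power of
    two.\<close>
  have "2 ^ n dvd u \<and> 2 ^ n dvd v" for n
  proof -
    have "at_level n u v (seeded t)" using at_level_shift[OF at_level_seeded[of n t], of u v] assms by simp
    from at_level_unique[OF this at_level_seeded[of n t] agree_widely_refl] have "2 ^ Suc n dvd u \<and> 2 ^ Suc n dvd v" by simp
    then show ?thesis using dvd_mult_right unfolding power_Suc by blast
  qed
  then show ?thesis using dvd_all_pow2 by blast
qed

lemma sym_of_shift: "A \<in> signed_perm \<Longrightarrow> x \<in> X_Rob \<Longrightarrow> sym_of p A (shift q x) = shift (A *v q) (sym_of p A x)"
  using act_conf_shift shift_X by (simp add: sym_of_def shift_shift add.commute)

text \<open>Different shifts of an aperiodic point are different. Shifting a preimage of such a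
  point recovers the matrix, and then the translation vector.\<close>

lemma sym_of_inj:
  assumes "A \<in> signed_perm" "B \<in> signed_perm" "sym_of p A = sym_of q B" shows "p = q \<and> A = B"
proof -
  define x where "x = realize (seeded (column_seed NoRed))"
  have xX: "x \<in> X_Rob" unfolding x_def by (rule realize_X) simp
  have ap: "s = s'" if "shift s x = shift s' x" for s s'
  proof -
    have "shift (s - s') x = shift (- s') (shift s x)" by (simp add: shift_shift)
    also have "\<dots> = x" using that by (simp add: shift_shift shift_0)
    finally have "sh ((s - s') $ 1) ((s - s') $ 2) (seeded (column_seed NoRed)) = seeded (column_seed NoRed)"
      unfolding x_def shift_realize inj_realize .
    from seeded_aperiodic[OF this] show ?thesis by (simp add: vec2_eq)
  qed
  have "bij_betw (sym_of p A) X_Rob X_Rob" using sym_of_Sym[OF assms(1)] by (simp add: carrier_Sym)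
  then obtain z where z: "z \<in> X_Rob" "sym_of p A z = x" using xX by (auto simp: bij_betw_def image_iff dest!: equalityD2)
  then have "sym_of q B z = x" using assms(3) by simp
  then have sh: "sym_of p A (shift s z) = shift (A *v s) x" "sym_of q B (shift s z) = shift (B *v s) x" for s
    using z sym_of_shift[OF assms(1) z(1), of p s] sym_of_shift[OF assms(2) z(1), of q s] by simp_all
  have Av: "A *v s = B *v s" for s using sh[of s] assms(3) by (intro ap) simp
  then have AB: "A = B"
    using Av[of "vector [1, 0]"] Av[of "vector [0, 1]"] by (simp add: vec2_eq mat2_vec mat2_eq)
  define w where "w = act_conf (adj A) x"
  have w: "w \<in> X_Rob" "act_conf A w = x"
    using act_conf_X[OF signed_perm_adj[OF assms(1)]] xX assms(1) by (auto simp: w_def signed_perm_def act_conf_one simp flip: act_conf_mult)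
  have "shift p x = shift q x"
    using fun_cong[OF assms(3), of w] w AB by (simp add: sym_of_def)
  then show ?thesis using ap AB by blast
qed

text \<open>The isomorphism below is built starting from the semidirect product. Neither side has
  been shown to be a group, so it is inverted by hand from the closure of \<open>G\<close>.\<close>

lemma is_iso_flip:
  assumes h: "h \<in> iso G H" and closed: "\<And>x y. x \<in> carrier G \<Longrightarrow> y \<in> carrier G \<Longrightarrow> x \<otimes>\<^bsub>G\<^esub> y \<in> carrier G"
  shows "H \<cong> G"
proof -
  define k where "k = inv_into (carrier G) h"
  have b: "bij_betw h (carrier G) (carrier H)"
    and m: "\<And>x y. x \<in> carrier G \<Longrightarrow> y \<in> carrier G \<Longrightarrow> h (x \<otimes>\<^bsub>G\<^esub> y) = h x \<otimes>\<^bsub>H\<^esub> h y"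
    using h by (auto simp: iso_def hom_def)
  have k: "bij_betw k (carrier H) (carrier G)" unfolding k_def by (rule bij_betw_inv_into[OF b])
  have hk: "h (k y) = y" "k y \<in> carrier G" if "y \<in> carrier H" for y
    using b k that by (auto simp: k_def bij_betw_inv_into_right bij_betw_def f_inv_into_f)
  have kh: "k (h x) = x" if "x \<in> carrier G" for x
    unfolding k_def by (rule bij_betw_inv_into_left[OF b that])
  have "k (x \<otimes>\<^bsub>H\<^esub> y) = k x \<otimes>\<^bsub>G\<^esub> k y" if "x \<in> carrier H" "y \<in> carrier H" for x y
    using m[OF hk(2)[OF that(1)] hk(2)[OF that(2)]] hk that kh[OF closed[OF hk(2)[OF that(1)] hk(2)[OF that(2)]]] by simp
  then have "k \<in> iso H G" using k by (auto simp: iso_def hom_def bij_betw_def)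
  then show ?thesis by (rule is_isoI)
qed

theorem proposition22:
  shows "Sym robinson_alphabet X_Rob \<cong> semidirect_product Z2 D4 (*v)"
proof (rule is_iso_flip)
  let ?G = "semidirect_product Z2 D4 (*v)"
  have cG: "carrier ?G = UNIV \<times> signed_perm"
    by (simp add: semidirect_product_def Z2_def carrier_D4)
  have mG: "(p, A) \<otimes>\<^bsub>?G\<^esub> (q, B) = (p + A *v q, A ** B)" for p A q B
    by (simp add: semidirect_product_def Z2_def mult_D4)
  show "x \<otimes>\<^bsub>?G\<^esub> y \<in> carrier ?G" if "x \<in> carrier ?G" "y \<in> carrier ?G" for x y
    using that by (cases x; cases y) (auto simp: cG mG signed_perm_mult)
  show "(\<lambda>(p, A). sym_of p A) \<in> iso ?G (Sym robinson_alphabet X_Rob)"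
    unfolding iso_def
  proof (intro CollectI conjI)
    show "(\<lambda>(p, A). sym_of p A) \<in> hom ?G (Sym robinson_alphabet X_Rob)"
    proof (rule homI)
      fix x y assume "x \<in> carrier ?G" "y \<in> carrier ?G"
      then obtain p A q B where "x = (p, A)" "y = (q, B)" "A \<in> signed_perm" "B \<in> signed_perm" by (auto simp: cG)
      then show "(case x \<otimes>\<^bsub>?G\<^esub> y of (p, A) \<Rightarrow> sym_of p A) =
          (case x of (p, A) \<Rightarrow> sym_of p A) \<otimes>\<^bsub>Sym robinson_alphabet X_Rob\<^esub> (case y of (p, A) \<Rightarrow> sym_of p A)"
        by (simp add: mG mult_Sym[OF sym_of_Sym sym_of_Sym] sym_of_mult)
    qed (auto simp: cG sym_of_Sym)
    show "bij_betw (\<lambda>(p, A). sym_of p A) (carrier ?G) (carrier (Sym robinson_alphabet X_Rob))"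
      unfolding bij_betw_def
    proof
      show "inj_on (\<lambda>(p, A). sym_of p A) (carrier ?G)"
        by (rule inj_onI) (auto simp: cG dest: sym_of_inj)
      show "(\<lambda>(p, A). sym_of p A) ` carrier ?G = carrier (Sym robinson_alphabet X_Rob)"
        using sym_of_Sym Sym_eq_sym_of by (force simp: cG)
    qed
  qed
qed


end
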